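(* Let $Q$ be an irreducible Dirichlet form on $L^2(X,m)$, $(X,m)$ a $\sigma$-finite measure space. Then the following are equivalent: (i) $Q$ is recurrent; (ii) for all $u\in D(L_e)$ with $L_eu\in L^1(X,m)$, $\int_X L_eu\,dm=0$; (iii) the constant function $1$ belongs to $D(L_e)$ and $L_e1=0$.
   Context: A Dirichlet form is a densely defined, nonnegative, closed, symmetric bilinear form on $L^2(X,m)$ satisfying the contraction property, with generator $L$ and semigroup $T_t=e^{-tL}$ (extended to $L^1$). For $f\in L^1_+(X,m)$, $Gf:=\lim_{n\to\infty}\int_0^nT_sf\,ds$ ($m$-a.e., possibly infinite). $Q$ is recurrent if for every $f\in L^1_+(X,m)$ either $Gf=0$ a.e. or $Gf=\infty$ a.e. A measurable set $A$ is $Q$-invariant if for all $f\in D(Q)$, $1_Af\in D(Q)$ and $Q(f)=Q(1_Af)+Q(1_{X\setminus A}f)$; $Q$ is irreducible if every $Q$-invariant $A$ has $m(A)=0$ or $m(X\setminus A)=0$. The extended Dirichlet space $D(Q)_e$ consists of all $m$-a.e. finite measurable $f$ for which there is a $Q$-Cauchy sequence $(f_n)\subseteq D(Q)$ with $f_n\to f$ a.e.; $Q(f):=\lim Q(f_n)$, extended to a bilinear form by polarization. $L_e$ has domain $D(L_e)=\{v\in D(Q)_e\mid\exists w\in L^2(X,m):\ \langle w,u\rangle=Q(v,u)\ \forall u\in D(Q)\}$ and $L_ev=w$. *)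

theory Defs
  imports "HOL-Analysis.Analysis"
begin

text \<open>Elements of L^p(X,m) are represented by real-valued functions on space M;
  all notions below are invariant under m-a.e. equality.\<close>

definition L2 :: "'a measure \<Rightarrow> ('a \<Rightarrow> real) set" where
  "L2 M = {f. f \<in> borel_measurable M \<and> integrable M (\<lambda>x. (f x)\<^sup>2)}"

definition L1 :: "'a measure \<Rightarrow> ('a \<Rightarrow> real) set" where
  "L1 M = {f. integrable M f}"

definition ip :: "'a measure \<Rightarrow> ('a \<Rightarrow> real) \<Rightarrow> ('a \<Rightarrow> real) \<Rightarrow> real" where
  "ip M f g = (\<integral>x. f x * g x \<partial>M)"

definition l2norm :: "'a measure \<Rightarrow> ('a \<Rightarrow> real) \<Rightarrow> real" where
  "l2norm M f = sqrt (\<integral>x. (f x)\<^sup>2 \<partial>M)"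

definition l1norm :: "'a measure \<Rightarrow> ('a \<Rightarrow> real) \<Rightarrow> real" where
  "l1norm M f = (\<integral>x. \<bar>f x\<bar> \<partial>M)"

definition dirichlet_form ::
  "'a measure \<Rightarrow> ('a \<Rightarrow> real) set \<Rightarrow> (('a \<Rightarrow> real) \<Rightarrow> ('a \<Rightarrow> real) \<Rightarrow> real) \<Rightarrow> bool" where
  "dirichlet_form M D Q \<longleftrightarrow>
     D \<subseteq> L2 M
   \<comment> \<open>well defined on a.e.-classes\<close>
   \<and> (\<forall>f\<in>D. \<forall>g. g \<in> borel_measurable M \<and> (AE x in M. f x = g x) \<longrightarrow>
          g \<in> D \<and> (\<forall>h\<in>D. Q g h = Q f h))
   \<comment> \<open>linear subspace\<close>
   \<and> (\<lambda>x. 0) \<in> D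
   \<and> (\<forall>f\<in>D. \<forall>g\<in>D. (\<lambda>x. f x + g x) \<in> D)
   \<and> (\<forall>f\<in>D. \<forall>c::real. (\<lambda>x. c * f x) \<in> D)
   \<comment> \<open>symmetric, bilinear, nonnegative\<close>
   \<and> (\<forall>f\<in>D. \<forall>g\<in>D. Q f g = Q g f)
   \<and> (\<forall>f\<in>D. \<forall>g\<in>D. \<forall>h\<in>D. Q (\<lambda>x. f x + g x) h = Q f h + Q g h)
   \<and> (\<forall>f\<in>D. \<forall>h\<in>D. \<forall>c::real. Q (\<lambda>x. c * f x) h = c * Q f h)
   \<and> (\<forall>f\<in>D. Q f f \<ge> 0)
   \<comment> \<open>densely defined\<close>
   \<and> (\<forall>f\<in>L2 M. \<forall>e>0. \<exists>g\<in>D. l2norm M (\<lambda>x. f x - g x) < e)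
   \<comment> \<open>closed: D complete w.r.t. the form norm Q(f) + \<parallel>f\<parallel>^2\<close>
   \<and> (\<forall>u. (\<forall>n. u n \<in> D) \<and>
          (\<forall>e>0. \<exists>N. \<forall>n\<ge>N. \<forall>m\<ge>N.
             Q (\<lambda>x. u n x - u m x) (\<lambda>x. u n x - u m x) + (l2norm M (\<lambda>x. u n x - u m x))\<^sup>2 < e)
        \<longrightarrow> (\<exists>v\<in>D. (\<lambda>n. Q (\<lambda>x. u n x - v x) (\<lambda>x. u n x - v x)
                          + (l2norm M (\<lambda>x. u n x - v x))\<^sup>2) \<longlonglongrightarrow> 0))
   \<comment> \<open>contraction property (normal contractions)\<close>
   \<and> (\<forall>f\<in>D. \<forall>C::real \<Rightarrow> real. C 0 = 0 \<and> (\<forall>s t. \<bar>C s - C t\<bar> \<le> \<bar>s - t\<bar>) \<longrightarrow>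
          (\<lambda>x. C (f x)) \<in> D \<and> Q (\<lambda>x. C (f x)) (\<lambda>x. C (f x)) \<le> Q f f)"

definition gen_rel ::
  "'a measure \<Rightarrow> ('a \<Rightarrow> real) set \<Rightarrow> (('a \<Rightarrow> real) \<Rightarrow> ('a \<Rightarrow> real) \<Rightarrow> real)
     \<Rightarrow> ('a \<Rightarrow> real) \<Rightarrow> ('a \<Rightarrow> real) \<Rightarrow> bool" where
  "gen_rel M D Q v w \<longleftrightarrow> v \<in> D \<and> w \<in> L2 M \<and> (\<forall>u\<in>D. ip M w u = Q v u)"

text \<open>T is the semigroup e^{-tL} on L^2, extended to L^1.
  On L^2 it is characterised as the (unique) solution of the abstract Cauchy problem
  u(0) = f, u'(t) = -L u(t) (t>0), u continuous on [0,\<infinity>);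
  on L^1 it is the (unique) L^1-contractive extension.\<close>
definition semigroup_of ::
  "'a measure \<Rightarrow> ('a \<Rightarrow> real) set \<Rightarrow> (('a \<Rightarrow> real) \<Rightarrow> ('a \<Rightarrow> real) \<Rightarrow> real)
     \<Rightarrow> (real \<Rightarrow> ('a \<Rightarrow> real) \<Rightarrow> ('a \<Rightarrow> real)) \<Rightarrow> bool" where
  "semigroup_of M D Q T \<longleftrightarrow>
     (\<forall>f\<in>L2 M. \<forall>t\<ge>0. T t f \<in> L2 M)
   \<and> (\<forall>f\<in>L2 M. AE x in M. T 0 f x = f x)
   \<and> (\<forall>f\<in>L2 M. \<forall>t\<ge>0.
        ((\<lambda>s. l2norm M (\<lambda>x. T s f x - T t f x)) \<longlongrightarrow> 0) (at t within {0..}))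
   \<and> (\<forall>f\<in>L2 M. \<forall>t>0. \<exists>w. gen_rel M D Q (T t f) w \<and>
        ((\<lambda>h. l2norm M (\<lambda>x. (T (t + h) f x - T t f x) / h + w x)) \<longlongrightarrow> 0) (at 0))
   \<and> (\<forall>f\<in>L1 M. \<forall>t\<ge>0. T t f \<in> L1 M)
   \<and> (\<forall>f\<in>L1 M. \<forall>g\<in>L1 M. \<forall>t\<ge>0.
        l1norm M (\<lambda>x. T t f x - T t g x) \<le> l1norm M (\<lambda>x. f x - g x))"

text \<open>F is (a version of) the L^1-valued integral \<integral>_0^n T_s f ds, characterised weakly.\<close>
definition is_int_semigroup ::
  "'a measure \<Rightarrow> (real \<Rightarrow> ('a \<Rightarrow> real) \<Rightarrow> ('a \<Rightarrow> real)) \<Rightarrow> ('a \<Rightarrow> real) \<Rightarrow> real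
     \<Rightarrow> ('a \<Rightarrow> real) \<Rightarrow> bool" where
  "is_int_semigroup M T f r F \<longleftrightarrow> F \<in> L1 M \<and>
     (\<forall>g \<in> borel_measurable M. (\<exists>B. \<forall>x\<in>space M. \<bar>g x\<bar> \<le> B) \<longrightarrow>
        (\<integral>x. F x * g x \<partial>M) = (LBINT s:{0..r}. (\<integral>x. T s f x * g x \<partial>M)))"

definition is_Green ::
  "'a measure \<Rightarrow> (real \<Rightarrow> ('a \<Rightarrow> real) \<Rightarrow> ('a \<Rightarrow> real)) \<Rightarrow> ('a \<Rightarrow> real) \<Rightarrow> ('a \<Rightarrow> ereal) \<Rightarrow> bool" where
  "is_Green M T f G \<longleftrightarrow> (\<exists>F. (\<forall>n::nat. is_int_semigroup M T f (real n) (F n)) \<and>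
      (AE x in M. (\<lambda>n. ereal (F n x)) \<longlonglongrightarrow> G x))"

definition recurrent ::
  "'a measure \<Rightarrow> (real \<Rightarrow> ('a \<Rightarrow> real) \<Rightarrow> ('a \<Rightarrow> real)) \<Rightarrow> bool" where
  "recurrent M T \<longleftrightarrow> (\<forall>f\<in>L1 M. (AE x in M. f x \<ge> 0) \<longrightarrow>
     (\<forall>G. is_Green M T f G \<longrightarrow> (AE x in M. G x = 0) \<or> (AE x in M. G x = \<infinity>)))"

definition invariant_set ::
  "'a measure \<Rightarrow> ('a \<Rightarrow> real) set \<Rightarrow> (('a \<Rightarrow> real) \<Rightarrow> ('a \<Rightarrow> real) \<Rightarrow> real) \<Rightarrow> 'a set \<Rightarrow> bool" where
  "invariant_set M D Q A \<longleftrightarrow> A \<in> sets M \<and>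
     (\<forall>f\<in>D. (\<lambda>x. indicator A x * f x) \<in> D \<and>
        Q f f = Q (\<lambda>x. indicator A x * f x) (\<lambda>x. indicator A x * f x)
              + Q (\<lambda>x. indicator (space M - A) x * f x) (\<lambda>x. indicator (space M - A) x * f x))"

definition irreducible_form ::
  "'a measure \<Rightarrow> ('a \<Rightarrow> real) set \<Rightarrow> (('a \<Rightarrow> real) \<Rightarrow> ('a \<Rightarrow> real) \<Rightarrow> real) \<Rightarrow> bool" where
  "irreducible_form M D Q \<longleftrightarrow> (\<forall>A. invariant_set M D Q A \<longrightarrow>
      emeasure M A = 0 \<or> emeasure M (space M - A) = 0)"

definition approx_seq ::
  "'a measure \<Rightarrow> ('a \<Rightarrow> real) set \<Rightarrow> (('a \<Rightarrow> real) \<Rightarrow> ('a \<Rightarrow> real) \<Rightarrow> real)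
     \<Rightarrow> ('a \<Rightarrow> real) \<Rightarrow> (nat \<Rightarrow> 'a \<Rightarrow> real) \<Rightarrow> bool" where
  "approx_seq M D Q f fs \<longleftrightarrow> (\<forall>n. fs n \<in> D) \<and>
     (\<forall>e>0. \<exists>N. \<forall>n\<ge>N. \<forall>m\<ge>N. Q (\<lambda>x. fs n x - fs m x) (\<lambda>x. fs n x - fs m x) < e) \<and>
     (AE x in M. (\<lambda>n. fs n x) \<longlonglongrightarrow> f x)"

definition ext_space ::
  "'a measure \<Rightarrow> ('a \<Rightarrow> real) set \<Rightarrow> (('a \<Rightarrow> real) \<Rightarrow> ('a \<Rightarrow> real) \<Rightarrow> real) \<Rightarrow> ('a \<Rightarrow> real) set" where
  "ext_space M D Q = {f. f \<in> borel_measurable M \<and> (\<exists>fs. approx_seq M D Q f fs)}"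

definition extQ1 ::
  "'a measure \<Rightarrow> ('a \<Rightarrow> real) set \<Rightarrow> (('a \<Rightarrow> real) \<Rightarrow> ('a \<Rightarrow> real) \<Rightarrow> real) \<Rightarrow> ('a \<Rightarrow> real) \<Rightarrow> real" where
  "extQ1 M D Q f = (THE c. \<forall>fs. approx_seq M D Q f fs \<longrightarrow> (\<lambda>n. Q (fs n) (fs n)) \<longlonglongrightarrow> c)"

definition extQ ::
  "'a measure \<Rightarrow> ('a \<Rightarrow> real) set \<Rightarrow> (('a \<Rightarrow> real) \<Rightarrow> ('a \<Rightarrow> real) \<Rightarrow> real)
     \<Rightarrow> ('a \<Rightarrow> real) \<Rightarrow> ('a \<Rightarrow> real) \<Rightarrow> real" where
  "extQ M D Q f g = (extQ1 M D Q (\<lambda>x. f x + g x) - extQ1 M D Q (\<lambda>x. f x - g x)) / 4"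

definition ext_gen_rel ::
  "'a measure \<Rightarrow> ('a \<Rightarrow> real) set \<Rightarrow> (('a \<Rightarrow> real) \<Rightarrow> ('a \<Rightarrow> real) \<Rightarrow> real)
     \<Rightarrow> ('a \<Rightarrow> real) \<Rightarrow> ('a \<Rightarrow> real) \<Rightarrow> bool" where
  "ext_gen_rel M D Q v w \<longleftrightarrow> v \<in> ext_space M D Q \<and> w \<in> L2 M \<and>
     (\<forall>u\<in>D. ip M w u = extQ M D Q v u)"

end

theory Submission
  imports Defs
begin

text \<open>
  For an integrable \<open>0 \<le> g \<le> 1\<close>, let \<open>u\<^sub>n\<close> solve \<open>L u\<^sub>n + u\<^sub>n / (n + 1) = g (1 - u\<^sub>n)\<close>. These
  equilibrium potentials increase to some \<open>u \<le> 1\<close> in the extended space with \<open>L\<^sub>e u = g (1 - u)\<close>.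

  (i) implies (iii): for strictly positive \<open>g\<close>, testing the equation with the semigroup gives
  \<open>\<integral> (G g) g (1 - u) \<le> \<integral> g < \<infinity>\<close>, and \<open>G g = \<infinity>\<close> forces \<open>u = 1\<close>.
  (iii) implies (ii) by Cauchy-Schwarz against \<open>u\<^sub>n \<in> D\<close> with \<open>u\<^sub>n \<rightarrow> 1\<close> and \<open>Q u\<^sub>n \<rightarrow> 0\<close>.

  (ii) implies (i): resolvents of functions \<open>h\<close> with \<open>\<integral> (G f) h < \<infinity>\<close> vanish on \<open>{G f = \<infinity>}\<close>, so
  this set is invariant, hence null or conull. If it is null, choose \<open>h > 0\<close> with \<open>\<integral> (G f) h < \<infinity>\<close>.
  For \<open>0 < \<kappa> \<le> 1\<close> condition (ii) makes the limit of the equilibrium potentials of \<open>g = \<kappa> h\<close> equal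
  to 1, and testing with the semigroup gives \<open>\<integral> f u\<^sub>n \<le> \<kappa> \<integral> (G f) h\<close>. Letting \<open>n \<rightarrow> \<infinity>\<close> and then
  \<open>\<kappa> \<rightarrow> 0\<close> yields \<open>f = 0\<close>.
\<close>

section \<open>Nonnegative symmetric forms on spaces of functions\<close>

abbreviation (input) quad :: "('b \<Rightarrow> 'b \<Rightarrow> real) \<Rightarrow> 'b \<Rightarrow> real" where
  "quad B f \<equiv> B f f"

lemma square_le_mult_if_quadratic_nonneg:
  fixes a b c :: real
  assumes nonneg: "\<And>t. 0 \<le> a + 2 * t * b + t\<^sup>2 * c" and "0 \<le> c"
  shows "b\<^sup>2 \<le> a * c"
proof (cases "c = 0")
  case True
  have "b = 0"
  proof (rule ccontr)
    assume "b \<noteq> 0"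
    then show False using nonneg[of "- (a + 1) / (2 * b)"] True by (simp add: field_simps)
  qed
  then show ?thesis using True by simp
next
  case False
  then show ?thesis using nonneg[of "- b / c"] \<open>0 \<le> c\<close> by (simp add: field_simps power2_eq_square)
qed

lemma tendsto_0_if_square_le:
  fixes f g :: "'b \<Rightarrow> real"
  assumes "\<forall>\<^sub>F n in F. (f n)\<^sup>2 \<le> g n" "(g \<longlongrightarrow> 0) F"
  shows "(f \<longlongrightarrow> 0) F"
proof -
  have "((\<lambda>n. (f n)\<^sup>2) \<longlongrightarrow> 0) F" by (rule Lim_null_comparison[OF _ assms(2)]) (use assms(1) in simp)
  then show ?thesis by simp
qed

definition form_Cauchy :: "(('a \<Rightarrow> real) \<Rightarrow> ('a \<Rightarrow> real) \<Rightarrow> real) \<Rightarrow> (nat \<Rightarrow> 'a \<Rightarrow> real) \<Rightarrow> bool" where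
  "form_Cauchy B u \<longleftrightarrow> (\<forall>e>0. \<exists>N. \<forall>n\<ge>N. \<forall>m\<ge>N. quad B (\<lambda>x. u n x - u m x) < e)"

lemma form_CauchyE:
  assumes "form_Cauchy B u" "e > 0"
  obtains N where "\<And>n m. n \<ge> N \<Longrightarrow> m \<ge> N \<Longrightarrow> quad B (\<lambda>x. u n x - u m x) < e"
  using assms unfolding form_Cauchy_def by blast

lemma form_Cauchy_if_quad_le:
  assumes "form_Cauchy B' v" "K > 0"
    and le: "\<And>n m. quad B (\<lambda>x. u n x - u m x) \<le> K * quad B' (\<lambda>x. v n x - v m x)"
  shows "form_Cauchy B u"
  unfolding form_Cauchy_def
proof (intro allI impI)
  fix e :: real assume "e > 0"
  then have "e / K > 0" using \<open>K > 0\<close> by simp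
  then obtain N where N: "\<And>n m. n \<ge> N \<Longrightarrow> m \<ge> N \<Longrightarrow> quad B' (\<lambda>x. v n x - v m x) < e / K"
    using form_CauchyE[OF assms(1)] by blast
  have "quad B (\<lambda>x. u n x - u m x) < e" if "n \<ge> N" "m \<ge> N" for n m
    using le[of n m] N[OF that] \<open>K > 0\<close> by (simp add: field_simps)
  then show "\<exists>N. \<forall>n\<ge>N. \<forall>m\<ge>N. quad B (\<lambda>x. u n x - u m x) < e" by blast
qed

locale psd_form =
  fixes V :: "('a \<Rightarrow> real) set" and B :: "('a \<Rightarrow> real) \<Rightarrow> ('a \<Rightarrow> real) \<Rightarrow> real"
  assumes zero_mem [simp, intro]: "(\<lambda>x. 0) \<in> V"
    and add_mem [simp, intro]: "f \<in> V \<Longrightarrow> g \<in> V \<Longrightarrow> (\<lambda>x. f x + g x) \<in> V"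
    and scale_mem [simp, intro]: "f \<in> V \<Longrightarrow> (\<lambda>x. c * f x) \<in> V"
    and sym: "f \<in> V \<Longrightarrow> g \<in> V \<Longrightarrow> B f g = B g f"
    and add_left: "f \<in> V \<Longrightarrow> g \<in> V \<Longrightarrow> h \<in> V \<Longrightarrow> B (\<lambda>x. f x + g x) h = B f h + B g h"
    and scale_left: "f \<in> V \<Longrightarrow> h \<in> V \<Longrightarrow> B (\<lambda>x. c * f x) h = c * B f h"
    and quad_nonneg [simp]: "f \<in> V \<Longrightarrow> 0 \<le> quad B f"
begin

lemma diff_mem [simp, intro]: "f \<in> V \<Longrightarrow> g \<in> V \<Longrightarrow> (\<lambda>x. f x - g x) \<in> V"
  using add_mem[of f "\<lambda>x. - 1 * g x"] scale_mem[of g "- 1"] by simp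

lemma diff_left: "f \<in> V \<Longrightarrow> g \<in> V \<Longrightarrow> h \<in> V \<Longrightarrow> B (\<lambda>x. f x - g x) h = B f h - B g h"
  using add_left[of f "\<lambda>x. - 1 * g x" h] scale_left[of g h "- 1"] scale_mem[of g "- 1"] by simp

lemma add_right: "f \<in> V \<Longrightarrow> g \<in> V \<Longrightarrow> h \<in> V \<Longrightarrow> B h (\<lambda>x. f x + g x) = B h f + B h g"
  and diff_right: "f \<in> V \<Longrightarrow> g \<in> V \<Longrightarrow> h \<in> V \<Longrightarrow> B h (\<lambda>x. f x - g x) = B h f - B h g"
  and scale_right: "f \<in> V \<Longrightarrow> h \<in> V \<Longrightarrow> B h (\<lambda>x. c * f x) = c * B h f"
  by (simp_all add: sym[of h] add_left diff_left scale_left)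

lemma quad_zero [simp]: "quad B (\<lambda>x. 0) = 0"
  using scale_left[of "\<lambda>x. 0" "\<lambda>x. 0" 0] by simp

lemma quad_add_scale:
  assumes "f \<in> V" "g \<in> V"
  shows "quad B (\<lambda>x. f x + t * g x) = quad B f + 2 * t * B f g + t\<^sup>2 * quad B g"
  using assms
  by (simp add: add_left add_right scale_left scale_right sym[of g f] power2_eq_square algebra_simps)

lemma quad_add: "f \<in> V \<Longrightarrow> g \<in> V \<Longrightarrow> quad B (\<lambda>x. f x + g x) = quad B f + 2 * B f g + quad B g"
  and quad_diff: "f \<in> V \<Longrightarrow> g \<in> V \<Longrightarrow> quad B (\<lambda>x. f x - g x) = quad B f - 2 * B f g + quad B g"
  using quad_add_scale[of f g 1] quad_add_scale[of f g "- 1"] by simp_all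

lemma quad_diff_commute: "f \<in> V \<Longrightarrow> g \<in> V \<Longrightarrow> quad B (\<lambda>x. f x - g x) = quad B (\<lambda>x. g x - f x)"
  by (simp add: quad_diff sym[of g f])

lemma quad_diff_le: "f \<in> V \<Longrightarrow> g \<in> V \<Longrightarrow> quad B (\<lambda>x. f x - g x) \<le> 2 * quad B f + 2 * quad B g"
  using quad_add[of f g] quad_diff[of f g] quad_nonneg[OF add_mem[of f g]] by simp

lemma Cauchy_Schwarz:
  assumes "f \<in> V" "g \<in> V"
  shows "(B f g)\<^sup>2 \<le> quad B f * quad B g"
proof (rule square_le_mult_if_quadratic_nonneg)
  show "0 \<le> quad B f + 2 * t * B f g + t\<^sup>2 * quad B g" for t
    using quad_nonneg[of "\<lambda>x. f x + t * g x"] assms by (simp add: quad_add_scale)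
qed (use assms in simp)

lemma sqrt_quad_diff_le:
  assumes "f \<in> V" "g \<in> V"
  shows "\<bar>sqrt (quad B f) - sqrt (quad B g)\<bar> \<le> sqrt (quad B (\<lambda>x. f x - g x))"
proof -
  have "B f g \<le> sqrt (quad B f) * sqrt (quad B g)"
    using real_sqrt_le_mono[OF Cauchy_Schwarz[OF assms]] by (simp add: real_sqrt_mult)
  then have "(sqrt (quad B f) - sqrt (quad B g))\<^sup>2 \<le> quad B (\<lambda>x. f x - g x)"
    using assms by (simp add: quad_diff power2_diff)
  from real_sqrt_le_mono[OF this] show ?thesis by simp
qed

lemma tendsto_left:
  assumes "\<forall>\<^sub>F n in F. f n \<in> V" "f' \<in> V" "h \<in> V" "((\<lambda>n. quad B (\<lambda>x. f n x - f' x)) \<longlongrightarrow> 0) F"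
  shows "((\<lambda>n. B (f n) h) \<longlongrightarrow> B f' h) F"
proof (rule LIM_zero_cancel, rule tendsto_0_if_square_le)
  show "\<forall>\<^sub>F n in F. (B (f n) h - B f' h)\<^sup>2 \<le> quad B (\<lambda>x. f n x - f' x) * quad B h"
    using assms(1)
  proof eventually_elim
    case (elim n)
    then show ?case
      using Cauchy_Schwarz[OF diff_mem[OF elim assms(2)] assms(3)] assms(2,3)
      by (simp add: diff_left)
  qed
  show "((\<lambda>n. quad B (\<lambda>x. f n x - f' x) * quad B h) \<longlongrightarrow> 0) F"
    by (intro tendsto_mult_left_zero assms(4))
qed

lemma quad_tendsto_if_quad_diff_tendsto_0:
  assumes "\<forall>\<^sub>F n in F. f n \<in> V" "\<forall>\<^sub>F n in F. g n \<in> V"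
    and "((\<lambda>n. quad B (\<lambda>x. f n x - g n x)) \<longlongrightarrow> 0) F" "((\<lambda>n. quad B (g n)) \<longlongrightarrow> l) F"
  shows "((\<lambda>n. quad B (f n)) \<longlongrightarrow> l) F"
proof -
  have "((\<lambda>n. sqrt (quad B (f n)) - sqrt (quad B (g n))) \<longlongrightarrow> 0) F"
  proof (rule Lim_null_comparison)
    show "\<forall>\<^sub>F n in F. norm (sqrt (quad B (f n)) - sqrt (quad B (g n)))
        \<le> sqrt (quad B (\<lambda>x. f n x - g n x))"
      using assms(1,2) by eventually_elim (simp add: sqrt_quad_diff_le)
    show "((\<lambda>n. sqrt (quad B (\<lambda>x. f n x - g n x))) \<longlongrightarrow> 0) F"
      using tendsto_real_sqrt[OF assms(3)] by simp
  qed
  from tendsto_power[OF tendsto_add[OF this tendsto_real_sqrt[OF assms(4)]], of 2]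
  have lim: "((\<lambda>n. (sqrt (quad B (f n)))\<^sup>2) \<longlongrightarrow> (sqrt l)\<^sup>2) F" by simp
  show ?thesis
  proof (cases "F = bot")
    case False
    have "0 \<le> l"
      using assms(2,4) False by (intro tendsto_lowerbound[OF assms(4)]) (auto elim: eventually_mono)
    moreover have "\<forall>\<^sub>F n in F. (sqrt (quad B (f n)))\<^sup>2 = quad B (f n)"
      using assms(1) by eventually_elim simp
    ultimately show ?thesis using Lim_transform_eventually[OF lim] by simp
  qed simp
qed

lemma Cauchy_if_increments:
  fixes c :: "nat \<Rightarrow> real"
  assumes mem: "\<And>n. u n \<in> V"
    and incr: "\<And>n m. n \<le> m \<Longrightarrow> quad B (\<lambda>x. u m x - u n x) \<le> c m - c n"
    and bound: "\<And>n. c n \<le> K"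
  shows "form_Cauchy B u"
  unfolding form_Cauchy_def
proof (intro allI impI)
  fix e :: real assume "e > 0"
  have "incseq c"
  proof (rule incseq_SucI)
    show "c n \<le> c (Suc n)" for n
      using incr[of n "Suc n"] quad_nonneg[OF diff_mem[OF mem[of "Suc n"] mem[of n]]] by linarith
  qed
  then have "Cauchy c" by (metis bound incseq_convergent LIMSEQ_imp_Cauchy)
  then obtain N where N: "\<And>n m. n \<ge> N \<Longrightarrow> m \<ge> N \<Longrightarrow> \<bar>c n - c m\<bar> < e"
    using \<open>e > 0\<close> unfolding Cauchy_def dist_real_def by blast
  have "quad B (\<lambda>x. u n x - u m x) < e" if "n \<ge> N" "m \<ge> N" for n m
    using N[OF that] incr[of n m] incr[of m n] quad_diff_commute[OF mem[of n] mem[of m]]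
    by (cases "n \<le> m") auto
  then show "\<exists>N. \<forall>n\<ge>N. \<forall>m\<ge>N. quad B (\<lambda>x. u n x - u m x) < e" by blast
qed

lemma Cauchy_if_quad_tendsto_0:
  assumes mem: "\<And>n. u n \<in> V" "f \<in> V" and lim: "(\<lambda>n. quad B (\<lambda>x. u n x - f x)) \<longlonglongrightarrow> 0"
  shows "form_Cauchy B u"
  unfolding form_Cauchy_def
proof (intro allI impI)
  fix e :: real assume "e > 0"
  then have "\<forall>\<^sub>F n in sequentially. quad B (\<lambda>x. u n x - f x) < e / 4"
    by (intro order_tendstoD(2)[OF lim]) simp
  then obtain N where N: "\<And>n. n \<ge> N \<Longrightarrow> quad B (\<lambda>x. u n x - f x) < e / 4"
    unfolding eventually_sequentially by blast
  have "quad B (\<lambda>x. u n x - u m x) < e" if "n \<ge> N" "m \<ge> N" for n m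
    using quad_diff_le[OF diff_mem[OF mem] diff_mem[OF mem], of n m] N[OF that(1)] N[OF that(2)]
    by simp
  then show "\<exists>N. \<forall>n\<ge>N. \<forall>m\<ge>N. quad B (\<lambda>x. u n x - u m x) < e" by blast
qed

lemma quad_diff_limits_eq_0:
  assumes mem: "\<And>n. u n \<in> V" "f \<in> V" "g \<in> V"
    and lim: "(\<lambda>n. quad B (\<lambda>x. u n x - f x)) \<longlonglongrightarrow> 0" "(\<lambda>n. quad B (\<lambda>x. u n x - g x)) \<longlonglongrightarrow> 0"
  shows "quad B (\<lambda>x. f x - g x) = 0"
proof -
  have "quad B (\<lambda>x. f x - g x) \<le> 2 * quad B (\<lambda>x. u n x - g x) + 2 * quad B (\<lambda>x. u n x - f x)" for n
    using quad_diff_le[OF diff_mem[OF mem(1,3)] diff_mem[OF mem(1,2)], of n n] by simp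
  moreover have "(\<lambda>n. 2 * quad B (\<lambda>x. u n x - g x) + 2 * quad B (\<lambda>x. u n x - f x)) \<longlonglongrightarrow> 2 * 0 + 2 * 0"
    by (intro tendsto_intros lim)
  ultimately have "quad B (\<lambda>x. f x - g x) \<le> 0" using LIMSEQ_le_const by fastforce
  then show ?thesis using quad_nonneg[OF diff_mem[OF mem(2,3)]] by linarith
qed

lemma Cauchy_const: "u \<in> V \<Longrightarrow> form_Cauchy B (\<lambda>n. u)"
  by (auto simp: form_Cauchy_def)

lemma Cauchy_diff:
  assumes mem: "\<And>n. u n \<in> V" "\<And>n. v n \<in> V" and "form_Cauchy B u" "form_Cauchy B v"
  shows "form_Cauchy B (\<lambda>n x. u n x - v n x)"
  unfolding form_Cauchy_def
proof (intro allI impI)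
  fix e :: real assume "e > 0"
  then have "e / 4 > 0" by simp
  obtain N where N: "\<And>n m. n \<ge> N \<Longrightarrow> m \<ge> N \<Longrightarrow> quad B (\<lambda>x. u n x - u m x) < e / 4"
    using form_CauchyE[OF assms(3) \<open>e / 4 > 0\<close>] by blast
  obtain N' where N': "\<And>n m. n \<ge> N' \<Longrightarrow> m \<ge> N' \<Longrightarrow> quad B (\<lambda>x. v n x - v m x) < e / 4"
    using form_CauchyE[OF assms(4) \<open>e / 4 > 0\<close>] by blast
  have "quad B (\<lambda>x. u n x - v n x - (u m x - v m x)) < e" if "n \<ge> max N N'" "m \<ge> max N N'" for n m
  proof -
    have "(\<lambda>x. u n x - v n x - (u m x - v m x)) = (\<lambda>x. (u n x - u m x) - (v n x - v m x))" by auto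
    then show ?thesis
      using quad_diff_le[OF diff_mem[OF mem(1) mem(1)] diff_mem[OF mem(2) mem(2)], of n m n m]
        N[of n m] N'[of n m] that by simp
  qed
  then show "\<exists>N. \<forall>n\<ge>N. \<forall>m\<ge>N. quad B (\<lambda>x. u n x - v n x - (u m x - v m x)) < e" by blast
qed

lemma quad_tendsto_0_if_Cauchy_weakly_null:
  assumes mem: "\<And>n. u n \<in> V" and "form_Cauchy B u" and null: "\<And>n. (\<lambda>m. B (u m) (u n)) \<longlonglongrightarrow> 0"
  shows "(\<lambda>n. quad B (u n)) \<longlonglongrightarrow> 0"
proof (rule LIMSEQ_I)
  fix e :: real assume "e > 0"
  then have "e / 2 > 0" by simp
  then obtain N where N: "\<And>n m. n \<ge> N \<Longrightarrow> m \<ge> N \<Longrightarrow> quad B (\<lambda>x. u n x - u m x) < e / 2"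
    using form_CauchyE[OF assms(2)] by blast
  have "quad B (u n) \<le> e / 2" if "n \<ge> N" for n
  proof (rule LIMSEQ_le_const2)
    show "(\<lambda>m. quad B (u n) - 2 * B (u m) (u n)) \<longlonglongrightarrow> quad B (u n)"
      using tendsto_diff[OF tendsto_const tendsto_mult_left[OF null[of n], of 2]] by auto
    have "quad B (u n) - 2 * B (u m) (u n) \<le> e / 2" if "m \<ge> N" for m
      using N[OF that \<open>n \<ge> N\<close>] quad_diff[OF mem mem, of m n] quad_nonneg[OF mem, of m] by linarith
    then show "\<exists>N. \<forall>m\<ge>N. quad B (u n) - 2 * B (u m) (u n) \<le> e / 2" by blast
  qed
  then have "norm (quad B (u n) - 0) < e" if "n \<ge> N" for n
    using that quad_nonneg[OF mem, of n] \<open>e > 0\<close> by fastforce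
  then show "\<exists>N. \<forall>n\<ge>N. norm (quad B (u n) - 0) < e" by blast
qed

lemma convergent_quad_if_Cauchy:
  assumes mem: "\<And>n. u n \<in> V" and "form_Cauchy B u"
  shows "convergent (\<lambda>n. quad B (u n))"
proof -
  have "Cauchy (\<lambda>n. sqrt (quad B (u n)))"
    unfolding Cauchy_def dist_real_def
  proof (intro allI impI)
    fix e :: real assume "e > 0"
    then obtain N where N: "\<And>n m. n \<ge> N \<Longrightarrow> m \<ge> N \<Longrightarrow> quad B (\<lambda>x. u n x - u m x) < e\<^sup>2"
      using form_CauchyE[OF assms(2), of "e\<^sup>2"] by auto
    have "\<bar>sqrt (quad B (u n)) - sqrt (quad B (u m))\<bar> < e" if "n \<ge> N" "m \<ge> N" for n m
      using sqrt_quad_diff_le[OF mem[of n] mem[of m]] real_sqrt_less_mono[OF N[OF that]] \<open>e > 0\<close>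
      by simp
    then show "\<exists>N. \<forall>n\<ge>N. \<forall>m\<ge>N. \<bar>sqrt (quad B (u n)) - sqrt (quad B (u m))\<bar> < e" by blast
  qed
  then obtain l where "(\<lambda>n. sqrt (quad B (u n))) \<longlonglongrightarrow> l"
    using Cauchy_convergent unfolding convergent_def by blast
  from tendsto_power[OF this, of 2] show ?thesis using mem by (auto simp: convergent_def)
qed

end

text \<open>The Riesz representation theorem: the representer of \<open>\<phi>\<close> minimises \<open>B z z - 2 \<phi> z\<close>.\<close>

locale bounded_functional = psd_form V B
  for V :: "('a \<Rightarrow> real) set" and B +
  fixes \<phi> :: "('a \<Rightarrow> real) \<Rightarrow> real" and K :: real
  assumes functional_add: "f \<in> V \<Longrightarrow> g \<in> V \<Longrightarrow> \<phi> (\<lambda>x. f x + g x) = \<phi> f + \<phi> g"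
    and functional_scale: "f \<in> V \<Longrightarrow> \<phi> (\<lambda>x. c * f x) = c * \<phi> f"
    and functional_bound: "f \<in> V \<Longrightarrow> (\<phi> f)\<^sup>2 \<le> K * quad B f"
begin

definition objective :: "('a \<Rightarrow> real) \<Rightarrow> real" where
  "objective z = quad B z - 2 * \<phi> z"

lemma objective_add_scale:
  assumes "z \<in> V" "p \<in> V"
  shows "objective (\<lambda>x. z x + t * p x) = objective z + 2 * t * (B z p - \<phi> p) + t\<^sup>2 * quad B p"
  using assms by (simp add: objective_def quad_add_scale functional_add functional_scale algebra_simps)

lemma objective_bdd_below: "bdd_below (objective ` V)"
proof (rule bdd_belowI2)
  fix z assume z: "z \<in> V"
  have "4 * (\<phi> z)\<^sup>2 \<le> (\<bar>K\<bar> + quad B z)\<^sup>2"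
  proof -
    have "(\<phi> z)\<^sup>2 \<le> \<bar>K\<bar> * quad B z"
      using functional_bound[OF z] mult_right_mono[OF abs_ge_self[of K] quad_nonneg[OF z]] by linarith
    moreover have "4 * (\<bar>K\<bar> * quad B z) \<le> (\<bar>K\<bar> + quad B z)\<^sup>2"
      using zero_le_power2[of "\<bar>K\<bar> - quad B z"] by (simp add: power2_eq_square algebra_simps)
    ultimately show ?thesis by linarith
  qed
  then have "(2 * \<phi> z)\<^sup>2 \<le> (\<bar>K\<bar> + quad B z)\<^sup>2" by (simp add: power_mult_distrib)
  then have "2 * \<phi> z \<le> \<bar>K\<bar> + quad B z" by (rule power2_le_imp_le) (use z in simp)
  then show "- \<bar>K\<bar> \<le> objective z" by (simp add: objective_def)
qed

lemma minimiser_represents: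
  assumes v: "v \<in> V" and "\<And>z. z \<in> V \<Longrightarrow> objective v \<le> objective z" and p: "p \<in> V"
  shows "B v p = \<phi> p"
proof -
  have "(B v p - \<phi> p)\<^sup>2 \<le> 0 * quad B p"
  proof (rule square_le_mult_if_quadratic_nonneg)
    show "0 \<le> 0 + 2 * t * (B v p - \<phi> p) + t\<^sup>2 * quad B p" for t
      using assms(2)[of "\<lambda>x. v x + t * p x"] objective_add_scale[OF v p, of t] v p by simp
  qed (use p in simp)
  then show ?thesis by simp
qed

lemma quad_diff_le_objective:
  assumes "z \<in> V" "y \<in> V" and lower: "\<And>w. w \<in> V \<Longrightarrow> I \<le> objective w"
  shows "quad B (\<lambda>x. z x - y x) \<le> 2 * (objective z - I) + 2 * (objective y - I)"
proof -
  let ?p = "\<lambda>x. z x - y x"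
  have p: "?p \<in> V" using assms by simp
  note expand = objective_add_scale[OF assms(2) p]
  have "I \<le> objective (\<lambda>x. y x + (1 / 2) * ?p x)" by (intro lower add_mem scale_mem assms p)
  then show ?thesis using expand[of "1 / 2"] expand[of 1] by (simp add: power2_eq_square)
qed

lemma objective_le_if_limit:
  assumes mem: "\<And>n. z n \<in> V" "v \<in> V" and lim: "(\<lambda>n. quad B (\<lambda>x. z n x - v x)) \<longlonglongrightarrow> 0"
    and obj: "(\<lambda>n. objective (z n)) \<longlonglongrightarrow> I"
  shows "objective v \<le> I"
proof -
  have p: "(\<lambda>x. z n x - v x) \<in> V" for n using mem by simp
  have "(\<lambda>n. B (\<lambda>x. z n x - v x) v) \<longlonglongrightarrow> 0"
    using tendsto_left[OF _ zero_mem mem(2), of "\<lambda>n x. z n x - v x" sequentially] p lim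
      scale_left[OF zero_mem mem(2), of 0] by simp
  moreover have "(\<lambda>n. \<phi> (\<lambda>x. z n x - v x)) \<longlonglongrightarrow> 0"
  proof (rule tendsto_0_if_square_le)
    show "\<forall>\<^sub>F n in sequentially. (\<phi> (\<lambda>x. z n x - v x))\<^sup>2 \<le> K * quad B (\<lambda>x. z n x - v x)"
      using functional_bound[OF p] by simp
    show "(\<lambda>n. K * quad B (\<lambda>x. z n x - v x)) \<longlonglongrightarrow> 0" by (intro tendsto_mult_right_zero lim)
  qed
  ultimately have "(\<lambda>n. objective (z n) - 2 * (B (\<lambda>x. z n x - v x) v - \<phi> (\<lambda>x. z n x - v x)))
      \<longlonglongrightarrow> I - 2 * (0 - 0)"
    by (intro tendsto_intros obj)
  moreover have "objective v \<le> objective (z n) - 2 * (B (\<lambda>x. z n x - v x) v - \<phi> (\<lambda>x. z n x - v x))"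
    for n
    using objective_add_scale[OF mem(2) p, of 1 n] quad_nonneg[OF p, of n]
      sym[OF mem(2) p, of n] by simp
  ultimately show ?thesis by (intro LIMSEQ_le_const) auto
qed

lemma ex_minimising_Cauchy:
  obtains z where "\<And>n. z n \<in> V" "form_Cauchy B z" "(\<lambda>n. objective (z n)) \<longlonglongrightarrow> (INF w\<in>V. objective w)"
proof -
  define I where "I = (INF w\<in>V. objective w)"
  have lower: "I \<le> objective w" if "w \<in> V" for w
    unfolding I_def by (rule cINF_lower[OF objective_bdd_below that])
  have "\<exists>w\<in>V. objective w < I + inverse (real (Suc n))" for n
  proof -
    have "(INF w\<in>V. objective w) < I + inverse (real (Suc n))" by (simp add: I_def)
    then show ?thesis using zero_mem by (subst (asm) cINF_less_iff[OF _ objective_bdd_below]) auto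
  qed
  then obtain z where z: "\<And>n. z n \<in> V" "\<And>n. objective (z n) < I + inverse (real (Suc n))" by metis
  have lim: "(\<lambda>n. objective (z n)) \<longlonglongrightarrow> I"
  proof (rule tendsto_sandwich[OF _ _ tendsto_const LIMSEQ_inverse_real_of_nat_add])
    show "\<forall>\<^sub>F n in sequentially. I \<le> objective (z n)" using lower z(1) by simp
    show "\<forall>\<^sub>F n in sequentially. objective (z n) \<le> I + inverse (real (Suc n))"
      using z(2) by (intro always_eventually allI less_imp_le)
  qed
  have "form_Cauchy B z"
    unfolding form_Cauchy_def
  proof (intro allI impI)
    fix e :: real assume "e > 0"
    then have "\<forall>\<^sub>F n in sequentially. objective (z n) < I + e / 4"
      using order_tendstoD(2)[OF lim, of "I + e / 4"] by simp
    then obtain N where N: "\<And>n. n \<ge> N \<Longrightarrow> objective (z n) < I + e / 4"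
      unfolding eventually_sequentially by blast
    have "quad B (\<lambda>x. z n x - z m x) < e" if "n \<ge> N" "m \<ge> N" for n m
      using quad_diff_le_objective[OF z(1) z(1) lower, of n m] N[OF that(1)] N[OF that(2)] by simp
    then show "\<exists>N. \<forall>n\<ge>N. \<forall>m\<ge>N. quad B (\<lambda>x. z n x - z m x) < e" by blast
  qed
  then show ?thesis using lim that[OF z(1)] by (simp add: I_def)
qed

theorem ex_representer:
  assumes complete: "\<And>u. (\<And>n. u n \<in> V) \<Longrightarrow> form_Cauchy B u \<Longrightarrow>
      \<exists>v\<in>V. (\<lambda>n. quad B (\<lambda>x. u n x - v x)) \<longlonglongrightarrow> 0"
  obtains v where "v \<in> V" "\<And>p. p \<in> V \<Longrightarrow> B v p = \<phi> p"
proof -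
  obtain z where z: "\<And>n. z n \<in> V" "form_Cauchy B z" "(\<lambda>n. objective (z n)) \<longlonglongrightarrow> (INF w\<in>V. objective w)"
    using ex_minimising_Cauchy by blast
  then obtain v where v: "v \<in> V" "(\<lambda>n. quad B (\<lambda>x. z n x - v x)) \<longlonglongrightarrow> 0" using complete by blast
  have "objective v \<le> objective w" if "w \<in> V" for w
    using objective_le_if_limit[OF z(1) v z(3)] cINF_lower[OF objective_bdd_below that] by linarith
  then show ?thesis by (rule that[OF v(1) minimiser_represents[OF v(1)]])
qed

end

section \<open>Square-integrable and bounded functions\<close>

lemma L2_measurable [measurable_dest]: "f \<in> L2 M \<Longrightarrow> f \<in> borel_measurable M"
  and L2_integrable_square: "f \<in> L2 M \<Longrightarrow> integrable M (\<lambda>x. (f x)\<^sup>2)"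
  by (auto simp: L2_def)

lemma L2_mult_integrable:
  assumes "f \<in> L2 M" "g \<in> L2 M"
  shows "integrable M (\<lambda>x. f x * g x)"
proof (rule Bochner_Integration.integrable_bound[of M "\<lambda>x. (f x)\<^sup>2 + (g x)\<^sup>2"])
  show "integrable M (\<lambda>x. (f x)\<^sup>2 + (g x)\<^sup>2)" "(\<lambda>x. f x * g x) \<in> borel_measurable M"
    using assms by (auto simp: L2_def)
  have "\<bar>a * b\<bar> \<le> a\<^sup>2 + b\<^sup>2" for a b :: real
    using sum_squares_bound[of "\<bar>a\<bar>" "\<bar>b\<bar>"] abs_ge_zero[of "a * b"]
    unfolding abs_mult power2_abs by linarith
  then show "AE x in M. norm (f x * g x) \<le> norm ((f x)\<^sup>2 + (g x)\<^sup>2)"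
    by (auto intro!: AE_I2)
qed

lemma L2_dominated:
  assumes "f \<in> L2 M" "g \<in> borel_measurable M" "AE x in M. \<bar>g x\<bar> \<le> \<bar>f x\<bar>"
  shows "g \<in> L2 M"
proof -
  have "integrable M (\<lambda>x. (g x)\<^sup>2)"
  proof (rule Bochner_Integration.integrable_bound[OF L2_integrable_square[OF assms(1)]])
    show "AE x in M. norm ((g x)\<^sup>2) \<le> norm ((f x)\<^sup>2)"
      using assms(3) by eventually_elim (simp add: abs_le_square_iff)
  qed (use assms(2) in measurable)
  then show ?thesis using assms(2) by (simp add: L2_def)
qed

interpretation L2: psd_form "L2 M" "ip M" for M :: "'a measure"
proof
  fix f g h :: "'a \<Rightarrow> real" and c :: real
  show "(\<lambda>x. 0) \<in> L2 M" by (simp add: L2_def)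
  show "(\<lambda>x. c * f x) \<in> L2 M" if "f \<in> L2 M" using that by (auto simp: L2_def power_mult_distrib)
  show "(\<lambda>x. f x + g x) \<in> L2 M" if "f \<in> L2 M" "g \<in> L2 M"
  proof -
    have "integrable M (\<lambda>x. (f x)\<^sup>2 + (g x)\<^sup>2 + 2 * (f x * g x))"
      using that L2_mult_integrable[OF that] by (simp add: L2_integrable_square)
    then show ?thesis using that by (auto simp: L2_def power2_sum algebra_simps)
  qed
  show "ip M f g = ip M g f" by (simp add: ip_def mult.commute)
  show "ip M (\<lambda>x. f x + g x) h = ip M f h + ip M g h" if "f \<in> L2 M" "g \<in> L2 M" "h \<in> L2 M"
    using that by (simp add: ip_def distrib_right L2_mult_integrable)
  show "ip M (\<lambda>x. c * f x) h = c * ip M f h" by (simp add: ip_def mult.assoc)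
  show "0 \<le> quad (ip M) f" by (simp add: ip_def)
qed

lemma ip_commute: "ip M f g = ip M g f"
  by (simp add: ip_def mult.commute)

lemma quad_ip: "quad (ip M) f = (\<integral>x. (f x)\<^sup>2 \<partial>M)"
  by (simp add: ip_def power2_eq_square)

lemma quad_ip_nonneg [simp]: "0 \<le> quad (ip M) f"
  by (simp add: ip_def)

lemma l2norm_square: "(l2norm M f)\<^sup>2 = quad (ip M) f"
  by (simp add: l2norm_def quad_ip)

lemma ip_scale_left: "ip M (\<lambda>x. c * f x) g = c * ip M f g"
  by (simp add: ip_def mult.assoc)

lemma ip_scale_right: "ip M f (\<lambda>x. c * g x) = c * ip M f g"
  by (simp add: ip_def mult.left_commute)

lemma ip_cong_AE:
  assumes "f \<in> borel_measurable M" "g \<in> borel_measurable M" "f' \<in> borel_measurable M"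
    "g' \<in> borel_measurable M" "AE x in M. f x * g x = f' x * g' x"
  shows "ip M f g = ip M f' g'"
  unfolding ip_def using assms by (intro integral_cong_AE) auto

lemma ip_eq_0_if_AE_mult_eq_0:
  assumes "f \<in> borel_measurable M" "g \<in> borel_measurable M" "AE x in M. f x * g x = 0"
  shows "ip M f g = 0"
  using ip_cong_AE[OF assms(1,2), of "\<lambda>x. 0" "\<lambda>x. 0"] assms(3) by (simp add: ip_def)

lemma ip_nonneg: "AE x in M. 0 \<le> f x * g x \<Longrightarrow> 0 \<le> ip M f g"
  unfolding ip_def by (rule integral_nonneg_AE)

lemma AE_eq_0_if_quad_ip_le_0:
  assumes "f \<in> L2 M" "quad (ip M) f \<le> 0"
  shows "AE x in M. f x = 0"
proof -
  have "(\<integral>x. (f x)\<^sup>2 \<partial>M) = 0" using assms(2) quad_ip_nonneg[of M f] unfolding quad_ip by simp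
  then show ?thesis
    using integral_nonneg_eq_0_iff_AE[OF L2_integrable_square[OF assms(1)]] by simp
qed

definition Linf :: "'a measure \<Rightarrow> ('a \<Rightarrow> real) set" where
  "Linf M = {f. f \<in> borel_measurable M \<and> (\<exists>B. \<forall>x\<in>space M. \<bar>f x\<bar> \<le> B)}"

lemma LinfI: "f \<in> borel_measurable M \<Longrightarrow> (\<And>x. x \<in> space M \<Longrightarrow> \<bar>f x\<bar> \<le> B) \<Longrightarrow> f \<in> Linf M"
  by (auto simp: Linf_def)

lemma Linf_measurable [measurable_dest]: "f \<in> Linf M \<Longrightarrow> f \<in> borel_measurable M"
  by (simp add: Linf_def)

lemma LinfE:
  assumes "f \<in> Linf M"
  obtains B where "0 \<le> B" "\<And>x. x \<in> space M \<Longrightarrow> \<bar>f x\<bar> \<le> B"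
proof -
  obtain B where "\<And>x. x \<in> space M \<Longrightarrow> \<bar>f x\<bar> \<le> B" using assms by (auto simp: Linf_def)
  then show ?thesis by (intro that[of "max 0 B"]) (auto intro: max.coboundedI2)
qed

lemma Linf_const [simp]: "(\<lambda>x. c) \<in> Linf M"
  by (rule LinfI[of _ _ "\<bar>c\<bar>"]) auto

lemma Linf_indicator [simp]: "A \<in> sets M \<Longrightarrow> indicator A \<in> Linf M"
  by (rule LinfI[of _ _ 1]) (auto simp: indicator_def)

lemma Linf_mult [simp]:
  assumes "f \<in> Linf M" "g \<in> Linf M"
  shows "(\<lambda>x. f x * g x) \<in> Linf M"
proof -
  obtain B where B: "\<And>x. x \<in> space M \<Longrightarrow> \<bar>f x\<bar> \<le> B" by (rule LinfE[OF assms(1)]) blast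
  obtain C where C: "\<And>x. x \<in> space M \<Longrightarrow> \<bar>g x\<bar> \<le> C" by (rule LinfE[OF assms(2)]) blast
  show ?thesis
  proof (rule LinfI)
    show "\<bar>f x * g x\<bar> \<le> B * C" if "x \<in> space M" for x
      unfolding abs_mult using B[OF that] C[OF that] by (intro mult_mono) auto
  qed (use assms in measurable)
qed

lemma Linf_diff [simp]:
  assumes "f \<in> Linf M" "g \<in> Linf M"
  shows "(\<lambda>x. f x - g x) \<in> Linf M"
proof -
  obtain B where B: "\<And>x. x \<in> space M \<Longrightarrow> \<bar>f x\<bar> \<le> B" by (rule LinfE[OF assms(1)]) blast
  obtain C where C: "\<And>x. x \<in> space M \<Longrightarrow> \<bar>g x\<bar> \<le> C" by (rule LinfE[OF assms(2)]) blast
  show ?thesis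
  proof (rule LinfI)
    show "\<bar>f x - g x\<bar> \<le> B + C" if "x \<in> space M" for x using B[OF that] C[OF that] by linarith
  qed (use assms in measurable)
qed

lemma Linf_max_0 [simp]:
  assumes "f \<in> Linf M"
  shows "(\<lambda>x. max 0 (f x)) \<in> Linf M"
proof -
  obtain B where B: "\<And>x. x \<in> space M \<Longrightarrow> \<bar>f x\<bar> \<le> B" by (rule LinfE[OF assms]) blast
  show ?thesis
  proof (rule LinfI)
    show "\<bar>max 0 (f x)\<bar> \<le> B" if "x \<in> space M" for x using B[OF that] by linarith
  qed (use assms in measurable)
qed

lemma L2_Linf_mult:
  assumes "f \<in> L2 M" "g \<in> Linf M"
  shows "(\<lambda>x. g x * f x) \<in> L2 M"
proof -
  obtain B where B: "0 \<le> B" "\<And>x. x \<in> space M \<Longrightarrow> \<bar>g x\<bar> \<le> B" by (rule LinfE[OF assms(2)]) blast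
  show ?thesis
  proof (rule L2_dominated[OF L2.scale_mem[OF assms(1), of B]])
    show "AE x in M. \<bar>g x * f x\<bar> \<le> \<bar>B * f x\<bar>"
      using B by (intro AE_I2) (simp add: abs_mult mult_right_mono)
  qed (use assms in measurable)
qed

lemma integrable_mult_Linf:
  assumes "integrable M f" "g \<in> Linf M"
  shows "integrable M (\<lambda>x. f x * g x)"
proof -
  obtain B where B: "0 \<le> B" "\<And>x. x \<in> space M \<Longrightarrow> \<bar>g x\<bar> \<le> B" by (rule LinfE[OF assms(2)]) blast
  have "integrable M (\<lambda>x. B * f x)" using assms(1) by simp
  then show ?thesis
  proof (rule Bochner_Integration.integrable_bound)
    show "AE x in M. norm (f x * g x) \<le> norm (B * f x)"
      using B by (intro AE_I2) (simp add: abs_mult mult.commute[of B] mult_left_mono)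
  qed (use assms in measurable)
qed

lemma L2_if_integrable_Linf:
  assumes "integrable M f" "f \<in> Linf M"
  shows "f \<in> L2 M"
  using integrable_mult_Linf[OF assms] assms(1) by (simp add: L2_def power2_eq_square)

lemma abs_ip_le:
  assumes "integrable M f" "g \<in> borel_measurable M" and bound: "AE x in M. \<bar>g x\<bar> \<le> B"
  shows "\<bar>ip M f g\<bar> \<le> B * (\<integral>x. \<bar>f x\<bar> \<partial>M)"
proof -
  have Bf: "integrable M (\<lambda>x. B * \<bar>f x\<bar>)" using assms(1) by simp
  have le: "AE x in M. \<bar>f x * g x\<bar> \<le> B * \<bar>f x\<bar>"
    using bound by eventually_elim (simp add: abs_mult mult.commute[of B] mult_left_mono)
  have int: "integrable M (\<lambda>x. f x * g x)"
    using assms(1,2) le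
    by (intro Bochner_Integration.integrable_bound[OF Bf])
      (auto intro: order_trans[OF _ abs_ge_self])
  have "\<bar>ip M f g\<bar> \<le> (\<integral>x. \<bar>f x * g x\<bar> \<partial>M)" unfolding ip_def by (rule integral_abs_bound)
  also have "\<dots> \<le> (\<integral>x. B * \<bar>f x\<bar> \<partial>M)" using int Bf le by (intro integral_mono_AE) auto
  finally show ?thesis by simp
qed

lemma ip_diff_left_L1:
  "integrable M f \<Longrightarrow> integrable M f' \<Longrightarrow> g \<in> Linf M \<Longrightarrow>
    ip M (\<lambda>x. f x - f' x) g = ip M f g - ip M f' g"
  by (simp add: ip_def left_diff_distrib integrable_mult_Linf)

lemma ip_diff_right_Linf:
  "integrable M f \<Longrightarrow> g \<in> Linf M \<Longrightarrow> h \<in> Linf M \<Longrightarrow> ip M f (\<lambda>x. g x - h x) = ip M f g - ip M f h"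
  by (simp add: ip_def right_diff_distrib integrable_mult_Linf)

lemma ip_mono_right:
  assumes "integrable M f" "AE x in M. 0 \<le> f x" "g \<in> Linf M" "h \<in> Linf M"
    and "\<And>x. x \<in> space M \<Longrightarrow> g x \<le> h x"
  shows "ip M f g \<le> ip M f h"
  unfolding ip_def
proof (rule integral_mono_AE)
  show "AE x in M. f x * g x \<le> f x * h x"
    using assms(2) AE_space by eventually_elim (simp add: assms(5) mult_left_mono)
qed (use assms in \<open>simp_all add: integrable_mult_Linf\<close>)

lemma ip_tendsto_if_bounded:
  assumes "integrable M f" "\<And>n. g n \<in> borel_measurable M" "h \<in> borel_measurable M"
    and bound: "\<And>n x. x \<in> space M \<Longrightarrow> \<bar>g n x\<bar> \<le> B"
    and lim: "AE x in M. (\<lambda>n. g n x) \<longlonglongrightarrow> h x"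
  shows "(\<lambda>n. ip M f (g n)) \<longlonglongrightarrow> ip M f h"
  unfolding ip_def
proof (rule integral_dominated_convergence)
  show "integrable M (\<lambda>x. B * \<bar>f x\<bar>)" using assms(1) by simp
  show "AE x in M. norm (f x * g n x) \<le> B * \<bar>f x\<bar>" for n
    using bound by (intro AE_I2) (simp add: abs_mult mult.commute[of B] mult_left_mono)
  show "AE x in M. (\<lambda>n. f x * g n x) \<longlonglongrightarrow> f x * h x"
    using lim by eventually_elim (intro tendsto_intros)
qed (use assms in measurable)

lemma AE_le_if_ip_indicator_le:
  assumes "integrable M f" "integrable M g"
    and le: "\<And>A. A \<in> sets M \<Longrightarrow> ip M f (indicator A) \<le> ip M g (indicator A)"
  shows "AE x in M. f x \<le> g x"
proof -
  note [measurable] = assms(1,2)[THEN borel_measurable_integrable]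
  define A where "A = {x \<in> space M. g x < f x}"
  have A: "A \<in> sets M" unfolding A_def by measurable
  let ?d = "\<lambda>x. (f x - g x) * indicator A x"
  have nonneg: "AE x in M. 0 \<le> ?d x" by (auto simp: A_def indicator_def)
  have int: "integrable M ?d" using assms(1,2) A by (intro integrable_mult_Linf) auto
  have "(\<integral>x. ?d x \<partial>M) = ip M f (indicator A) - ip M g (indicator A)"
    using ip_diff_left_L1[OF assms(1,2), of "indicator A"] A by (simp add: ip_def)
  then have "(\<integral>x. ?d x \<partial>M) = 0" using le[OF A] integral_nonneg_AE[OF nonneg] by simp
  then have "AE x in M. ?d x = 0" using integral_nonneg_eq_0_iff_AE[OF int nonneg] by simp
  then show ?thesis
    using AE_space by eventually_elim (auto simp: A_def indicator_def split: if_splits)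
qed

lemma (in sigma_finite_measure) finite_exhaustion:
  obtains A :: "nat \<Rightarrow> 'a set" where "\<And>i. A i \<in> sets M" "\<And>i. emeasure M (A i) < \<infinity>" "incseq A"
    "(\<Union>i. A i) = space M"
  using sigma_finite_incseq by (metis infinity_ennreal_def less_top range_subsetD)

lemma (in sigma_finite_measure) integrable_if_set_integral_le:
  fixes f :: "'a \<Rightarrow> real"
  assumes [measurable]: "f \<in> borel_measurable M"
    and bound: "\<And>A. A \<in> sets M \<Longrightarrow> emeasure M A < \<infinity> \<Longrightarrow> (\<integral>\<^sup>+x\<in>A. ennreal \<bar>f x\<bar> \<partial>M) \<le> ennreal K"
  shows "integrable M f"
proof -
  obtain A where A: "\<And>i. A i \<in> sets M" "\<And>i. emeasure M (A i) < \<infinity>" "incseq A" "(\<Union>i. A i) = space M"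
    by (rule finite_exhaustion) blast
  let ?N = "density M (\<lambda>x. ennreal \<bar>f x\<bar>)"
  have "(\<integral>\<^sup>+x. ennreal \<bar>f x\<bar> \<partial>M) = emeasure ?N (\<Union>i. A i)"
    unfolding A(4) by (simp add: emeasure_density cong: nn_integral_cong)
  also have "\<dots> = (SUP i. emeasure ?N (A i))"
    using A(1,3) by (intro SUP_emeasure_incseq[symmetric]) auto
  also have "\<dots> \<le> ennreal K"
    using A(1) bound[OF A(1,2)] by (intro SUP_least) (simp add: emeasure_density)
  also have "\<dots> < \<infinity>" by simp
  finally show ?thesis by (intro integrableI_bounded) auto
qed

subsection \<open>Normal contractions\<close>

definition normal_contraction :: "(real \<Rightarrow> real) \<Rightarrow> bool" where
  "normal_contraction C \<longleftrightarrow> C 0 = 0 \<and> (\<forall>s t. \<bar>C s - C t\<bar> \<le> \<bar>s - t\<bar>)"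

lemma normal_contractionI:
  "C 0 = 0 \<Longrightarrow> (\<And>s t. \<bar>C s - C t\<bar> \<le> \<bar>s - t\<bar>) \<Longrightarrow> normal_contraction C"
  by (simp add: normal_contraction_def)

lemma normal_contraction_dist: "normal_contraction C \<Longrightarrow> \<bar>C s - C t\<bar> \<le> \<bar>s - t\<bar>"
  by (simp add: normal_contraction_def)

lemma normal_contraction_abs_le: "normal_contraction C \<Longrightarrow> \<bar>C s\<bar> \<le> \<bar>s\<bar>"
  using normal_contraction_dist[of C s 0] by (simp add: normal_contraction_def)

lemma isCont_normal_contraction:
  assumes "normal_contraction C"
  shows "isCont C s"
proof -
  have "1-lipschitz_on UNIV C"
    using normal_contraction_dist[OF assms] by (intro lipschitz_onI) (auto simp: dist_real_def)
  then show ?thesis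
    by (auto dest: lipschitz_on_continuous_on simp: continuous_on_eq_continuous_at)
qed

lemma normal_contraction_measurable [measurable_dest]:
  "normal_contraction C \<Longrightarrow> C \<in> borel_measurable borel"
  by (intro borel_measurable_continuous_onI continuous_at_imp_continuous_on ballI
      isCont_normal_contraction)

lemma L2_normal_contraction:
  assumes C: "normal_contraction C" and "f \<in> L2 M"
  shows "(\<lambda>x. C (f x)) \<in> L2 M"
proof (rule L2_dominated[OF assms(2)])
  show "(\<lambda>x. C (f x)) \<in> borel_measurable M"
    by (rule measurable_compose[OF L2_measurable[OF assms(2)] normal_contraction_measurable[OF C]])
  show "AE x in M. \<bar>C (f x)\<bar> \<le> \<bar>f x\<bar>" using normal_contraction_abs_le[OF C] by simp
qed

lemma ip_normal_contraction_tendsto: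
  assumes f: "f \<in> L2 M" and g: "g \<in> L2 M" and C: "\<And>n. normal_contraction (C n)"
    and lim: "\<And>s. (\<lambda>n. C n s) \<longlonglongrightarrow> s"
  shows "(\<lambda>n. ip M f (\<lambda>x. C n (g x))) \<longlonglongrightarrow> ip M f g"
  unfolding ip_def
proof (rule integral_dominated_convergence)
  note [measurable] = L2_measurable[OF f] L2_measurable[OF g]
    L2_measurable[OF L2_normal_contraction[OF C g]]
  show "integrable M (\<lambda>x. \<bar>f x * g x\<bar>)" using L2_mult_integrable[OF f g] by simp
  show "AE x in M. norm (f x * C n (g x)) \<le> \<bar>f x * g x\<bar>" for n
    unfolding real_norm_def abs_mult
    by (intro AE_I2 mult_left_mono normal_contraction_abs_le[OF C]) auto
  show "AE x in M. (\<lambda>n. f x * C n (g x)) \<longlonglongrightarrow> f x * g x" by (intro AE_I2 tendsto_intros lim)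
  show "(\<lambda>x. f x * g x) \<in> borel_measurable M" "(\<lambda>x. f x * C n (g x)) \<in> borel_measurable M" for n
    by measurable
qed

lemma normal_contraction_min: "0 \<le> b \<Longrightarrow> normal_contraction (\<lambda>s. min b s)"
  and normal_contraction_min_abs: "0 \<le> b \<Longrightarrow> normal_contraction (\<lambda>s. min b \<bar>s\<bar>)"
  by (auto intro!: normal_contractionI simp: max_def min_def)

definition clip :: "real \<Rightarrow> real \<Rightarrow> real" where
  "clip c s = max (- c) (min c s)"

lemma normal_contraction_clip: "0 \<le> c \<Longrightarrow> normal_contraction (clip c)"
  by (auto intro!: normal_contractionI simp: clip_def max_def min_def)

lemma abs_clip_le: "0 \<le> c \<Longrightarrow> \<bar>clip c s\<bar> \<le> c"
  by (auto simp: clip_def)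

lemma clip_eq_if_abs_le: "\<bar>s\<bar> \<le> c \<Longrightarrow> clip c s = s"
  by (auto simp: clip_def)

lemma clip_nonneg: "0 \<le> c \<Longrightarrow> 0 \<le> s \<Longrightarrow> 0 \<le> clip c s"
  by (auto simp: clip_def)

lemma clip_measurable [measurable]: "clip c \<in> borel_measurable borel"
  unfolding clip_def by measurable

lemma clip_tendsto:
  assumes "filterlim c at_top sequentially"
  shows "(\<lambda>n. clip (c n) s) \<longlonglongrightarrow> s"
proof (rule tendsto_eventually)
  show "\<forall>\<^sub>F n in sequentially. clip (c n) s = s"
    using filterlim_at_top[THEN iffD1, OF assms, rule_format, of "\<bar>s\<bar>"]
    by eventually_elim (rule clip_eq_if_abs_le)
qed

lemma clip_integrable:
  assumes "integrable M f" "0 \<le> c"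
  shows "integrable M (\<lambda>x. clip c (f x))"
  using assms normal_contraction_abs_le[OF normal_contraction_clip[OF assms(2)]]
  by (intro Bochner_Integration.integrable_bound[OF assms(1)]) auto

lemma clip_Linf: "f \<in> borel_measurable M \<Longrightarrow> 0 \<le> c \<Longrightarrow> (\<lambda>x. clip c (f x)) \<in> Linf M"
  by (rule LinfI[of _ _ c]) (auto simp: abs_clip_le)

lemma clip_L1_tendsto:
  assumes "integrable M f"
  shows "(\<lambda>n. \<integral>x. \<bar>f x - clip (real n) (f x)\<bar> \<partial>M) \<longlonglongrightarrow> 0"
proof -
  note [measurable] = borel_measurable_integrable[OF assms]
  have "(\<lambda>n. \<integral>x. \<bar>f x - clip (real n) (f x)\<bar> \<partial>M) \<longlonglongrightarrow> (\<integral>x. \<bar>f x - f x\<bar> \<partial>M)"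
  proof (rule integral_dominated_convergence)
    show "integrable M (\<lambda>x. 2 * \<bar>f x\<bar>)" using assms by simp
    show "AE x in M. (\<lambda>n. \<bar>f x - clip (real n) (f x)\<bar>) \<longlonglongrightarrow> \<bar>f x - f x\<bar>"
      by (intro AE_I2 tendsto_intros clip_tendsto filterlim_real_sequentially)
    show "AE x in M. norm \<bar>f x - clip (real n) (f x)\<bar> \<le> 2 * \<bar>f x\<bar>" for n
      using normal_contraction_abs_le[OF normal_contraction_clip[of "real n"]]
      by (intro AE_I2) (simp add: order_trans[OF abs_triangle_ineq4])
  qed measurable
  then show ?thesis by simp
qed

text \<open>Soft clipping also vanishes near 0, and therefore maps \<open>L\<^sup>2\<close> into \<open>L\<^sup>1\<close>.\<close>

definition soft_clip :: "real \<Rightarrow> real \<Rightarrow> real \<Rightarrow> real" where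
  "soft_clip d c s = clip c s - clip d s"

lemma normal_contraction_soft_clip:
  assumes "0 \<le> d" "d \<le> c"
  shows "normal_contraction (soft_clip d c)"
  using assms by (auto intro!: normal_contractionI simp: soft_clip_def clip_def max_def min_def)

lemma abs_soft_clip_le: "0 \<le> d \<Longrightarrow> d \<le> c \<Longrightarrow> \<bar>soft_clip d c s\<bar> \<le> c"
  by (auto simp: soft_clip_def clip_def max_def min_def)

lemma abs_soft_clip_le_square:
  assumes "0 < d" "d \<le> c"
  shows "\<bar>soft_clip d c s\<bar> \<le> s\<^sup>2 / d"
proof (cases "\<bar>s\<bar> \<le> d")
  case True
  then show ?thesis using assms by (simp add: soft_clip_def clip_eq_if_abs_le)
next
  case False
  then have "\<bar>s\<bar> * d \<le> \<bar>s\<bar> * \<bar>s\<bar>" by (intro mult_left_mono) auto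
  then have "\<bar>s\<bar> \<le> s\<^sup>2 / d" using assms by (simp add: pos_le_divide_eq power2_eq_square)
  moreover have "normal_contraction (soft_clip d c)"
    using assms by (intro normal_contraction_soft_clip) auto
  ultimately show ?thesis using normal_contraction_abs_le order_trans by blast
qed

lemma integrable_soft_clip:
  assumes "f \<in> L2 M" "0 < d" "d \<le> c"
  shows "integrable M (\<lambda>x. soft_clip d c (f x))"
proof (rule Bochner_Integration.integrable_bound)
  show "integrable M (\<lambda>x. (f x)\<^sup>2 / d)" using assms(1) by (simp add: L2_integrable_square)
  show "(\<lambda>x. soft_clip d c (f x)) \<in> borel_measurable M"
    using assms
    by (intro L2_measurable L2_normal_contraction[OF normal_contraction_soft_clip]) simp_all
  show "AE x in M. norm (soft_clip d c (f x)) \<le> norm ((f x)\<^sup>2 / d)"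
    using abs_soft_clip_le_square[OF assms(2,3)] assms(2) by simp
qed

lemma soft_clip_tendsto:
  assumes "d \<longlonglongrightarrow> 0" "\<And>n. 0 \<le> d n" "filterlim c at_top sequentially"
  shows "(\<lambda>n. soft_clip (d n) (c n) s) \<longlonglongrightarrow> s"
proof -
  have "(\<lambda>n. clip (d n) s) \<longlonglongrightarrow> 0"
    by (rule Lim_null_comparison[OF _ assms(1)]) (simp add: abs_clip_le assms(2))
  from tendsto_diff[OF clip_tendsto[OF assms(3)] this] show ?thesis
    by (simp add: soft_clip_def)
qed

subsection \<open>Differentiation in \<open>L\<^sup>2\<close>\<close>

definition L2_derivative :: "'a measure \<Rightarrow> (real \<Rightarrow> 'a \<Rightarrow> real) \<Rightarrow> ('a \<Rightarrow> real) \<Rightarrow> real \<Rightarrow> bool" where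
  "L2_derivative M u u' t \<longleftrightarrow> u t \<in> L2 M \<and> u' \<in> L2 M \<and> (\<forall>\<^sub>F h in at 0. u (t + h) \<in> L2 M) \<and>
     ((\<lambda>h. quad (ip M) (\<lambda>x. (u (t + h) x - u t x) / h - u' x)) \<longlongrightarrow> 0) (at 0)"

lemma L2_divide: "f \<in> L2 M \<Longrightarrow> (\<lambda>x. f x / c) \<in> L2 M"
  using L2.scale_mem[of f M "1 / c"] by simp

lemma L2_derivative_ip:
  assumes "L2_derivative M u u' t" and g: "g \<in> L2 M"
  shows "((\<lambda>s. ip M (u s) g) has_real_derivative ip M u' g) (at t)"
proof -
  have u: "u t \<in> L2 M" "u' \<in> L2 M" "\<forall>\<^sub>F h in at 0. u (t + h) \<in> L2 M"
    and lim: "((\<lambda>h. quad (ip M) (\<lambda>x. (u (t + h) x - u t x) / h - u' x)) \<longlongrightarrow> 0) (at 0)"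
    using assms(1) by (auto simp: L2_derivative_def)
  have "((\<lambda>h. ip M (\<lambda>x. (u (t + h) x - u t x) / h) g) \<longlongrightarrow> ip M u' g) (at 0)"
  proof (rule L2.tendsto_left[OF _ u(2) g lim])
    show "\<forall>\<^sub>F h in at 0. (\<lambda>x. (u (t + h) x - u t x) / h) \<in> L2 M"
      using u(3) by eventually_elim (intro L2_divide L2.diff_mem u(1))
  qed
  moreover have "\<forall>\<^sub>F h in at 0. ip M (\<lambda>x. (u (t + h) x - u t x) / h) g =
      (ip M (u (t + h)) g - ip M (u t) g) / h"
    using u(3)
  proof eventually_elim
    case (elim h)
    then show ?case
      using L2.scale_left[OF L2.diff_mem[OF elim u(1)] g, of "1 / h"] u(1) g
      by (simp add: L2.diff_left)
  qed
  ultimately show ?thesis unfolding DERIV_def by (rule Lim_transform_eventually)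
qed

lemma L2_derivative_quad_increment:
  assumes "L2_derivative M u u' t"
  shows "((\<lambda>h. quad (ip M) (\<lambda>x. u (t + h) x - u t x) / h) \<longlongrightarrow> 0) (at 0)"
proof -
  have u: "u t \<in> L2 M" "u' \<in> L2 M" "\<forall>\<^sub>F h in at 0. u (t + h) \<in> L2 M"
    and lim: "((\<lambda>h. quad (ip M) (\<lambda>x. (u (t + h) x - u t x) / h - u' x)) \<longlongrightarrow> 0) (at 0)"
    using assms by (auto simp: L2_derivative_def)
  have "((\<lambda>h. quad (ip M) (\<lambda>x. (u (t + h) x - u t x) / h)) \<longlongrightarrow> quad (ip M) u') (at 0)"
  proof (rule L2.quad_tendsto_if_quad_diff_tendsto_0[OF _ _ lim])
    show "\<forall>\<^sub>F h in at 0. (\<lambda>x. (u (t + h) x - u t x) / h) \<in> L2 M"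
      using u(3) by eventually_elim (intro L2_divide L2.diff_mem u(1))
  qed (use u(2) in auto)
  from tendsto_mult[OF tendsto_ident_at this]
  have "((\<lambda>h. h * quad (ip M) (\<lambda>x. (u (t + h) x - u t x) / h)) \<longlongrightarrow> 0) (at 0)" by simp
  moreover have "\<forall>\<^sub>F h in at (0::real). h * quad (ip M) (\<lambda>x. (u (t + h) x - u t x) / h) =
      quad (ip M) (\<lambda>x. u (t + h) x - u t x) / h"
    by (auto simp: eventually_at_filter quad_ip power_divide power2_eq_square)
  ultimately show ?thesis by (rule Lim_transform_eventually)
qed

definition quadratic_primitive :: "(real \<Rightarrow> real) \<Rightarrow> (real \<Rightarrow> real) \<Rightarrow> bool" where
  "quadratic_primitive \<theta> C \<longleftrightarrow> \<theta> \<in> borel_measurable borel \<and> normal_contraction C \<and> \<theta> 0 = 0 \<and>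
     (\<forall>a b. \<bar>\<theta> b - \<theta> a - C a * (b - a)\<bar> \<le> (b - a)\<^sup>2)"

lemma abs_half_square_Taylor_le: "\<bar>b\<^sup>2 / 2 - a\<^sup>2 / 2 - a * (b - a)\<bar> \<le> (b - a)\<^sup>2" for a b :: real
proof -
  have eq: "b\<^sup>2 / 2 - a\<^sup>2 / 2 - a * (b - a) = (b - a)\<^sup>2 / 2"
    by (simp add: power2_eq_square algebra_simps)
  show ?thesis unfolding eq by simp
qed

lemma quadratic_primitive_square: "quadratic_primitive (\<lambda>s. s\<^sup>2 / 2) (\<lambda>s. s)"
  unfolding quadratic_primitive_def normal_contraction_def using abs_half_square_Taylor_le by simp

lemma quadratic_primitive_negative_part: "quadratic_primitive (\<lambda>s. (min 0 s)\<^sup>2 / 2) (\<lambda>s. min 0 s)"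
proof -
  have "\<bar>(min 0 b)\<^sup>2 / 2 - (min 0 a)\<^sup>2 / 2 - min 0 a * (b - a)\<bar> \<le> (b - a)\<^sup>2" for a b :: real
  proof -
    consider (nonpos) "a \<le> 0" "b \<le> 0" | (increase) "a \<le> 0" "b > 0" | (decrease) "a > 0" "b \<le> 0"
      | (pos) "a > 0" "b > 0" by linarith
    then show ?thesis
    proof cases
      case nonpos
      then show ?thesis using abs_half_square_Taylor_le[of b a] by (simp add: min_def)
    next
      case increase
      have "- a\<^sup>2 / 2 - a * (b - a) = a\<^sup>2 / 2 - a * b"
        by (simp add: power2_eq_square algebra_simps)
      moreover have "a * b \<le> 0" using increase by (simp add: mult_nonpos_nonneg)
      moreover have "(b - a)\<^sup>2 = b\<^sup>2 - 2 * (a * b) + a\<^sup>2" by (simp add: power2_diff)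
      ultimately have "\<bar>- a\<^sup>2 / 2 - a * (b - a)\<bar> \<le> (b - a)\<^sup>2"
        using zero_le_power2[of a] zero_le_power2[of b] by linarith
      then show ?thesis using increase by (simp add: min_def)
    next
      case decrease
      then have "b\<^sup>2 \<le> (b - a)\<^sup>2" by (simp flip: abs_le_square_iff)
      then have "\<bar>b\<^sup>2 / 2\<bar> \<le> (b - a)\<^sup>2" using zero_le_power2[of b] by linarith
      then show ?thesis using decrease by (simp add: min_def)
    qed (simp add: min_def)
  qed
  then show ?thesis
    using normal_contraction_min[of 0] by (simp add: quadratic_primitive_def)
qed

lemma quadratic_primitive_integrable:
  assumes "quadratic_primitive \<theta> C" and f: "f \<in> L2 M"
  shows "integrable M (\<lambda>x. \<theta> (f x))"
proof (rule Bochner_Integration.integrable_bound[OF L2_integrable_square[OF f]])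
  have C: "C 0 = 0" and \<theta>: "\<theta> 0 = 0" "\<And>a b. \<bar>\<theta> b - \<theta> a - C a * (b - a)\<bar> \<le> (b - a)\<^sup>2"
    and [measurable]: "\<theta> \<in> borel_measurable borel"
    using assms(1) by (auto simp: quadratic_primitive_def normal_contraction_def)
  note [measurable] = L2_measurable[OF f]
  show "(\<lambda>x. \<theta> (f x)) \<in> borel_measurable M" by measurable
  show "AE x in M. norm (\<theta> (f x)) \<le> norm ((f x)\<^sup>2)"
    using \<theta>(2)[of _ 0] by (simp add: C \<theta>(1))
qed

lemma integral_primitive_Taylor:
  assumes \<theta>: "quadratic_primitive \<theta> C" and f: "f \<in> L2 M" and g: "g \<in> L2 M"
  shows "\<bar>(\<integral>x. \<theta> (g x) \<partial>M) - (\<integral>x. \<theta> (f x) \<partial>M) - ip M (\<lambda>x. g x - f x) (\<lambda>x. C (f x))\<bar>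
    \<le> quad (ip M) (\<lambda>x. g x - f x)"
proof -
  have C: "normal_contraction C" and bound: "\<And>a b. \<bar>\<theta> b - \<theta> a - C a * (b - a)\<bar> \<le> (b - a)\<^sup>2"
    using \<theta> by (auto simp: quadratic_primitive_def)
  have Cf: "(\<lambda>x. C (f x)) \<in> L2 M" by (rule L2_normal_contraction[OF C f])
  note int = \<theta>[THEN quadratic_primitive_integrable, OF f] \<theta>[THEN quadratic_primitive_integrable, OF g]
    L2_mult_integrable[OF L2.diff_mem[OF g f] Cf]
  have "(\<integral>x. \<theta> (g x) \<partial>M) - (\<integral>x. \<theta> (f x) \<partial>M) - ip M (\<lambda>x. g x - f x) (\<lambda>x. C (f x)) =
      (\<integral>x. \<theta> (g x) - \<theta> (f x) - (g x - f x) * C (f x) \<partial>M)"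
    using int by (simp add: ip_def)
  also have "\<bar>\<dots>\<bar> \<le> (\<integral>x. \<bar>\<theta> (g x) - \<theta> (f x) - (g x - f x) * C (f x)\<bar> \<partial>M)"
    by (rule integral_abs_bound)
  also have "\<dots> \<le> (\<integral>x. (g x - f x)\<^sup>2 \<partial>M)"
    using int bound f g by (intro integral_mono) (auto simp: L2_integrable_square mult.commute)
  finally show ?thesis by (simp add: quad_ip)
qed

lemma integral_primitive_tendsto:
  assumes \<theta>: "quadratic_primitive \<theta> C" and f: "\<forall>\<^sub>F n in F. f n \<in> L2 M" and g: "g \<in> L2 M"
    and lim: "((\<lambda>n. quad (ip M) (\<lambda>x. f n x - g x)) \<longlongrightarrow> 0) F"
  shows "((\<lambda>n. \<integral>x. \<theta> (f n x) \<partial>M) \<longlongrightarrow> (\<integral>x. \<theta> (g x) \<partial>M)) F"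
proof (rule LIM_zero_cancel, rule Lim_null_comparison)
  let ?Cg = "\<lambda>x. C (g x)"
  have Cg: "?Cg \<in> L2 M"
    by (rule L2_normal_contraction[OF _ g]) (use \<theta> in \<open>simp add: quadratic_primitive_def\<close>)
  have "((\<lambda>n. ip M (f n) ?Cg - ip M g ?Cg) \<longlongrightarrow> 0) F"
    using L2.tendsto_left[OF f g Cg lim] by (rule LIM_zero)
  from tendsto_add[OF tendsto_rabs[OF this] lim]
  show "((\<lambda>n. \<bar>ip M (f n) ?Cg - ip M g ?Cg\<bar> + quad (ip M) (\<lambda>x. f n x - g x)) \<longlongrightarrow> 0) F" by simp
  show "\<forall>\<^sub>F n in F. norm ((\<integral>x. \<theta> (f n x) \<partial>M) - (\<integral>x. \<theta> (g x) \<partial>M)) \<le>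
      \<bar>ip M (f n) ?Cg - ip M g ?Cg\<bar> + quad (ip M) (\<lambda>x. f n x - g x)"
    using f
  proof eventually_elim
    case (elim n)
    then show ?case
      using integral_primitive_Taylor[OF \<theta> g elim] L2.diff_left[OF elim g Cg] by simp
  qed
qed

lemma L2_derivative_integral_primitive:
  assumes \<theta>: "quadratic_primitive \<theta> C" and u: "L2_derivative M u u' t"
  shows "((\<lambda>s. \<integral>x. \<theta> (u s x) \<partial>M) has_real_derivative ip M u' (\<lambda>x. C (u t x))) (at t)"
proof -
  let ?\<Phi> = "\<lambda>s. \<integral>x. \<theta> (u s x) \<partial>M" and ?c = "\<lambda>x. C (u t x)"
  have ut: "u t \<in> L2 M" "\<forall>\<^sub>F h in at 0. u (t + h) \<in> L2 M" using u by (auto simp: L2_derivative_def)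
  have c: "?c \<in> L2 M"
    by (rule L2_normal_contraction[OF _ ut(1)]) (use \<theta> in \<open>simp add: quadratic_primitive_def\<close>)
  have "((\<lambda>h. (?\<Phi> (t + h) - ?\<Phi> t) / h - (ip M (u (t + h)) ?c - ip M (u t) ?c) / h) \<longlongrightarrow> 0) (at 0)"
  proof (rule Lim_null_comparison)
    show "((\<lambda>h. \<bar>quad (ip M) (\<lambda>x. u (t + h) x - u t x) / h\<bar>) \<longlongrightarrow> 0) (at 0)"
      using L2_derivative_quad_increment[OF u] by (rule tendsto_rabs_zero)
    show "\<forall>\<^sub>F h in at 0. norm ((?\<Phi> (t + h) - ?\<Phi> t) / h - (ip M (u (t + h)) ?c - ip M (u t) ?c) / h)
        \<le> \<bar>quad (ip M) (\<lambda>x. u (t + h) x - u t x) / h\<bar>"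
      using ut(2)
    proof eventually_elim
      case (elim h)
      have "\<bar>?\<Phi> (t + h) - ?\<Phi> t - (ip M (u (t + h)) ?c - ip M (u t) ?c)\<bar> / \<bar>h\<bar>
          \<le> quad (ip M) (\<lambda>x. u (t + h) x - u t x) / \<bar>h\<bar>"
        using integral_primitive_Taylor[OF \<theta> ut(1) elim] L2.diff_left[OF elim ut(1) c]
        by (intro divide_right_mono) auto
      then show ?case by (simp add: diff_divide_distrib[symmetric] abs_divide)
    qed
  qed
  from tendsto_add[OF this L2_derivative_ip[OF u c, unfolded DERIV_def]]
  show ?thesis unfolding DERIV_def by simp
qed

subsection \<open>Unbounded sequences and mixtures of densities\<close>

definition unbounded_set :: "'a measure \<Rightarrow> (nat \<Rightarrow> 'a \<Rightarrow> real) \<Rightarrow> 'a set" where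
  "unbounded_set M F = {x \<in> space M. \<forall>k::nat. \<exists>n. real k < F n x}"

lemma unbounded_set_measurable [measurable]:
  assumes [measurable]: "\<And>n. F n \<in> borel_measurable M"
  shows "unbounded_set M F \<in> sets M"
  unfolding unbounded_set_def by measurable

lemma limit_eq_infinity_on_unbounded_set:
  assumes "x \<in> unbounded_set M F" "\<And>n. F n x \<le> F (Suc n) x" and lim: "(\<lambda>n. ereal (F n x)) \<longlonglongrightarrow> l"
  shows "l = \<infinity>"
proof (rule ereal_top)
  fix c :: real
  have inc: "incseq (\<lambda>n. ereal (F n x))" using assms(2) by (intro incseq_SucI) simp
  obtain k :: nat where "c \<le> real k" using real_arch_simple by blast
  moreover obtain n where "real k < F n x" using assms(1) by (auto simp: unbounded_set_def)
  ultimately have "ereal c \<le> ereal (F n x)" by simp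
  also have "\<dots> \<le> l" by (rule incseq_le[OF inc lim])
  finally show "ereal c \<le> l" .
qed

lemma AE_eq_0_on_unbounded_set:
  assumes F: "\<And>n. integrable M (F n)" "AE x in M. \<forall>n. 0 \<le> F n x \<and> F n x \<le> F (Suc n) x"
    and p: "p \<in> Linf M" "\<And>x. 0 \<le> p x" and bound: "\<And>n. ip M (F n) p \<le> K"
  shows "AE x in M. x \<in> unbounded_set M F \<longrightarrow> p x = 0"
proof -
  note [measurable] = borel_measurable_integrable[OF F(1)] Linf_measurable[OF p(1)]
  let ?s = "\<lambda>x. SUP n. ennreal (F n x * p x)"
  have "(\<integral>\<^sup>+x. ?s x \<partial>M) = (SUP n. \<integral>\<^sup>+x. ennreal (F n x * p x) \<partial>M)"
  proof (rule nn_integral_monotone_convergence_SUP_AE)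
    show "AE x in M. ennreal (F n x * p x) \<le> ennreal (F (Suc n) x * p x)" for n
      using F(2) by eventually_elim (simp add: ennreal_leI mult_right_mono p(2))
  qed measurable
  also have "\<dots> \<le> ennreal K"
  proof (rule SUP_least)
    fix n
    have "AE x in M. 0 \<le> F n x * p x" using F(2) by eventually_elim (simp add: p(2))
    then show "(\<integral>\<^sup>+x. ennreal (F n x * p x) \<partial>M) \<le> ennreal K"
      using bound[of n] integrable_mult_Linf[OF F(1) p(1), of n]
      by (simp add: nn_integral_eq_integral ip_def ennreal_leI)
  qed
  also have "\<dots> < \<infinity>" by simp
  finally have "AE x in M. ?s x \<noteq> \<infinity>" by (intro nn_integral_noteq_infinite) auto
  moreover have "?s x = \<infinity>" if x: "x \<in> unbounded_set M F" and "p x \<noteq> 0" for x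
    unfolding infinity_ennreal_def
  proof (rule ennreal_SUP_eq_top)
    fix k :: nat
    have pos: "0 < p x" using p(2)[of x] \<open>p x \<noteq> 0\<close> by simp
    obtain l :: nat where l: "real k / p x \<le> real l" using real_arch_simple by blast
    obtain n where n: "real l < F n x" using x by (auto simp: unbounded_set_def)
    have "real k \<le> F n x * p x" using l n pos by (simp add: pos_divide_le_eq order_trans)
    then show "\<exists>n\<in>UNIV. of_nat k \<le> ennreal (F n x * p x)"
      by (auto simp: ennreal_of_nat_eq_real_of_nat intro!: ennreal_leI)
  qed
  ultimately show ?thesis by (auto elim!: eventually_mono)
qed

lemma (in sigma_finite_measure) ex_weight_bounding_sequence:
  assumes F: "\<And>n. integrable M (F n)"
  obtains h :: "'a \<Rightarrow> real" and K where "integrable M h" "\<And>x. 0 \<le> h x \<and> h x \<le> 1"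
    "\<And>x. x \<in> space M \<Longrightarrow> h x = 0 \<longleftrightarrow> x \<in> unbounded_set M F" "\<And>n. ip M (F n) h \<le> K"
proof -
  obtain g :: "'a \<Rightarrow> real" where g: "g \<in> borel_measurable M" "\<And>x. 0 < g x" "\<And>x. g x \<le> 1"
    "integrable M g"
    using obtain_positive_integrable_function by blast
  define S where "S x = enn2real (SUP n. ennreal (F n x))" for x
  define h where "h x = (if x \<in> unbounded_set M F then 0 else g x / (1 + S x))" for x
  note [measurable] = g(1) borel_measurable_integrable[OF F]
  have [measurable]: "S \<in> borel_measurable M" unfolding S_def by measurable
  have [measurable]: "h \<in> borel_measurable M" unfolding h_def by measurable
  have S: "0 \<le> S x" for x by (simp add: S_def)
  have h_le_g: "0 \<le> h x \<and> h x \<le> g x" for x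
    using S[of x] g(2)[of x] by (simp add: h_def pos_divide_le_eq add_pos_nonneg)
  have h01: "0 \<le> h x \<and> h x \<le> 1" for x using h_le_g[of x] g(3)[of x] by linarith
  have Fh: "F n x * h x \<le> g x" if x: "x \<in> space M" for n x
  proof (cases "x \<in> unbounded_set M F")
    case False
    then obtain k :: nat where "\<And>n. F n x \<le> real k"
      using x by (auto simp: unbounded_set_def not_less)
    then have "(SUP n. ennreal (F n x)) \<le> ennreal (real k)" by (intro SUP_least ennreal_leI)
    then have "(SUP n. ennreal (F n x)) < \<infinity>" by (rule le_less_trans) simp
    then have "enn2real (ennreal (F n x)) \<le> S x"
      unfolding S_def by (intro enn2real_mono SUP_upper) auto
    then have "F n x \<le> 1 + S x" using S[of x] by (cases "0 \<le> F n x") auto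
    then have "F n x * (g x / (1 + S x)) \<le> (1 + S x) * (g x / (1 + S x))"
      using S[of x] g(2)[of x] by (intro mult_right_mono) auto
    then show ?thesis using False S[of x] by (simp add: h_def)
  qed (use g(2)[of x] in \<open>simp add: h_def\<close>)
  have int: "integrable M h"
    using h_le_g
    by (intro Bochner_Integration.integrable_bound[OF g(4)])
      (auto intro!: AE_I2 intro: order_trans[OF _ abs_ge_self])
  have "h \<in> Linf M" using h01 by (intro LinfI[of _ _ 1]) auto
  then have "ip M (F n) h \<le> (\<integral>x. g x \<partial>M)" for n
    unfolding ip_def using Fh g(4) by (intro integral_mono integrable_mult_Linf[OF F])
  moreover have "h x = 0 \<longleftrightarrow> x \<in> unbounded_set M F" for x
    using S[of x] g(2)[of x] by (auto simp: h_def)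
  ultimately show ?thesis using that[OF int h01] by blast
qed

lemma (in sigma_finite_measure) ex_mixture_density:
  fixes h :: "'s \<Rightarrow> 'a \<Rightarrow> ennreal"
  assumes h: "\<And>s. s \<in> space L \<Longrightarrow> h s \<in> borel_measurable M"
    and meas: "\<And>A. A \<in> sets M \<Longrightarrow> (\<lambda>s. \<integral>\<^sup>+x\<in>A. h s x \<partial>M) \<in> borel_measurable L"
  shows "\<exists>H\<in>borel_measurable M. \<forall>A\<in>sets M.
    (\<integral>\<^sup>+x\<in>A. H x \<partial>M) = (\<integral>\<^sup>+s. (\<integral>\<^sup>+x\<in>A. h s x \<partial>M) \<partial>L)"
proof -
  define \<nu> where "\<nu> A = (\<integral>\<^sup>+s. (\<integral>\<^sup>+x\<in>A. h s x \<partial>M) \<partial>L)" for A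
  define N where "N = measure_of (space M) (sets M) \<nu>"
  have "countably_additive (sets M) \<nu>"
  proof (rule countably_additiveI)
    fix A :: "nat \<Rightarrow> 'a set" assume A: "range A \<subseteq> sets M" "disjoint_family A"
    have "(\<Sum>i. \<nu> (A i)) = (\<integral>\<^sup>+s. (\<Sum>i. \<integral>\<^sup>+x\<in>A i. h s x \<partial>M) \<partial>L)"
      unfolding \<nu>_def using A by (intro nn_integral_suminf[symmetric] meas) auto
    also have "\<dots> = \<nu> (\<Union>i. A i)"
      unfolding \<nu>_def
    proof (rule nn_integral_cong)
      fix s assume "s \<in> space L"
      note [measurable] = h[OF this]
      have "emeasure (density M (h s)) (\<Union>i. A i) = (\<Sum>i. emeasure (density M (h s)) (A i))"
        using A by (intro suminf_emeasure[symmetric]) auto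
      then show "(\<Sum>i. \<integral>\<^sup>+x\<in>A i. h s x \<partial>M) = (\<integral>\<^sup>+x\<in>(\<Union>i. A i). h s x \<partial>M)"
        using A(1) by (simp add: emeasure_density range_subsetD sets.countable_UN)
    qed
    finally show "(\<Sum>i. \<nu> (A i)) = \<nu> (\<Union>i. A i)" .
  qed
  then have N: "emeasure N A = \<nu> A" if "A \<in> sets M" for A
    unfolding N_def using that
    by (intro emeasure_measure_of_sigma sets.sigma_algebra_axioms)
      (auto simp: positive_def \<nu>_def)
  have sets_N: "sets N = sets M" by (simp add: N_def)
  have "absolutely_continuous M N"
    unfolding absolutely_continuous_def
  proof
    fix A assume A: "A \<in> null_sets M"
    then have "(\<integral>\<^sup>+x\<in>A. h s x \<partial>M) = 0" for s
      using AE_not_in[OF A] by (subst nn_integral_cong_AE[of _ "\<lambda>x. 0"]) (auto elim!: AE_mp)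
    then show "A \<in> null_sets N" using A by (simp add: null_sets_def sets_N N \<nu>_def)
  qed
  then obtain H where H: "H \<in> borel_measurable M" "density M H = N"
    using Radon_Nikodym[OF _ sets_N] by blast
  then have "(\<integral>\<^sup>+x\<in>A. H x \<partial>M) = \<nu> A" if "A \<in> sets M" for A
    using that N[OF that] by (simp flip: H(2) add: emeasure_density)
  with H(1) show ?thesis unfolding \<nu>_def by blast
qed

lemma incseq_nn_integral_mult:
  fixes U :: "nat \<Rightarrow> 'a \<Rightarrow> ennreal"
  assumes "incseq U"
  shows "incseq (\<lambda>i. \<integral>\<^sup>+x. k x * U i x \<partial>M)"
  using assms by (auto simp: incseq_def le_fun_def intro!: nn_integral_mono mult_left_mono)

lemma nn_integral_mult_SUP:
  fixes U :: "nat \<Rightarrow> 'a \<Rightarrow> ennreal"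
  assumes "k \<in> borel_measurable M" "\<And>i. U i \<in> borel_measurable M" and "incseq U"
  shows "(\<integral>\<^sup>+x. k x * (SUP i. U i x) \<partial>M) = (SUP i. \<integral>\<^sup>+x. k x * U i x \<partial>M)"
proof -
  have "incseq (\<lambda>i x. k x * U i x)"
    using assms(3) by (auto simp: incseq_def le_fun_def intro!: mult_left_mono)
  then have "(\<integral>\<^sup>+x. (SUP i. k x * U i x) \<partial>M) = (SUP i. \<integral>\<^sup>+x. k x * U i x \<partial>M)"
    using assms(1,2) by (intro nn_integral_monotone_convergence_SUP) auto
  then show ?thesis by (simp add: SUP_mult_left_ennreal)
qed

lemma nn_integral_mixture_density:
  fixes h :: "'s \<Rightarrow> 'a \<Rightarrow> ennreal"
  assumes h: "\<And>s. s \<in> space L \<Longrightarrow> h s \<in> borel_measurable M"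
    and meas: "\<And>A. A \<in> sets M \<Longrightarrow> (\<lambda>s. \<integral>\<^sup>+x\<in>A. h s x \<partial>M) \<in> borel_measurable L"
    and H: "H \<in> borel_measurable M"
    and mixture: "\<And>A. A \<in> sets M \<Longrightarrow> (\<integral>\<^sup>+x\<in>A. H x \<partial>M) = (\<integral>\<^sup>+s. (\<integral>\<^sup>+x\<in>A. h s x \<partial>M) \<partial>L)"
    and "g \<in> borel_measurable M"
  shows "(\<lambda>s. \<integral>\<^sup>+x. h s x * g x \<partial>M) \<in> borel_measurable L \<and>
    (\<integral>\<^sup>+x. H x * g x \<partial>M) = (\<integral>\<^sup>+s. (\<integral>\<^sup>+x. h s x * g x \<partial>M) \<partial>L)"
  using \<open>g \<in> borel_measurable M\<close>
proof (induction g rule: borel_measurable_induct)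
  case (cong f g)
  then show ?case by (simp cong: nn_integral_cong)
next
  case (set A)
  then show ?case using meas mixture by simp
next
  case (mult u c)
  have "(\<integral>\<^sup>+x. k x * (c * u x) \<partial>M) = c * (\<integral>\<^sup>+x. k x * u x \<partial>M)" if "k \<in> borel_measurable M" for k
    using that mult(2) by (simp add: nn_integral_cmult mult.left_commute)
  moreover note [measurable] = mult(4)[THEN conjunct1]
  ultimately show ?case
    using mult h H by (simp add: nn_integral_cmult cong: measurable_cong nn_integral_cong)
next
  case (add u v)
  have "(\<integral>\<^sup>+x. k x * (v x + u x) \<partial>M) = (\<integral>\<^sup>+x. k x * v x \<partial>M) + (\<integral>\<^sup>+x. k x * u x \<partial>M)"
    if "k \<in> borel_measurable M" for k
    using that add(1,3) by (simp add: nn_integral_add distrib_left)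
  moreover note [measurable] = add(6,7)[THEN conjunct1]
  ultimately show ?case
    using add h H by (simp add: nn_integral_add cong: measurable_cong nn_integral_cong)
next
  case (seq U)
  note sup = nn_integral_mult_SUP[OF _ seq(1,3)] and mono = incseq_nn_integral_mult[OF seq(3)]
  have "(\<integral>\<^sup>+s. (SUP i. \<integral>\<^sup>+x. h s x * U i x \<partial>M) \<partial>L) = (SUP i. \<integral>\<^sup>+s. (\<integral>\<^sup>+x. h s x * U i x \<partial>M) \<partial>L)"
  proof (rule nn_integral_monotone_convergence_SUP_AE)
    show "AE s in L. (\<integral>\<^sup>+x. h s x * U i x \<partial>M) \<le> (\<integral>\<^sup>+x. h s x * U (Suc i) x \<partial>M)" for i
      using mono by (intro AE_I2) (auto simp: incseq_Suc_iff)
  qed (use seq(5) in blast)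
  moreover note [measurable] = seq(5)[THEN conjunct1]
  ultimately show ?case
    using seq(5) h H by (simp add: sup del: Sup_apply cong: measurable_cong nn_integral_cong)
qed

section \<open>Dirichlet forms\<close>

lemma gen_rel_mem: "gen_rel M D Q v w \<Longrightarrow> v \<in> D"
  and gen_rel_L2: "gen_rel M D Q v w \<Longrightarrow> w \<in> L2 M"
  and gen_rel_form: "gen_rel M D Q v w \<Longrightarrow> u \<in> D \<Longrightarrow> Q v u = ip M w u"
  by (auto simp: gen_rel_def)

lemma gen_relI:
  "v \<in> D \<Longrightarrow> w \<in> L2 M \<Longrightarrow> (\<And>u. u \<in> D \<Longrightarrow> Q v u = ip M w u) \<Longrightarrow> gen_rel M D Q v w"
  by (simp add: gen_rel_def)

context psd_form
begin

lemma gen_rel_swap: "gen_rel M V B v w \<Longrightarrow> gen_rel M V B v' w' \<Longrightarrow> ip M w v' = ip M w' v"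
  using sym[of v v'] by (simp add: gen_rel_mem flip: gen_rel_form[of M V B])

lemma gen_rel_diff:
  assumes "V \<subseteq> L2 M" "gen_rel M V B v w" "gen_rel M V B v' w'"
  shows "gen_rel M V B (\<lambda>x. v x - v' x) (\<lambda>x. w x - w' x)"
proof (rule gen_relI)
  note v = assms(2,3)[THEN gen_rel_mem] and w = assms(2,3)[THEN gen_rel_L2]
  show "(\<lambda>x. v x - v' x) \<in> V" "(\<lambda>x. w x - w' x) \<in> L2 M" using v w by auto
  show "B (\<lambda>x. v x - v' x) u = ip M (\<lambda>x. w x - w' x) u" if "u \<in> V" for u
    using that v w assms by (auto simp: diff_left L2.diff_left gen_rel_form[of M V B])
qed

lemma gen_rel_uminus: "V \<subseteq> L2 M \<Longrightarrow> gen_rel M V B v w \<Longrightarrow> gen_rel M V B (\<lambda>x. - v x) (\<lambda>x. - w x)"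
  using gen_rel_diff[of M "\<lambda>x. 0" "\<lambda>x. 0" v w] scale_left[of "\<lambda>x. 0" _ 0]
    ip_scale_left[of M 0 "\<lambda>x. 0"] by (simp add: gen_rel_def)

end

locale dirichlet_space = sigma_finite_measure M
  for M :: "'a measure" +
  fixes D :: "('a \<Rightarrow> real) set" and Q :: "('a \<Rightarrow> real) \<Rightarrow> ('a \<Rightarrow> real) \<Rightarrow> real"
  assumes form: "dirichlet_form M D Q"
begin

abbreviation pairing :: "('a \<Rightarrow> real) \<Rightarrow> ('a \<Rightarrow> real) \<Rightarrow> real" ("\<langle>_, _\<rangle>") where
  "\<langle>f, g\<rangle> \<equiv> ip M f g"

abbreviation gen :: "('a \<Rightarrow> real) \<Rightarrow> ('a \<Rightarrow> real) \<Rightarrow> bool" where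
  "gen \<equiv> gen_rel M D Q"

lemma D_subset_L2: "D \<subseteq> L2 M"
  and D_cong: "f \<in> D \<Longrightarrow> g \<in> borel_measurable M \<Longrightarrow> AE x in M. f x = g x \<Longrightarrow> g \<in> D"
  using form by (simp_all add: dirichlet_form_def)

lemma Q_cong_left:
  "f \<in> D \<Longrightarrow> g \<in> borel_measurable M \<Longrightarrow> AE x in M. f x = g x \<Longrightarrow> h \<in> D \<Longrightarrow> Q g h = Q f h"
  using form unfolding dirichlet_form_def by metis

sublocale Q: psd_form D Q
proof
  fix f g h and c :: real
  show "(\<lambda>x. 0) \<in> D" "f \<in> D \<Longrightarrow> g \<in> D \<Longrightarrow> (\<lambda>x. f x + g x) \<in> D" "f \<in> D \<Longrightarrow> (\<lambda>x. c * f x) \<in> D"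
    "f \<in> D \<Longrightarrow> 0 \<le> quad Q f"
    using form by (simp_all add: dirichlet_form_def)
  show "f \<in> D \<Longrightarrow> g \<in> D \<Longrightarrow> Q f g = Q g f"
    "f \<in> D \<Longrightarrow> g \<in> D \<Longrightarrow> h \<in> D \<Longrightarrow> Q (\<lambda>x. f x + g x) h = Q f h + Q g h"
    "f \<in> D \<Longrightarrow> h \<in> D \<Longrightarrow> Q (\<lambda>x. c * f x) h = c * Q f h"
    using form unfolding dirichlet_form_def by metis+
qed

lemma quad_cong:
  assumes "f \<in> D" "g \<in> borel_measurable M" "AE x in M. f x = g x"
  shows "quad Q g = quad Q f"
  using Q_cong_left[OF assms] D_cong[OF assms] Q.sym assms(1) by metis

lemma D_L2: "f \<in> D \<Longrightarrow> f \<in> L2 M"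
  using D_subset_L2 by blast

lemma D_measurable [measurable_dest]: "f \<in> D \<Longrightarrow> f \<in> borel_measurable M"
  by (auto dest: D_L2 L2_measurable)

lemma D_contraction: "normal_contraction C \<Longrightarrow> f \<in> D \<Longrightarrow> (\<lambda>x. C (f x)) \<in> D"
  and quad_contraction_le: "normal_contraction C \<Longrightarrow> f \<in> D \<Longrightarrow> quad Q (\<lambda>x. C (f x)) \<le> quad Q f"
proof -
  have "\<forall>f\<in>D. \<forall>C. C 0 = 0 \<and> (\<forall>s t. \<bar>C s - C t\<bar> \<le> \<bar>s - t\<bar>) \<longrightarrow>
      (\<lambda>x. C (f x)) \<in> D \<and> quad Q (\<lambda>x. C (f x)) \<le> quad Q f"
    using form unfolding dirichlet_form_def by (elim conjE)
  then show "normal_contraction C \<Longrightarrow> f \<in> D \<Longrightarrow> (\<lambda>x. C (f x)) \<in> D"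
    "normal_contraction C \<Longrightarrow> f \<in> D \<Longrightarrow> quad Q (\<lambda>x. C (f x)) \<le> quad Q f"
    unfolding normal_contraction_def by blast+
qed

lemma D_complete:
  assumes u: "\<And>n. u n \<in> D" and Cauchy: "form_Cauchy Q u" "form_Cauchy (ip M) u"
  obtains v where "v \<in> D" "(\<lambda>n. quad Q (\<lambda>x. u n x - v x)) \<longlonglongrightarrow> 0"
    "(\<lambda>n. quad (ip M) (\<lambda>x. u n x - v x)) \<longlonglongrightarrow> 0"
proof -
  let ?N = "\<lambda>f. quad Q f + (l2norm M f)\<^sup>2"
  have small: "\<exists>N. \<forall>n\<ge>N. \<forall>m\<ge>N. ?N (\<lambda>x. u n x - u m x) < e" if e: "e > 0" for e
  proof -
    obtain N where N: "\<And>n m. n \<ge> N \<Longrightarrow> m \<ge> N \<Longrightarrow> quad Q (\<lambda>x. u n x - u m x) < e / 2"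
      by (rule form_CauchyE[OF Cauchy(1) half_gt_zero[OF e]]) blast
    obtain N' where N': "\<And>n m. n \<ge> N' \<Longrightarrow> m \<ge> N' \<Longrightarrow> quad (ip M) (\<lambda>x. u n x - u m x) < e / 2"
      by (rule form_CauchyE[OF Cauchy(2) half_gt_zero[OF e]]) blast
    have "?N (\<lambda>x. u n x - u m x) < e" if "n \<ge> max N N'" "m \<ge> max N N'" for n m
      using N[of n m] N'[of n m] that unfolding l2norm_square by simp
    then show ?thesis by blast
  qed
  have closed: "\<forall>u. (\<forall>n. u n \<in> D) \<and> (\<forall>e>0. \<exists>N. \<forall>n\<ge>N. \<forall>m\<ge>N. ?N (\<lambda>x. u n x - u m x) < e) \<longrightarrow>
      (\<exists>v\<in>D. (\<lambda>n. ?N (\<lambda>x. u n x - v x)) \<longlonglongrightarrow> 0)"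
    using form unfolding dirichlet_form_def by (elim conjE)
  have "\<exists>v\<in>D. (\<lambda>n. ?N (\<lambda>x. u n x - v x)) \<longlonglongrightarrow> 0"
    by (rule mp[OF spec[OF closed, of u]]) (use u small in blast)
  then obtain v where v: "v \<in> D" and
    lim: "(\<lambda>n. quad Q (\<lambda>x. u n x - v x) + quad (ip M) (\<lambda>x. u n x - v x)) \<longlonglongrightarrow> 0"
    unfolding l2norm_square by blast
  have nonneg: "0 \<le> quad Q (\<lambda>x. u n x - v x)" "0 \<le> quad (ip M) (\<lambda>x. u n x - v x)" for n
    using u v by auto
  show ?thesis
  proof (rule that[OF v])
    show "(\<lambda>n. quad Q (\<lambda>x. u n x - v x)) \<longlonglongrightarrow> 0" "(\<lambda>n. quad (ip M) (\<lambda>x. u n x - v x)) \<longlonglongrightarrow> 0"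
      by (rule Lim_null_comparison[OF _ lim]; use nonneg in simp)+
  qed
qed

lemma D_closed:
  assumes u: "\<And>n. u n \<in> D" "form_Cauchy Q u" and f: "f \<in> L2 M"
    and lim: "(\<lambda>n. quad (ip M) (\<lambda>x. u n x - f x)) \<longlonglongrightarrow> 0"
  shows "f \<in> D" and "(\<lambda>n. quad Q (\<lambda>x. u n x - f x)) \<longlonglongrightarrow> 0"
proof -
  have uL: "\<And>n. u n \<in> L2 M" by (rule D_L2[OF u(1)])
  obtain v where v: "v \<in> D" "(\<lambda>n. quad Q (\<lambda>x. u n x - v x)) \<longlonglongrightarrow> 0"
      "(\<lambda>n. quad (ip M) (\<lambda>x. u n x - v x)) \<longlonglongrightarrow> 0"
    by (rule D_complete[OF u L2.Cauchy_if_quad_tendsto_0[OF uL f lim]]) blast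
  have vL: "v \<in> L2 M" by (rule D_L2[OF v(1)])
  have "AE x in M. v x - f x = 0"
    using L2.quad_diff_limits_eq_0[OF uL vL f v(3) lim] vL f
    by (intro AE_eq_0_if_quad_ip_le_0) auto
  then have ae: "AE x in M. v x = f x" by simp
  show fD: "f \<in> D" by (rule D_cong[OF v(1) L2_measurable[OF f] ae])
  have "quad Q (\<lambda>x. u n x - f x) = quad Q (\<lambda>x. u n x - v x)" for n
    using ae u(1) v(1) fD by (intro quad_cong) (auto intro: D_measurable elim: AE_mp)
  with v(2) show "(\<lambda>n. quad Q (\<lambda>x. u n x - f x)) \<longlonglongrightarrow> 0" by simp
qed

text \<open>For monotone \<open>C\<close>, the map \<open>s \<mapsto> s - C s\<close> is a normal contraction too, so \<open>Q (f - C f) \<le> Q f\<close>.\<close>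

lemma Q_monotone_contraction_nonneg:
  assumes C: "normal_contraction C" "mono C" and f: "f \<in> D"
  shows "0 \<le> Q f (\<lambda>x. C (f x))"
proof -
  note Cf = D_contraction[OF C(1) f]
  have "\<bar>(s - C s) - (t - C t)\<bar> \<le> \<bar>s - t\<bar>" for s t
    using normal_contraction_dist[OF C(1), of s t] monoD[OF C(2), of s t] monoD[OF C(2), of t s]
    by (cases "s \<le> t") auto
  then have "normal_contraction (\<lambda>s. s - C s)"
    using C(1) by (simp add: normal_contraction_def)
  from quad_contraction_le[OF this f] have "quad Q (\<lambda>x. f x - C (f x)) \<le> quad Q f" .
  then show ?thesis using Q.quad_diff[OF f Cf] Q.quad_nonneg[OF Cf] by linarith
qed

section \<open>Resolvents\<close>

definition weight :: "('a \<Rightarrow> real) \<Rightarrow> bool" where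
  "weight \<rho> \<longleftrightarrow> \<rho> \<in> Linf M \<and> (\<exists>\<alpha>>0. \<forall>x\<in>space M. \<alpha> \<le> \<rho> x)"

lemma weight_const: "\<alpha> > 0 \<Longrightarrow> weight (\<lambda>x. \<alpha>)"
  by (auto simp: weight_def)

lemma weight_Linf: "weight \<rho> \<Longrightarrow> \<rho> \<in> Linf M"
  by (simp add: weight_def)

lemma weight_pos: "weight \<rho> \<Longrightarrow> x \<in> space M \<Longrightarrow> 0 < \<rho> x"
  by (force simp: weight_def)

definition weighted :: "('a \<Rightarrow> real) \<Rightarrow> ('a \<Rightarrow> real) \<Rightarrow> ('a \<Rightarrow> real) \<Rightarrow> real" where
  "weighted \<rho> u v = Q u v + \<langle>\<lambda>x. \<rho> x * u x, v\<rangle>"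

text \<open>Thus \<open>resolvent \<rho> F v\<close> says that \<open>v = (L + \<rho>)\<^sup>-\<^sup>1 F\<close>.\<close>

abbreviation resolvent :: "('a \<Rightarrow> real) \<Rightarrow> ('a \<Rightarrow> real) \<Rightarrow> ('a \<Rightarrow> real) \<Rightarrow> bool" where
  "resolvent \<rho> F v \<equiv> gen_rel M D (weighted \<rho>) v F"

lemma weighted_const: "weighted (\<lambda>x. \<alpha>) u v = Q u v + \<alpha> * \<langle>u, v\<rangle>"
  by (simp add: weighted_def ip_scale_left)

lemma quad_weighted_mono:
  assumes "\<rho> \<in> Linf M" "\<sigma> \<in> Linf M" "\<And>x. x \<in> space M \<Longrightarrow> \<rho> x \<le> \<sigma> x" and u: "u \<in> D"
  shows "quad (weighted \<rho>) u \<le> quad (weighted \<sigma>) u"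
proof -
  have "\<langle>\<lambda>x. \<rho> x * u x, u\<rangle> \<le> \<langle>\<lambda>x. \<sigma> x * u x, u\<rangle>"
    unfolding ip_def using assms D_L2[OF u]
    by (intro integral_mono L2_mult_integrable L2_Linf_mult)
      (auto simp: mult.assoc intro!: mult_right_mono)
  then show ?thesis by (simp add: weighted_def)
qed

lemma psd_form_weighted:
  assumes "weight \<rho>"
  shows "psd_form D (weighted \<rho>)"
proof
  note \<rho> = L2_Linf_mult[OF D_L2 weight_Linf[OF assms]]
  fix f g h and c :: real assume f: "f \<in> D"
  have "\<langle>\<lambda>x. \<rho> x * f x, g\<rangle> = \<langle>\<lambda>x. \<rho> x * g x, f\<rangle>" for g
    by (simp add: ip_def mult.left_commute mult.commute)
  then show "weighted \<rho> f g = weighted \<rho> g f" if "g \<in> D"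
    using Q.sym[OF f that] by (simp add: weighted_def)
  show "weighted \<rho> (\<lambda>x. f x + g x) h = weighted \<rho> f h + weighted \<rho> g h" if "g \<in> D" "h \<in> D"
    using L2.add_left[OF \<rho>[OF f] \<rho>[OF that(1)] D_L2[OF that(2)]] f that
    by (simp add: weighted_def Q.add_left distrib_left)
  show "weighted \<rho> (\<lambda>x. c * f x) h = c * weighted \<rho> f h" if "h \<in> D"
    using f that ip_scale_left[of M c "\<lambda>x. \<rho> x * f x" h]
    by (simp add: weighted_def Q.scale_left mult.left_commute distrib_left)
  have "quad (weighted (\<lambda>x. 0)) f \<le> quad (weighted \<rho>) f"
    using weight_Linf[OF assms] weight_pos[OF assms] f
    by (intro quad_weighted_mono) (auto intro: less_imp_le)
  then show "0 \<le> quad (weighted \<rho>) f"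
    using Q.quad_nonneg[OF f] by (simp add: weighted_const)
qed auto

lemma weighted_bounds:
  assumes "weight \<rho>"
  obtains \<alpha> \<beta> where "0 < \<alpha>" "0 < \<beta>" "\<And>u. u \<in> D \<Longrightarrow> quad Q u + \<alpha> * quad (ip M) u \<le> quad (weighted \<rho>) u"
    "\<And>u. u \<in> D \<Longrightarrow> quad (weighted \<rho>) u \<le> quad Q u + \<beta> * quad (ip M) u"
proof -
  obtain \<alpha> where \<alpha>: "0 < \<alpha>" "\<And>x. x \<in> space M \<Longrightarrow> \<alpha> \<le> \<rho> x" using assms by (auto simp: weight_def)
  obtain \<beta> where \<beta>: "0 \<le> \<beta>" "\<And>x. x \<in> space M \<Longrightarrow> \<bar>\<rho> x\<bar> \<le> \<beta>"
    using LinfE[OF weight_Linf[OF assms]] by blast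
  have "quad (weighted (\<lambda>x. \<alpha>)) u \<le> quad (weighted \<rho>) u"
    "quad (weighted \<rho>) u \<le> quad (weighted (\<lambda>x. \<beta> + 1)) u" if "u \<in> D" for u
    using \<alpha>(2) \<beta>(2) weight_Linf[OF assms] that
    by (intro quad_weighted_mono; fastforce intro: order_trans abs_ge_self)+
  then show ?thesis using \<alpha>(1) \<beta>(1) by (intro that[of \<alpha> "\<beta> + 1"]) (auto simp: weighted_const)
qed

lemma weighted_complete:
  assumes \<rho>: "weight \<rho>" and u: "\<And>n. u n \<in> D" "form_Cauchy (weighted \<rho>) u"
  shows "\<exists>v\<in>D. (\<lambda>n. quad (weighted \<rho>) (\<lambda>x. u n x - v x)) \<longlonglongrightarrow> 0"
proof -
  interpret W: psd_form D "weighted \<rho>" by (rule psd_form_weighted[OF \<rho>])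
  obtain \<alpha> \<beta> where "0 < \<alpha>"
    and lower: "\<And>p. p \<in> D \<Longrightarrow> quad Q p + \<alpha> * quad (ip M) p \<le> quad (weighted \<rho>) p"
    and upper: "\<And>p. p \<in> D \<Longrightarrow> quad (weighted \<rho>) p \<le> quad Q p + \<beta> * quad (ip M) p"
    by (rule weighted_bounds[OF \<rho>]) blast
  have d: "(\<lambda>x. u n x - u m x) \<in> D" for n m using u(1) by simp
  have "0 \<le> \<alpha> * quad (ip M) p" for p using \<open>0 < \<alpha>\<close> by simp
  then have "quad Q (\<lambda>x. u n x - u m x) \<le> 1 * quad (weighted \<rho>) (\<lambda>x. u n x - u m x)" for n m
    using lower[OF d, of n m] by (smt (verit) mult_1)
  then have Cauchy_Q: "form_Cauchy Q u" by (rule form_Cauchy_if_quad_le[OF u(2) zero_less_one])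
  have "quad (ip M) (\<lambda>x. u n x - u m x) \<le> (1 / \<alpha>) * quad (weighted \<rho>) (\<lambda>x. u n x - u m x)" for n m
    using lower[OF d, of n m] Q.quad_nonneg[OF d, of n m] \<open>0 < \<alpha>\<close> by (simp add: field_simps)
  then have Cauchy_L2: "form_Cauchy (ip M) u"
    using \<open>0 < \<alpha>\<close> by (intro form_Cauchy_if_quad_le[OF u(2), of "1 / \<alpha>"]) auto
  obtain v where v: "v \<in> D" "(\<lambda>n. quad Q (\<lambda>x. u n x - v x)) \<longlonglongrightarrow> 0"
      "(\<lambda>n. quad (ip M) (\<lambda>x. u n x - v x)) \<longlonglongrightarrow> 0"
    by (rule D_complete[OF u(1) Cauchy_Q Cauchy_L2]) blast
  have "(\<lambda>n. quad (weighted \<rho>) (\<lambda>x. u n x - v x)) \<longlonglongrightarrow> 0"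
  proof (rule Lim_null_comparison)
    show "\<forall>\<^sub>F n in sequentially. norm (quad (weighted \<rho>) (\<lambda>x. u n x - v x)) \<le>
        quad Q (\<lambda>x. u n x - v x) + \<beta> * quad (ip M) (\<lambda>x. u n x - v x)"
      using u(1) v(1) upper by simp
    show "(\<lambda>n. quad Q (\<lambda>x. u n x - v x) + \<beta> * quad (ip M) (\<lambda>x. u n x - v x)) \<longlonglongrightarrow> 0"
      using tendsto_add[OF v(2) tendsto_mult_right_zero[OF v(3), of \<beta>]] by simp
  qed
  with v(1) show ?thesis by blast
qed

lemma ex_resolvent:
  assumes \<rho>: "weight \<rho>" and F: "F \<in> L2 M"
  obtains v where "resolvent \<rho> F v"
proof -
  interpret W: psd_form D "weighted \<rho>" by (rule psd_form_weighted[OF \<rho>])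
  obtain \<alpha> \<beta> where "0 < \<alpha>"
    and lower: "\<And>p. p \<in> D \<Longrightarrow> quad Q p + \<alpha> * quad (ip M) p \<le> quad (weighted \<rho>) p"
    by (rule weighted_bounds[OF \<rho>]) blast
  interpret bounded_functional D "weighted \<rho>" "ip M F" "quad (ip M) F / \<alpha>"
  proof
    fix f assume f: "f \<in> D"
    have "quad (ip M) f \<le> quad (weighted \<rho>) f / \<alpha>"
      using lower[OF f] Q.quad_nonneg[OF f] \<open>0 < \<alpha>\<close> by (simp add: field_simps)
    from mult_left_mono[OF this quad_ip_nonneg[of M F]]
    show "\<langle>F, f\<rangle>\<^sup>2 \<le> quad (ip M) F / \<alpha> * quad (weighted \<rho>) f"
      using L2.Cauchy_Schwarz[OF F D_L2[OF f]] by simp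
  qed (use F D_L2 in \<open>simp_all add: L2.add_right ip_scale_right\<close>)
  obtain v where "v \<in> D" "\<And>p. p \<in> D \<Longrightarrow> weighted \<rho> v p = \<langle>F, p\<rangle>"
    using ex_representer[OF weighted_complete[OF \<rho>]] by blast
  then show ?thesis using F by (intro that[of v] gen_relI)
qed

lemma resolvent_gen:
  assumes \<rho>: "weight \<rho>" and v: "resolvent \<rho> F v"
  shows "gen v (\<lambda>x. F x - \<rho> x * v x)"
proof (rule gen_relI)
  note vD = gen_rel_mem[OF v] and F = gen_rel_L2[OF v]
  have \<rho>v: "(\<lambda>x. \<rho> x * v x) \<in> L2 M" by (rule L2_Linf_mult[OF D_L2[OF vD] weight_Linf[OF \<rho>]])
  show "v \<in> D" "(\<lambda>x. F x - \<rho> x * v x) \<in> L2 M" using vD F \<rho>v by auto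
  show "Q v u = \<langle>\<lambda>x. F x - \<rho> x * v x, u\<rangle>" if u: "u \<in> D" for u
    using gen_rel_form[OF v u] L2.diff_left[OF F \<rho>v D_L2[OF u]] by (simp add: weighted_def)
qed

lemma resolvent_diff:
  "weight \<rho> \<Longrightarrow> resolvent \<rho> F v \<Longrightarrow> resolvent \<rho> F' v' \<Longrightarrow>
    resolvent \<rho> (\<lambda>x. F x - F' x) (\<lambda>x. v x - v' x)"
  by (rule psd_form.gen_rel_diff[OF psd_form_weighted D_subset_L2])

lemma resolvent_uminus: "weight \<rho> \<Longrightarrow> resolvent \<rho> F v \<Longrightarrow> resolvent \<rho> (\<lambda>x. - F x) (\<lambda>x. - v x)"
  by (rule psd_form.gen_rel_uminus[OF psd_form_weighted D_subset_L2])

lemma resolvent_swap: "weight \<rho> \<Longrightarrow> resolvent \<rho> F v \<Longrightarrow> resolvent \<rho> F' v' \<Longrightarrow> \<langle>F, v'\<rangle> = \<langle>F', v\<rangle>"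
  by (rule psd_form.gen_rel_swap[OF psd_form_weighted])

lemma resolvent_cong:
  assumes \<rho>: "weight \<rho>" and v: "resolvent \<rho> F v"
    and v': "v' \<in> borel_measurable M" "AE x in M. v x = v' x"
  shows "resolvent \<rho> F v'"
proof (rule gen_relI)
  note vD = gen_rel_mem[OF v]
  show "v' \<in> D" by (rule D_cong[OF vD v'])
  show "F \<in> L2 M" by (rule gen_rel_L2[OF v])
  fix u assume u: "u \<in> D"
  note [measurable] = D_measurable[OF vD] D_measurable[OF u] v'(1)
    Linf_measurable[OF weight_Linf[OF \<rho>]]
  have "\<langle>\<lambda>x. \<rho> x * v' x, u\<rangle> = \<langle>\<lambda>x. \<rho> x * v x, u\<rangle>"
    using v'(2) by (intro ip_cong_AE) auto
  then show "weighted \<rho> v' u = \<langle>F, u\<rangle>"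
    using gen_rel_form[OF v u] Q_cong_left[OF vD v' u] by (simp add: weighted_def)
qed

lemma resolvent_contraction_fixed:
  assumes \<rho>: "weight \<rho>" and v: "resolvent \<rho> F v" and C: "normal_contraction C"
    and le: "AE x in M. \<rho> x * (C (v x))\<^sup>2 - 2 * (F x * C (v x)) \<le> \<rho> x * (v x)\<^sup>2 - 2 * (F x * v x)"
  shows "AE x in M. C (v x) = v x"
proof -
  interpret W: psd_form D "weighted \<rho>" by (rule psd_form_weighted[OF \<rho>])
  note vD = gen_rel_mem[OF v] and F = gen_rel_L2[OF v]
  let ?z = "\<lambda>x. C (v x)"
  have z: "?z \<in> D" by (rule D_contraction[OF C vD])
  have objective: "\<langle>\<lambda>x. \<rho> x * p x, p\<rangle> - 2 * \<langle>F, p\<rangle> = (\<integral>x. \<rho> x * (p x)\<^sup>2 - 2 * (F x * p x) \<partial>M)"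
    and integrable: "integrable M (\<lambda>x. \<rho> x * (p x)\<^sup>2 - 2 * (F x * p x))" if "p \<in> D" for p
    using L2_mult_integrable[OF L2_Linf_mult[OF D_L2[OF that] weight_Linf[OF \<rho>]] D_L2[OF that]]
      L2_mult_integrable[OF F D_L2[OF that]]
    by (simp_all add: ip_def power2_eq_square mult.assoc)
  have "\<langle>\<lambda>x. \<rho> x * ?z x, ?z\<rangle> - 2 * \<langle>F, ?z\<rangle> \<le> \<langle>\<lambda>x. \<rho> x * v x, v\<rangle> - 2 * \<langle>F, v\<rangle>"
    unfolding objective[OF z] objective[OF vD] by (intro integral_mono_AE integrable z vD le)
  then have "quad (weighted \<rho>) ?z - 2 * \<langle>F, ?z\<rangle> \<le> quad (weighted \<rho>) v - 2 * \<langle>F, v\<rangle>"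
    using quad_contraction_le[OF C vD] by (simp add: weighted_def)
  then have "quad (weighted \<rho>) (\<lambda>x. v x - ?z x) \<le> 0"
    using gen_rel_form[OF v z] gen_rel_form[OF v vD] by (simp add: W.quad_diff[OF vD z])
  moreover obtain \<alpha> \<beta> where "0 < \<alpha>" and
    lower: "\<And>p. p \<in> D \<Longrightarrow> quad Q p + \<alpha> * quad (ip M) p \<le> quad (weighted \<rho>) p"
    by (rule weighted_bounds[OF \<rho>]) blast
  ultimately have "\<alpha> * quad (ip M) (\<lambda>x. v x - ?z x) \<le> 0"
    using lower[OF Q.diff_mem[OF vD z]] Q.quad_nonneg[OF Q.diff_mem[OF vD z]] by linarith
  then have "AE x in M. v x - ?z x = 0"
    using \<open>0 < \<alpha>\<close> vD z by (intro AE_eq_0_if_quad_ip_le_0 L2.diff_mem D_L2)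
      (auto simp: mult_le_0_iff)
  then show ?thesis by eventually_elim simp
qed

lemma resolvent_le_const:
  assumes \<rho>: "weight \<rho>" and v: "resolvent \<rho> F v" and "0 \<le> b" and le: "AE x in M. F x \<le> b * \<rho> x"
  shows "AE x in M. v x \<le> b"
proof -
  have "AE x in M. min b (v x) = v x"
  proof (rule resolvent_contraction_fixed[OF \<rho> v normal_contraction_min[OF \<open>0 \<le> b\<close>]])
    show "AE x in M. \<rho> x * (min b (v x))\<^sup>2 - 2 * (F x * min b (v x))
        \<le> \<rho> x * (v x)\<^sup>2 - 2 * (F x * v x)"
      using le AE_space
    proof eventually_elim
      case (elim x)
      show ?case
      proof (cases "v x \<le> b")
        case False
        have "2 * F x \<le> \<rho> x * (v x + b)"
        proof -
          have "\<rho> x * b \<le> \<rho> x * v x" using False weight_pos[OF \<rho> elim(2)] by simp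
          then show ?thesis using elim(1) by (simp add: algebra_simps)
        qed
        then have "2 * F x * (v x - b) \<le> \<rho> x * (v x + b) * (v x - b)"
          using False by (intro mult_right_mono) auto
        then show ?thesis using False by (simp add: power2_eq_square algebra_simps)
      qed simp
    qed
  qed
  then show ?thesis by eventually_elim linarith
qed

lemma resolvent_nonneg:
  assumes \<rho>: "weight \<rho>" and v: "resolvent \<rho> F v" and "AE x in M. 0 \<le> F x"
  shows "AE x in M. 0 \<le> v x"
  using resolvent_le_const[OF \<rho> resolvent_uminus[OF \<rho> v], of 0] assms(3) by auto

lemma resolvent_mono:
  assumes \<rho>: "weight \<rho>" and v: "resolvent \<rho> F v" "resolvent \<rho> F' v'" and "AE x in M. F x \<le> F' x"
  shows "AE x in M. v x \<le> v' x"
  using resolvent_nonneg[OF \<rho> resolvent_diff[OF \<rho> v(2,1)]] assms(4) by auto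

lemma resolvent_abs_le:
  assumes \<rho>: "weight \<rho>" and v: "resolvent \<rho> F v" "resolvent \<rho> F' v'"
    and le: "AE x in M. \<bar>F x\<bar> \<le> F' x"
  shows "AE x in M. \<bar>v x\<bar> \<le> v' x"
proof -
  have "AE x in M. v x \<le> v' x" using le by (intro resolvent_mono[OF \<rho> v]) auto
  moreover have "AE x in M. - v x \<le> v' x"
    using le by (intro resolvent_mono[OF \<rho> resolvent_uminus[OF \<rho> v(1)] v(2)]) auto
  ultimately show ?thesis by eventually_elim auto
qed

lemma resolvent_abs_le_const:
  assumes \<rho>: "weight \<rho>" and v: "resolvent \<rho> F v" and "0 \<le> b" and le: "AE x in M. \<bar>F x\<bar> \<le> b * \<rho> x"
  shows "AE x in M. \<bar>v x\<bar> \<le> b"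
proof -
  have "AE x in M. v x \<le> b" using le by (intro resolvent_le_const[OF \<rho> v \<open>0 \<le> b\<close>]) auto
  moreover have "AE x in M. - v x \<le> b"
    using le by (intro resolvent_le_const[OF \<rho> resolvent_uminus[OF \<rho> v] \<open>0 \<le> b\<close>]) auto
  ultimately show ?thesis by eventually_elim auto
qed

lemma ex_resolvent_between:
  assumes \<rho>: "weight \<rho>" and F: "F \<in> L2 M" and "0 \<le> b"
    and bound: "AE x in M. 0 \<le> F x \<and> F x \<le> b * \<rho> x"
  obtains v where "resolvent \<rho> F v" "\<And>x. 0 \<le> v x \<and> v x \<le> b"
proof -
  obtain v where v: "resolvent \<rho> F v" using ex_resolvent[OF \<rho> F] .
  note [measurable] = D_measurable[OF gen_rel_mem[OF v]]
  have "AE x in M. 0 \<le> v x" using bound by (intro resolvent_nonneg[OF \<rho> v]) auto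
  moreover have "AE x in M. v x \<le> b" using bound by (intro resolvent_le_const[OF \<rho> v \<open>0 \<le> b\<close>]) auto
  ultimately have "AE x in M. v x = max 0 (min b (v x))" by eventually_elim simp
  then have "resolvent \<rho> F (\<lambda>x. max 0 (min b (v x)))" by (intro resolvent_cong[OF \<rho> v]) auto
  then show ?thesis by (rule that) (use \<open>0 \<le> b\<close> in auto)
qed

lemma resolvent_integrable:
  assumes \<rho>: "weight \<rho>" and f: "integrable M f" and v: "resolvent \<rho> f v"
  shows "integrable M v"
proof -
  note [measurable] = D_measurable[OF gen_rel_mem[OF v]]
  obtain \<alpha> where \<alpha>: "0 < \<alpha>" "\<And>x. x \<in> space M \<Longrightarrow> \<alpha> \<le> \<rho> x" using \<rho> by (auto simp: weight_def)
  have "(\<integral>\<^sup>+x\<in>A. ennreal \<bar>v x\<bar> \<partial>M) \<le> ennreal (1 / \<alpha> * (\<integral>x. \<bar>f x\<bar> \<partial>M))"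
    if A [measurable]: "A \<in> sets M" and "emeasure M A < \<infinity>" for A
  proof -
    define s where "s x = sgn (v x) * indicat_real A x" for x
    have s_le: "\<bar>s x\<bar> \<le> 1" for x by (simp add: s_def abs_mult sgn_if indicator_def)
    have s: "s \<in> L2 M"
    proof (rule L2_dominated)
      show "indicat_real A \<in> L2 M"
        using A \<open>emeasure M A < \<infinity>\<close> by (intro L2_if_integrable_Linf) auto
      show "AE x in M. \<bar>s x\<bar> \<le> \<bar>indicat_real A x\<bar>"
        by (simp add: s_def abs_mult sgn_if indicator_def)
      show "s \<in> borel_measurable M" unfolding s_def by measurable
    qed
    obtain y where y: "resolvent \<rho> s y" using ex_resolvent[OF \<rho> s] .
    have "AE x in M. \<bar>y x\<bar> \<le> 1 / \<alpha>"
    proof (rule resolvent_abs_le_const[OF \<rho> y])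
      show "AE x in M. \<bar>s x\<bar> \<le> 1 / \<alpha> * \<rho> x"
        using \<alpha> s_le by (intro AE_I2) (simp add: field_simps order_trans[OF mult_left_le])
    qed (use \<alpha>(1) in simp)
    from abs_ip_le[OF f D_measurable[OF gen_rel_mem[OF y]] this]
    have le: "\<langle>f, y\<rangle> \<le> 1 / \<alpha> * (\<integral>x. \<bar>f x\<bar> \<partial>M)" by (rule order_trans[OF abs_ge_self])
    have "(\<integral>\<^sup>+x\<in>A. ennreal \<bar>v x\<bar> \<partial>M) = (\<integral>\<^sup>+x. ennreal (s x * v x) \<partial>M)"
      by (intro nn_integral_cong) (simp add: s_def abs_sgn mult.commute indicator_def)
    also have "\<dots> = ennreal \<langle>s, v\<rangle>"
      unfolding ip_def
    proof (rule nn_integral_eq_integral)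
      show "integrable M (\<lambda>x. s x * v x)"
        by (rule L2_mult_integrable[OF s D_L2[OF gen_rel_mem[OF v]]])
      show "AE x in M. 0 \<le> s x * v x" by (simp add: s_def indicator_def sgn_if)
    qed
    finally have "(\<integral>\<^sup>+x\<in>A. ennreal \<bar>v x\<bar> \<partial>M) = ennreal \<langle>f, y\<rangle>"
      by (simp only: resolvent_swap[OF \<rho> y v])
    then show ?thesis
      using ennreal_leI[OF le] by simp
  qed
  then show ?thesis by (rule integrable_if_set_integral_le[OF D_measurable[OF gen_rel_mem[OF v]]])
qed

lemma quad_diff_le_if_weights_le:
  assumes weights: "weight \<rho>" "weight \<sigma>" "\<And>x. x \<in> space M \<Longrightarrow> \<rho> x \<le> \<sigma> x"
    and mem: "u \<in> D" "v \<in> D" and eq: "\<And>z. z \<in> D \<Longrightarrow> weighted \<rho> u z = weighted \<sigma> v z"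
  shows "quad Q (\<lambda>x. u x - v x) \<le> quad (weighted \<rho>) u - quad (weighted \<sigma>) v"
proof -
  interpret W: psd_form D "weighted \<rho>" by (rule psd_form_weighted[OF weights(1)])
  have "quad (weighted (\<lambda>x. 0)) (\<lambda>x. u x - v x) \<le> quad (weighted \<rho>) (\<lambda>x. u x - v x)"
    using weight_Linf[OF weights(1)] weight_pos[OF weights(1)] mem
    by (intro quad_weighted_mono) (auto intro: less_imp_le)
  then have "quad Q (\<lambda>x. u x - v x) \<le> quad (weighted \<rho>) (\<lambda>x. u x - v x)"
    by (simp add: weighted_const)
  also have "\<dots> \<le> quad (weighted \<rho>) u - quad (weighted \<sigma>) v"
    using W.quad_diff[OF mem] eq[OF mem(2)]
      quad_weighted_mono[OF weight_Linf[OF weights(1)] weight_Linf[OF weights(2)] weights(3) mem(2)]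
    by simp
  finally show ?thesis .
qed

lemma inverse_nat_add_1_tendsto_0: "(\<lambda>n. inverse (real n + 1)) \<longlonglongrightarrow> 0"
  using LIMSEQ_inverse_real_of_nat by (simp add: add.commute)

lemma real_add_1_at_top: "filterlim (\<lambda>n. real n + 1) at_top sequentially"
  using filterlim_compose[OF filterlim_real_sequentially filterlim_Suc] by (simp add: add.commute)

definition resolvent_sequence :: "('a \<Rightarrow> real) \<Rightarrow> (nat \<Rightarrow> 'a \<Rightarrow> real) \<Rightarrow> bool" where
  "resolvent_sequence f v \<longleftrightarrow> (\<forall>n. resolvent (\<lambda>x. real n + 1) (\<lambda>x. (real n + 1) * f x) (v n))"

lemma ex_resolvent_sequence:
  assumes "f \<in> L2 M"
  obtains v where "resolvent_sequence f v"
proof -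
  have "\<exists>v. resolvent (\<lambda>x. real n + 1) (\<lambda>x. (real n + 1) * f x) v" for n
    using ex_resolvent[OF weight_const L2.scale_mem[OF assms], of "real n + 1"]
    by (meson add_nonneg_pos of_nat_0_le_iff zero_less_one)
  then show ?thesis using that unfolding resolvent_sequence_def by metis
qed

lemma resolvent_sequence_mem: "resolvent_sequence f v \<Longrightarrow> v n \<in> D"
  by (auto simp: resolvent_sequence_def intro: gen_rel_mem)

lemma resolvent_sequence_gen:
  assumes "resolvent_sequence f v"
  shows "gen (v n) (\<lambda>x. (real n + 1) * (f x - v n x))"
proof -
  have "resolvent (\<lambda>x. real n + 1) (\<lambda>x. (real n + 1) * f x) (v n)"
    using assms by (simp only: resolvent_sequence_def)
  from resolvent_gen[OF weight_const this] show ?thesis by (simp add: right_diff_distrib)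
qed

context
  fixes f v
  assumes f: "f \<in> D" and v: "resolvent_sequence f v"
begin

lemma resolvent_error:
  assumes "z \<in> D"
  shows "weighted (\<lambda>x. real n + 1) (\<lambda>x. f x - v n x) z = Q f z"
  using gen_rel_form[OF resolvent_sequence_gen[OF v] assms, of n]
    f resolvent_sequence_mem[OF v, of n] assms
  by (simp add: weighted_const Q.diff_left ip_scale_left)

lemma quad_resolvent_error:
  "quad (weighted (\<lambda>x. real n + 1)) (\<lambda>x. f x - v n x) = quad Q f - Q f (v n)"
  using resolvent_error[of "\<lambda>x. f x - v n x" n] f resolvent_sequence_mem[OF v]
  by (simp add: Q.diff_right)

lemma quad_resolvent_le: "quad Q (v n) \<le> quad Q f - (real n + 1) * quad (ip M) (\<lambda>x. v n x - f x)"
proof -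
  note vD = resolvent_sequence_mem[OF v, of n]
  have "0 \<le> quad (weighted (\<lambda>x. real n + 1)) (\<lambda>x. f x - v n x)"
    using psd_form.quad_nonneg[OF psd_form_weighted[OF weight_const]] f vD by simp
  then show ?thesis
    using quad_resolvent_error[of n] f vD L2.quad_diff_commute[OF D_L2[OF vD] D_L2[OF f]]
    by (simp add: weighted_const Q.quad_diff)
qed

lemma quad_resolvent_sequence_le: "quad Q (v n) \<le> quad Q f"
proof -
  have "0 \<le> (real n + 1) * quad (ip M) (\<lambda>x. v n x - f x)" by simp
  then show ?thesis using quad_resolvent_le[of n] by linarith
qed

lemma resolvent_sequence_L2_tendsto: "(\<lambda>n. quad (ip M) (\<lambda>x. v n x - f x)) \<longlonglongrightarrow> 0"
proof (rule Lim_null_comparison)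
  show "\<forall>\<^sub>F n in sequentially. norm (quad (ip M) (\<lambda>x. v n x - f x))
      \<le> quad Q f * inverse (real n + 1)"
  proof (intro always_eventually allI)
    fix n
    have "(real n + 1) * quad (ip M) (\<lambda>x. v n x - f x) \<le> quad Q f"
      using quad_resolvent_le[of n] Q.quad_nonneg[OF resolvent_sequence_mem[OF v, of n]] by linarith
    then show "norm (quad (ip M) (\<lambda>x. v n x - f x))
      \<le> quad Q f * inverse (real n + 1)"
      by (simp add: field_simps)
  qed
  show "(\<lambda>n. quad Q f * inverse (real n + 1)) \<longlonglongrightarrow> 0"
    by (intro tendsto_mult_right_zero inverse_nat_add_1_tendsto_0)
qed

lemma resolvent_sequence_Cauchy: "form_Cauchy Q v"
proof (rule Q.Cauchy_if_increments[of v "\<lambda>n. Q f (v n)" "quad Q f"])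
  note vD = resolvent_sequence_mem[OF v]
  show "v n \<in> D" for n by (rule vD)
  show "quad Q (\<lambda>x. v m x - v n x) \<le> Q f (v m) - Q f (v n)" if "n \<le> m" for n m
  proof -
    have "quad Q (\<lambda>x. (f x - v n x) - (f x - v m x)) \<le>
        quad (weighted (\<lambda>x. real n + 1)) (\<lambda>x. f x - v n x)
        - quad (weighted (\<lambda>x. real m + 1)) (\<lambda>x. f x - v m x)"
      using that f vD by (intro quad_diff_le_if_weights_le weight_const)
        (auto simp: resolvent_error)
    then show ?thesis by (simp add: quad_resolvent_error)
  qed
  show "Q f (v n) \<le> quad Q f" for n
    using quad_resolvent_error[of n] f vD
      psd_form.quad_nonneg[OF psd_form_weighted[OF weight_const], of "real n + 1" "\<lambda>x. f x - v n x"]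
    by simp
qed

lemma resolvent_sequence_tendsto: "(\<lambda>n. quad Q (\<lambda>x. v n x - f x)) \<longlonglongrightarrow> 0"
  by (rule D_closed(2)[OF resolvent_sequence_mem[OF v] resolvent_sequence_Cauchy D_L2[OF f]
        resolvent_sequence_L2_tendsto])

end

end

section \<open>Lower semicontinuity and the extended form\<close>

context dirichlet_space
begin

lemma Q_le_if_resolvent_tendsto:
  assumes f: "f \<in> D" and v: "resolvent_sequence f v" and p: "\<And>m. p m \<in> D" "\<And>m. quad Q (p m) \<le> c"
    and lim: "\<And>n. (\<lambda>m. \<langle>\<lambda>x. f x - v n x, p m\<rangle>) \<longlonglongrightarrow> \<langle>\<lambda>x. f x - v n x, f\<rangle>"
  shows "quad Q f \<le> c"
proof -
  note vD = resolvent_sequence_mem[OF v]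
  have c: "0 \<le> c" using p(2)[of 0] Q.quad_nonneg[OF p(1)[of 0]] by linarith
  have Q_v: "Q (v n) z = (real n + 1) * \<langle>\<lambda>x. f x - v n x, z\<rangle>" if "z \<in> D" for n z
    using gen_rel_form[OF resolvent_sequence_gen[OF v] that] by (simp add: ip_scale_left)
  have "(Q (v n) f)\<^sup>2 \<le> quad Q f * c" for n
  proof (rule LIMSEQ_le_const2)
    show "(\<lambda>m. (Q (v n) (p m))\<^sup>2) \<longlonglongrightarrow> (Q (v n) f)\<^sup>2"
      unfolding Q_v[OF f] Q_v[OF p(1)] by (intro tendsto_intros lim)
    have "(Q (v n) (p m))\<^sup>2 \<le> quad Q f * c" for m
    proof -
      have "(Q (v n) (p m))\<^sup>2 \<le> quad Q (v n) * quad Q (p m)" by (rule Q.Cauchy_Schwarz[OF vD p(1)])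
      also have "\<dots> \<le> quad Q f * c"
        using quad_resolvent_sequence_le[OF f v] p f by (intro mult_mono) auto
      finally show ?thesis .
    qed
    then show "\<exists>N. \<forall>m\<ge>N. (Q (v n) (p m))\<^sup>2 \<le> quad Q f * c" by blast
  qed
  moreover have "(\<lambda>n. (Q (v n) f)\<^sup>2) \<longlonglongrightarrow> (quad Q f)\<^sup>2"
    using vD f by (intro tendsto_power Q.tendsto_left resolvent_sequence_tendsto[OF f v]) auto
  ultimately have "(quad Q f)\<^sup>2 \<le> quad Q f * c" by (intro LIMSEQ_le_const2) auto
  then have "quad Q f * quad Q f \<le> quad Q f * c" by (simp add: power2_eq_square)
  then show ?thesis using Q.quad_nonneg[OF f] c by (cases "quad Q f = 0") auto
qed

lemma Q_lower_semicontinuous_bounded: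
  assumes f: "f \<in> D" "integrable M f" and p: "\<And>m. p m \<in> D" "\<And>m. quad Q (p m) \<le> c"
    and bound: "\<And>m x. \<bar>p m x\<bar> \<le> K" and lim: "AE x in M. (\<lambda>m. p m x) \<longlonglongrightarrow> f x"
  shows "quad Q f \<le> c"
proof -
  obtain v where v: "resolvent_sequence f v" using ex_resolvent_sequence[OF D_L2[OF f(1)]] .
  show ?thesis
  proof (rule Q_le_if_resolvent_tendsto[OF f(1) v p])
    fix n
    have "resolvent (\<lambda>x. real n + 1) (\<lambda>x. (real n + 1) * f x) (v n)"
      using v by (simp add: resolvent_sequence_def)
    from resolvent_integrable[OF weight_const _ this] have "integrable M (v n)" using f(2) by simp
    then have "integrable M (\<lambda>x. f x - v n x)" using f(2) by simp
    then show "(\<lambda>m. \<langle>\<lambda>x. f x - v n x, p m\<rangle>) \<longlonglongrightarrow> \<langle>\<lambda>x. f x - v n x, f\<rangle>"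
      by (rule ip_tendsto_if_bounded[OF _ D_measurable[OF p(1)] D_measurable[OF f(1)] bound lim])
  qed
qed

lemma Q_lower_semicontinuous:
  assumes f: "f \<in> D" and p: "\<And>m. p m \<in> D" "\<And>m. quad Q (p m) \<le> c"
    and lim: "AE x in M. (\<lambda>m. p m x) \<longlonglongrightarrow> f x"
  shows "quad Q f \<le> c"
proof -
  define C where "C k = soft_clip (inverse (real k + 1)) (real k + 1)" for k :: nat
  have params: "0 < inverse (real k + 1)" "inverse (real k + 1) \<le> real k + 1" for k :: nat
    using le_imp_inverse_le[of 1 "real k + 1"] by auto
  have C: "normal_contraction (C k)" for k
    unfolding C_def using params by (intro normal_contraction_soft_clip) (auto intro: less_imp_le)
  have C_lim: "(\<lambda>k. C k s) \<longlonglongrightarrow> s" for s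
    unfolding C_def using params
    by (intro soft_clip_tendsto inverse_nat_add_1_tendsto_0 real_add_1_at_top)
      (auto intro: less_imp_le)
  have clipped: "quad Q (\<lambda>x. C k (f x)) \<le> c" for k
  proof (rule Q_lower_semicontinuous_bounded)
    show "(\<lambda>x. C k (f x)) \<in> D" "(\<lambda>x. C k (p m x)) \<in> D" for m by (intro D_contraction[OF C] f p)+
    show "integrable M (\<lambda>x. C k (f x))"
      unfolding C_def by (rule integrable_soft_clip[OF D_L2[OF f] params])
    show "quad Q (\<lambda>x. C k (p m x)) \<le> c" for m
      by (rule order_trans[OF quad_contraction_le[OF C p(1)] p(2)])
    show "\<bar>C k (p m x)\<bar> \<le> real k + 1" for m x
      unfolding C_def using params by (intro abs_soft_clip_le) (auto intro: less_imp_le)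
    show "AE x in M. (\<lambda>m. C k (p m x)) \<longlonglongrightarrow> C k (f x)"
      using lim by eventually_elim (rule isCont_tendsto_compose[OF isCont_normal_contraction[OF C]])
  qed
  obtain v where v: "resolvent_sequence f v" using ex_resolvent_sequence[OF D_L2[OF f]] .
  show ?thesis
  proof (rule Q_le_if_resolvent_tendsto[OF f v D_contraction[OF C f] clipped])
    fix n
    let ?w = "\<lambda>x. f x - v n x"
    have w: "?w \<in> L2 M" using f resolvent_sequence_mem[OF v] by (intro L2.diff_mem D_L2) auto
    show "(\<lambda>k. \<langle>?w, \<lambda>x. C k (f x)\<rangle>) \<longlonglongrightarrow> \<langle>?w, f\<rangle>"
      by (rule ip_normal_contraction_tendsto[OF w D_L2[OF f] C C_lim])
  qed
qed

lemma quad_tendsto_0_if_AE_tendsto_0: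
  assumes u: "\<And>n. u n \<in> D" "form_Cauchy Q u" and lim: "AE x in M. (\<lambda>n. u n x) \<longlonglongrightarrow> 0"
  shows "(\<lambda>n. quad Q (u n)) \<longlonglongrightarrow> 0"
proof (rule LIMSEQ_I)
  fix e :: real assume "e > 0"
  then have "e / 2 > 0" by simp
  then obtain N where N: "\<And>n m. n \<ge> N \<Longrightarrow> m \<ge> N \<Longrightarrow> quad Q (\<lambda>x. u n x - u m x) < e / 2"
    using form_CauchyE[OF u(2)] by blast
  have "quad Q (u n) \<le> e / 2" if "n \<ge> N" for n
  proof (rule Q_lower_semicontinuous[OF u(1)[of n], of "\<lambda>m x. u n x - u (m + N) x"])
    show "AE x in M. (\<lambda>m. u n x - u (m + N) x) \<longlonglongrightarrow> u n x"
      using lim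
    proof eventually_elim
      case (elim x)
      from tendsto_diff[OF tendsto_const LIMSEQ_ignore_initial_segment[OF this, of N]]
      show ?case by simp
    qed
  qed (use u(1) N[OF that] in \<open>auto intro!: less_imp_le\<close>)
  then have "norm (quad Q (u n) - 0) < e" if "n \<ge> N" for n
    using that Q.quad_nonneg[OF u(1), of n] \<open>e > 0\<close> by fastforce
  then show "\<exists>N. \<forall>n\<ge>N. norm (quad Q (u n) - 0) < e" by blast
qed

lemma approx_seq_iff:
  "approx_seq M D Q f fs \<longleftrightarrow> (\<forall>n. fs n \<in> D) \<and> form_Cauchy Q fs \<and> (AE x in M. (\<lambda>n. fs n x) \<longlonglongrightarrow> f x)"
  by (simp add: approx_seq_def form_Cauchy_def)

lemma approx_seq_mem: "approx_seq M D Q f fs \<Longrightarrow> fs n \<in> D"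
  and approx_seq_Cauchy: "approx_seq M D Q f fs \<Longrightarrow> form_Cauchy Q fs"
  and approx_seq_tendsto: "approx_seq M D Q f fs \<Longrightarrow> AE x in M. (\<lambda>n. fs n x) \<longlonglongrightarrow> f x"
  by (simp_all add: approx_seq_iff)

lemma extQ1_tendsto:
  assumes fs: "approx_seq M D Q f fs"
  shows "(\<lambda>n. quad Q (fs n)) \<longlonglongrightarrow> extQ1 M D Q f"
proof -
  obtain l where l: "(\<lambda>n. quad Q (fs n)) \<longlonglongrightarrow> l"
    using Q.convergent_quad_if_Cauchy[OF approx_seq_mem[OF fs] approx_seq_Cauchy[OF fs]]
    by (auto simp: convergent_def)
  have lim: "(\<lambda>n. quad Q (gs n)) \<longlonglongrightarrow> l" if gs: "approx_seq M D Q f gs" for gs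
  proof (rule Q.quad_tendsto_if_quad_diff_tendsto_0[OF _ _ _ l])
    show "(\<lambda>n. quad Q (\<lambda>x. gs n x - fs n x)) \<longlonglongrightarrow> 0"
    proof (rule quad_tendsto_0_if_AE_tendsto_0)
      show "form_Cauchy Q (\<lambda>n x. gs n x - fs n x)"
        by (intro Q.Cauchy_diff approx_seq_mem[OF gs] approx_seq_mem[OF fs]
            approx_seq_Cauchy[OF gs] approx_seq_Cauchy[OF fs])
      show "AE x in M. (\<lambda>n. gs n x - fs n x) \<longlonglongrightarrow> 0"
        using approx_seq_tendsto[OF gs] approx_seq_tendsto[OF fs]
      proof eventually_elim
        case (elim x)
        from tendsto_diff[OF this] show ?case by simp
      qed
    qed (use approx_seq_mem[OF gs] approx_seq_mem[OF fs] in blast)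
  qed (simp_all add: approx_seq_mem[OF gs] approx_seq_mem[OF fs])
  have "extQ1 M D Q f = l"
    unfolding extQ1_def using fs lim LIMSEQ_unique by (intro the_equality) blast+
  then show ?thesis using l by simp
qed

lemma extQ_tendsto:
  assumes fs: "approx_seq M D Q f fs" and u: "u \<in> D"
  shows "(\<lambda>n. Q (fs n) u) \<longlonglongrightarrow> extQ M D Q f u"
proof -
  have shifted: "approx_seq M D Q (\<lambda>x. f x - c * u x) (\<lambda>n x. fs n x - c * u x)" for c
    unfolding approx_seq_iff
  proof (intro conjI allI)
    show "form_Cauchy Q (\<lambda>n x. fs n x - c * u x)"
      using u by (intro Q.Cauchy_diff[OF _ _ approx_seq_Cauchy[OF fs]] Q.Cauchy_const
          approx_seq_mem[OF fs]) auto
    show "AE x in M. (\<lambda>n. fs n x - c * u x) \<longlonglongrightarrow> f x - c * u x"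
      using approx_seq_tendsto[OF fs] by eventually_elim (intro tendsto_intros)
  qed (use approx_seq_mem[OF fs] u in auto)
  have "(\<lambda>n. (quad Q (\<lambda>x. fs n x - (- 1) * u x) - quad Q (\<lambda>x. fs n x - 1 * u x)) / 4)
     \<longlonglongrightarrow> (extQ1 M D Q (\<lambda>x. f x - (- 1) * u x) - extQ1 M D Q (\<lambda>x. f x - 1 * u x)) / 4"
    by (intro tendsto_intros extQ1_tendsto shifted) simp
  then show ?thesis
    using approx_seq_mem[OF fs] u by (simp add: extQ_def Q.quad_diff Q.quad_add)
qed

lemma extQ_Cauchy_Schwarz:
  assumes "f \<in> ext_space M D Q" "u \<in> D"
  shows "(extQ M D Q f u)\<^sup>2 \<le> extQ1 M D Q f * quad Q u"
proof -
  obtain fs where fs: "approx_seq M D Q f fs" using assms(1) by (auto simp: ext_space_def)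
  have "(\<lambda>k. (Q (fs k) u)\<^sup>2) \<longlonglongrightarrow> (extQ M D Q f u)\<^sup>2"
    by (intro tendsto_power extQ_tendsto fs assms(2))
  moreover have "(\<lambda>k. quad Q (fs k) * quad Q u) \<longlonglongrightarrow> extQ1 M D Q f * quad Q u"
    by (intro tendsto_mult_right extQ1_tendsto fs)
  ultimately show ?thesis
    using Q.Cauchy_Schwarz[OF approx_seq_mem[OF fs] assms(2)] by (intro LIMSEQ_le) auto
qed

lemma ex_approximants_of_one:
  assumes "ext_gen_rel M D Q (\<lambda>x. 1) (\<lambda>x. 0)"
  obtains u where "\<And>n. u n \<in> D" "\<And>n x. 0 \<le> u n x \<and> u n x \<le> 1"
    "AE x in M. (\<lambda>n. u n x) \<longlonglongrightarrow> 1" "(\<lambda>n. quad Q (u n)) \<longlonglongrightarrow> 0"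
proof -
  obtain fs where fs: "approx_seq M D Q (\<lambda>x. 1) fs"
    using assms by (auto simp: ext_gen_rel_def ext_space_def)
  note fsD = approx_seq_mem[OF fs]
  have "(\<lambda>m. Q (fs m) (fs n)) \<longlonglongrightarrow> 0" for n
    using extQ_tendsto[OF fs fsD] assms fsD by (simp add: ext_gen_rel_def ip_def)
  then have null: "(\<lambda>n. quad Q (fs n)) \<longlonglongrightarrow> 0"
    by (rule Q.quad_tendsto_0_if_Cauchy_weakly_null[OF fsD approx_seq_Cauchy[OF fs]])
  have C: "normal_contraction (\<lambda>s. min 1 \<bar>s\<bar>)" by (rule normal_contraction_min_abs) simp
  show ?thesis
  proof (rule that)
    show "(\<lambda>x. min 1 \<bar>fs n x\<bar>) \<in> D" for n by (rule D_contraction[OF C fsD])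
    show "AE x in M. (\<lambda>n. min 1 \<bar>fs n x\<bar>) \<longlonglongrightarrow> 1"
      using approx_seq_tendsto[OF fs]
    proof eventually_elim
      case (elim x)
      from tendsto_min[OF tendsto_const tendsto_rabs[OF this], of 1] show ?case by simp
    qed
    show "(\<lambda>n. quad Q (\<lambda>x. min 1 \<bar>fs n x\<bar>)) \<longlonglongrightarrow> 0"
      by (rule Lim_null_comparison[OF _ null])
        (simp add: quad_contraction_le[OF C fsD] D_contraction[OF C fsD])
  qed auto
qed

lemma integral_generator_eq_0:
  assumes one: "ext_gen_rel M D Q (\<lambda>x. 1) (\<lambda>x. 0)" and u: "ext_gen_rel M D Q u w" "integrable M w"
  shows "(\<integral>x. w x \<partial>M) = 0"
proof -
  obtain e where e: "\<And>n. e n \<in> D" "\<And>n x. 0 \<le> e n x \<and> e n x \<le> 1"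
    "AE x in M. (\<lambda>n. e n x) \<longlonglongrightarrow> 1" "(\<lambda>n. quad Q (e n)) \<longlonglongrightarrow> 0"
    by (rule ex_approximants_of_one[OF one]) blast
  have "(\<lambda>n. extQ M D Q u (e n)) \<longlonglongrightarrow> 0"
  proof (rule tendsto_0_if_square_le)
    show "\<forall>\<^sub>F n in sequentially. (extQ M D Q u (e n))\<^sup>2 \<le> extQ1 M D Q u * quad Q (e n)"
      using u(1) e(1) by (simp add: ext_gen_rel_def extQ_Cauchy_Schwarz)
    show "(\<lambda>n. extQ1 M D Q u * quad Q (e n)) \<longlonglongrightarrow> 0" by (intro tendsto_mult_right_zero e(4))
  qed
  then have "(\<lambda>n. \<langle>w, e n\<rangle>) \<longlonglongrightarrow> 0" using u(1) e(1) by (simp add: ext_gen_rel_def)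
  moreover have "(\<lambda>n. \<langle>w, e n\<rangle>) \<longlonglongrightarrow> \<langle>w, \<lambda>x. 1\<rangle>"
    using e by (intro ip_tendsto_if_bounded[OF u(2) D_measurable[OF e(1)], where B = 1]) auto
  ultimately have "\<langle>w, \<lambda>x. 1\<rangle> = 0" using LIMSEQ_unique by blast
  then show ?thesis by (simp add: ip_def)
qed

end

section \<open>Equilibrium potentials\<close>

context dirichlet_space
begin

text \<open>The equilibrium potential solves \<open>L u + a u = g (1 - u)\<close>, that is, \<open>(L + g + a) u = g\<close>.\<close>

definition equilibrium :: "('a \<Rightarrow> real) \<Rightarrow> real \<Rightarrow> ('a \<Rightarrow> real) \<Rightarrow> bool" where
  "equilibrium g a u \<longleftrightarrow> resolvent (\<lambda>x. g x + a) g u \<and> (\<forall>x. 0 \<le> u x \<and> u x \<le> 1)"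

definition equilibrium_sequence :: "('a \<Rightarrow> real) \<Rightarrow> (nat \<Rightarrow> 'a \<Rightarrow> real) \<Rightarrow> bool" where
  "equilibrium_sequence g u \<longleftrightarrow> (\<forall>n. equilibrium g (inverse (real n + 1)) (u n))"

lemma equilibrium_resolvent: "equilibrium g a u \<Longrightarrow> resolvent (\<lambda>x. g x + a) g u"
  and equilibrium_unit: "equilibrium g a u \<Longrightarrow> 0 \<le> u x \<and> u x \<le> 1"
  by (simp_all add: equilibrium_def)

lemma equilibrium_mem: "equilibrium g a u \<Longrightarrow> u \<in> D"
  by (rule gen_rel_mem[OF equilibrium_resolvent])

lemma equilibrium_Linf: "equilibrium g a u \<Longrightarrow> u \<in> Linf M"
  using equilibrium_unit[of g a u] by (intro LinfI[of _ _ 1] D_measurable equilibrium_mem) auto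

lemma resolvent_add_const:
  assumes \<rho>: "\<rho> \<in> Linf M" and v: "resolvent \<rho> F v"
  shows "resolvent (\<lambda>x. \<rho> x + c) (\<lambda>x. F x + c * v x) v"
proof (rule gen_relI)
  note vD = gen_rel_mem[OF v] and F = gen_rel_L2[OF v]
  show "v \<in> D" "(\<lambda>x. F x + c * v x) \<in> L2 M" using vD F D_L2 by auto
  show "weighted (\<lambda>x. \<rho> x + c) v u = \<langle>\<lambda>x. F x + c * v x, u\<rangle>" if u: "u \<in> D" for u
    using gen_rel_form[OF v u] L2_Linf_mult[OF D_L2[OF vD] \<rho>] F vD u
    by (simp add: weighted_def distrib_right L2.add_left ip_scale_left D_L2)
qed

context
  fixes g :: "'a \<Rightarrow> real"
  assumes unit_density_integrable: "integrable M g" and g_unit: "\<And>x. 0 \<le> g x \<and> g x \<le> 1"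
begin

lemma unit_density_Linf: "g \<in> Linf M"
  using g_unit by (intro LinfI[of _ _ 1] borel_measurable_integrable unit_density_integrable) auto

lemma unit_density_L2: "g \<in> L2 M"
  by (rule L2_if_integrable_Linf[OF unit_density_integrable unit_density_Linf])

lemma ip_unit_density_le: "p \<in> Linf M \<Longrightarrow> (\<And>x. p x \<le> 1) \<Longrightarrow> \<langle>g, p\<rangle> \<le> (\<integral>x. g x \<partial>M)"
  using ip_mono_right[OF unit_density_integrable, of p "\<lambda>x. 1"] g_unit by (simp add: ip_def)

lemma weight_equilibrium:
  assumes "0 < a"
  shows "weight (\<lambda>x. g x + a)"
  unfolding weight_def
proof
  show "(\<lambda>x. g x + a) \<in> Linf M" using Linf_diff[OF unit_density_Linf Linf_const[of "- a"]] by simp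
  show "\<exists>\<alpha>>0. \<forall>x\<in>space M. \<alpha> \<le> g x + a" using assms g_unit by auto
qed

lemma equilibrium_gen:
  assumes "equilibrium g a u" "0 < a"
  shows "gen u (\<lambda>x. g x * (1 - u x) - a * u x)"
  using resolvent_gen[OF weight_equilibrium[OF assms(2)] equilibrium_resolvent[OF assms(1)]]
  by (simp add: algebra_simps)

lemma equilibrium_form:
  assumes u: "equilibrium g a u" "0 < a" and p: "p \<in> D"
  shows "Q u p = \<langle>\<lambda>x. g x * (1 - u x), p\<rangle> - a * \<langle>u, p\<rangle>"
proof -
  have "(\<lambda>x. (1 - u x) * g x) \<in> L2 M"
    by (intro L2_Linf_mult unit_density_L2 Linf_diff Linf_const equilibrium_Linf[OF u(1)])
  then show ?thesis
    using gen_rel_form[OF equilibrium_gen[OF u] p] equilibrium_mem[OF u(1)] p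
    by (simp add: L2.diff_left D_L2 ip_scale_left mult.commute)
qed

lemma ex_equilibrium:
  assumes "0 < a"
  obtains u where "equilibrium g a u"
proof -
  have "AE x in M. 0 \<le> g x \<and> g x \<le> 1 * (g x + a)" using g_unit assms by simp
  then show ?thesis
    using ex_resolvent_between[OF weight_equilibrium[OF assms] unit_density_L2 zero_le_one] that
    unfolding equilibrium_def by metis
qed

lemma equilibrium_antimono:
  assumes u: "equilibrium g a u" and v: "equilibrium g b v" and ab: "0 < b" "b \<le> a"
  shows "AE x in M. u x \<le> v x"
proof (rule resolvent_mono)
  show "weight (\<lambda>x. g x + a)" using ab by (intro weight_equilibrium) simp
  show "resolvent (\<lambda>x. g x + a) g u" by (rule equilibrium_resolvent[OF u])
  show "resolvent (\<lambda>x. g x + a) (\<lambda>x. g x + (a - b) * v x) v"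
    using resolvent_add_const[OF weight_Linf[OF weight_equilibrium[OF ab(1)]]
      equilibrium_resolvent[OF v], of "a - b"]
    by (simp add: add.assoc)
  show "AE x in M. g x \<le> g x + (a - b) * v x" using equilibrium_unit[OF v] ab by simp
qed

lemma equilibrium_increment:
  assumes u: "equilibrium g a u" and v: "equilibrium g b v" and ab: "0 < b" "b \<le> a"
  shows "quad Q (\<lambda>x. v x - u x) \<le> \<langle>g, v\<rangle> - \<langle>g, u\<rangle>"
proof -
  note uD = equilibrium_mem[OF u] and vD = equilibrium_mem[OF v]
  note form_u = gen_rel_form[OF equilibrium_resolvent[OF u]]
    and form_v = gen_rel_form[OF equilibrium_resolvent[OF v]]
  have "quad Q (\<lambda>x. v x - u x) \<le> quad (weighted (\<lambda>x. g x + b)) v - quad (weighted (\<lambda>x. g x + a)) u"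
    using ab uD vD by (intro quad_diff_le_if_weights_le weight_equilibrium)
      (auto simp: form_u form_v)
  then show ?thesis by (simp add: form_u[OF uD] form_v[OF vD])
qed

lemma equilibrium_quad_ip_le:
  assumes u: "equilibrium g a u" "0 < a"
  shows "a * quad (ip M) u \<le> (\<integral>x. g x \<partial>M)"
proof -
  have "\<langle>\<lambda>x. g x * (1 - u x), u\<rangle> = \<langle>g, \<lambda>x. (1 - u x) * u x\<rangle>" by (simp add: ip_def mult.assoc)
  also have "\<dots> \<le> (\<integral>x. g x \<partial>M)"
    using equilibrium_Linf[OF u(1)] equilibrium_unit[OF u(1)]
    by (intro ip_unit_density_le Linf_mult Linf_diff Linf_const) (auto intro: mult_le_one)
  finally show ?thesis
    using equilibrium_form[OF u equilibrium_mem[OF u(1)]] Q.quad_nonneg[OF equilibrium_mem[OF u(1)]]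
    by simp
qed

lemma ex_equilibrium_sequence:
  obtains u where "equilibrium_sequence g u"
proof -
  have "\<exists>u. equilibrium g (inverse (real n + 1)) u" for n
    using ex_equilibrium[of "inverse (real n + 1)"]
    by (metis add_nonneg_pos inverse_positive_iff_positive of_nat_0_le_iff zero_less_one)
  then show ?thesis using that unfolding equilibrium_sequence_def by metis
qed

context
  fixes u
  assumes u: "equilibrium_sequence g u"
begin

lemma equilibrium_sequence_nth: "equilibrium g (inverse (real n + 1)) (u n)"
  using u by (simp add: equilibrium_sequence_def)

lemma equilibrium_sequence_mono: "AE x in M. \<forall>n. u n x \<le> u (Suc n) x"
  unfolding AE_all_countable
proof
  show "AE x in M. u n x \<le> u (Suc n) x" for n
    by (rule equilibrium_antimono[OF equilibrium_sequence_nth equilibrium_sequence_nth]) auto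
qed

lemma equilibrium_sequence_Cauchy: "form_Cauchy Q u"
proof (rule Q.Cauchy_if_increments[of u "\<lambda>n. \<langle>g, u n\<rangle>" "\<integral>x. g x \<partial>M"])
  show "u n \<in> D" for n by (rule equilibrium_mem[OF equilibrium_sequence_nth])
  show "quad Q (\<lambda>x. u m x - u n x) \<le> \<langle>g, u m\<rangle> - \<langle>g, u n\<rangle>" if "n \<le> m" for n m
    using that
    by (intro equilibrium_increment[OF equilibrium_sequence_nth equilibrium_sequence_nth]) auto
  show "\<langle>g, u n\<rangle> \<le> (\<integral>x. g x \<partial>M)" for n
    using equilibrium_unit[OF equilibrium_sequence_nth]
    by (intro ip_unit_density_le equilibrium_Linf[OF equilibrium_sequence_nth]) auto
qed

lemma equilibrium_sequence_limit:
  obtains e where "e \<in> Linf M" "\<And>x. 0 \<le> e x \<and> e x \<le> 1" "AE x in M. (\<lambda>n. u n x) \<longlonglongrightarrow> e x"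
proof -
  define e where "e x = max 0 (min 1 (lim (\<lambda>n. u n x)))" for x
  have [measurable]: "u n \<in> borel_measurable M" for n
    by (rule D_measurable[OF equilibrium_mem[OF equilibrium_sequence_nth]])
  have "e \<in> borel_measurable M" unfolding e_def by measurable
  moreover have "AE x in M. (\<lambda>n. u n x) \<longlonglongrightarrow> e x"
    using equilibrium_sequence_mono
  proof eventually_elim
    case (elim x)
    have unit: "0 \<le> u n x" "u n x \<le> 1" for n
      using equilibrium_unit[OF equilibrium_sequence_nth, of n x] by auto
    from elim have "incseq (\<lambda>n. u n x)" by (intro incseq_SucI) auto
    then obtain l where l: "(\<lambda>n. u n x) \<longlonglongrightarrow> l"
      by (rule incseq_convergent[of _ 1]) (use unit in auto)
    have "0 \<le> l" "l \<le> 1"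
      using unit by (auto intro: LIMSEQ_le_const[OF l] LIMSEQ_le_const2[OF l])
    then show ?case using l limI[OF l] by (simp add: e_def)
  qed
  moreover have "0 \<le> e x \<and> e x \<le> 1" for x by (simp add: e_def)
  ultimately show ?thesis by (intro that[of e] LinfI[of _ _ 1]) auto
qed

lemma equilibrium_sequence_scaled_tendsto_0:
  assumes p: "p \<in> D"
  shows "(\<lambda>n. inverse (real n + 1) * \<langle>u n, p\<rangle>) \<longlonglongrightarrow> 0"
proof (rule tendsto_0_if_square_le)
  show "\<forall>\<^sub>F n in sequentially. (inverse (real n + 1) * \<langle>u n, p\<rangle>)\<^sup>2 \<le>
      inverse (real n + 1) * ((\<integral>x. g x \<partial>M) * quad (ip M) p)"
  proof (intro always_eventually allI)
    fix n
    define a where "a = inverse (real n + 1)"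
    have a: "0 < a" by (simp add: a_def)
    have un: "equilibrium g a (u n)" unfolding a_def by (rule equilibrium_sequence_nth)
    have "(a * \<langle>u n, p\<rangle>)\<^sup>2 \<le> a\<^sup>2 * (quad (ip M) (u n) * quad (ip M) p)"
      unfolding power_mult_distrib
      by (intro mult_left_mono L2.Cauchy_Schwarz D_L2 equilibrium_mem[OF un] p) simp
    also have "\<dots> = a * ((a * quad (ip M) (u n)) * quad (ip M) p)" by (simp add: power2_eq_square)
    also have "\<dots> \<le> a * ((\<integral>x. g x \<partial>M) * quad (ip M) p)"
      using a by (intro mult_left_mono mult_right_mono equilibrium_quad_ip_le[OF un]) auto
    finally show "(inverse (real n + 1) * \<langle>u n, p\<rangle>)\<^sup>2
        \<le> inverse (real n + 1) * ((\<integral>x. g x \<partial>M) * quad (ip M) p)"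
      unfolding a_def .
  qed
  show "(\<lambda>n. inverse (real n + 1) * ((\<integral>x. g x \<partial>M) * quad (ip M) p)) \<longlonglongrightarrow> 0"
    by (intro tendsto_mult_left_zero inverse_nat_add_1_tendsto_0)
qed

lemma ext_gen_rel_equilibrium_limit:
  assumes e: "e \<in> Linf M" and lim: "AE x in M. (\<lambda>n. u n x) \<longlonglongrightarrow> e x"
  shows "ext_gen_rel M D Q e (\<lambda>x. g x * (1 - e x))"
proof -
  have uD: "u n \<in> D" for n by (rule equilibrium_mem[OF equilibrium_sequence_nth])
  have approx: "approx_seq M D Q e u"
    using uD equilibrium_sequence_Cauchy lim by (simp add: approx_seq_iff)
  have "\<langle>\<lambda>x. g x * (1 - e x), p\<rangle> = extQ M D Q e p" if p: "p \<in> D" for p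
  proof -
    have swap: "\<langle>\<lambda>x. g x * (1 - f x), p\<rangle> = \<langle>\<lambda>x. g x * p x, \<lambda>x. 1 - f x\<rangle>" for f
      by (simp add: ip_def mult_ac)
    have "(\<lambda>n. \<langle>\<lambda>x. g x * p x, \<lambda>x. 1 - u n x\<rangle>) \<longlonglongrightarrow> \<langle>\<lambda>x. g x * p x, \<lambda>x. 1 - e x\<rangle>"
    proof (rule ip_tendsto_if_bounded)
      show "integrable M (\<lambda>x. g x * p x)"
        by (rule L2_mult_integrable[OF unit_density_L2 D_L2[OF p]])
      show "\<bar>1 - u n x\<bar> \<le> 1" for n x
        using equilibrium_unit[OF equilibrium_sequence_nth, of n x] by simp
      show "AE x in M. (\<lambda>n. 1 - u n x) \<longlonglongrightarrow> 1 - e x"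
        using lim by eventually_elim (intro tendsto_intros)
    qed (use uD e D_measurable Linf_measurable in measurable)
    from tendsto_diff[OF this equilibrium_sequence_scaled_tendsto_0[OF p]]
    have "(\<lambda>n. Q (u n) p) \<longlonglongrightarrow> \<langle>\<lambda>x. g x * (1 - e x), p\<rangle>"
      using equilibrium_form[OF equilibrium_sequence_nth _ p] by (simp add: swap)
    then show ?thesis using extQ_tendsto[OF approx p] LIMSEQ_unique by blast
  qed
  moreover have "(\<lambda>x. g x * (1 - e x)) \<in> L2 M"
    using L2_Linf_mult[OF unit_density_L2 Linf_diff[OF Linf_const e], of 1]
    by (simp add: mult.commute)
  ultimately show ?thesis
    using approx Linf_measurable[OF e] by (auto simp: ext_gen_rel_def ext_space_def)
qed

lemma equilibrium_sequence_tendsto_1_if_integral_generator_eq_0: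
  assumes zero: "\<forall>v w. ext_gen_rel M D Q v w \<and> integrable M w \<longrightarrow> (\<integral>x. w x \<partial>M) = 0"
  shows "AE x in M. 0 < g x \<longrightarrow> (\<lambda>n. u n x) \<longlonglongrightarrow> 1"
proof -
  obtain e where e: "e \<in> Linf M" "\<And>x. 0 \<le> e x \<and> e x \<le> 1" "AE x in M. (\<lambda>n. u n x) \<longlonglongrightarrow> e x"
    by (rule equilibrium_sequence_limit) blast
  have int: "integrable M (\<lambda>x. g x * (1 - e x))"
    by (intro integrable_mult_Linf unit_density_integrable Linf_diff Linf_const e(1))
  have "(\<integral>x. g x * (1 - e x) \<partial>M) = 0"
    using zero ext_gen_rel_equilibrium_limit[OF e(1,3)] int by blast
  then have "AE x in M. g x * (1 - e x) = 0"
    using integral_nonneg_eq_0_iff_AE[OF int] e(2) g_unit by (simp add: mult_nonneg_nonneg)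
  then show ?thesis using e(3) by eventually_elim auto
qed

end

end

end

section \<open>The semigroup\<close>

locale dirichlet_semigroup = dirichlet_space M D Q
  for M :: "'a measure" and D :: "('a \<Rightarrow> real) set" and Q :: "('a \<Rightarrow> real) \<Rightarrow> ('a \<Rightarrow> real) \<Rightarrow> real" +
  fixes T :: "real \<Rightarrow> ('a \<Rightarrow> real) \<Rightarrow> 'a \<Rightarrow> real"
  assumes semigroup: "semigroup_of M D Q T"
begin

lemma T_L2: "f \<in> L2 M \<Longrightarrow> t \<ge> 0 \<Longrightarrow> T t f \<in> L2 M"
  and T_0: "f \<in> L2 M \<Longrightarrow> AE x in M. T 0 f x = f x"
  and T_integrable: "integrable M f \<Longrightarrow> t \<ge> 0 \<Longrightarrow> integrable M (T t f)"
  using semigroup by (simp_all add: semigroup_of_def L1_def)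

lemma T_L1_contraction:
  "integrable M f \<Longrightarrow> integrable M g \<Longrightarrow> t \<ge> 0 \<Longrightarrow>
    (\<integral>x. \<bar>T t f x - T t g x\<bar> \<partial>M) \<le> (\<integral>x. \<bar>f x - g x\<bar> \<partial>M)"
  using semigroup by (simp add: semigroup_of_def L1_def l1norm_def)

lemma T_continuous:
  assumes "f \<in> L2 M" "t \<ge> 0"
  shows "((\<lambda>s. quad (ip M) (\<lambda>x. T s f x - T t f x)) \<longlongrightarrow> 0) (at t within {0..})"
proof -
  have "((\<lambda>s. l2norm M (\<lambda>x. T s f x - T t f x)) \<longlongrightarrow> 0) (at t within {0..})"
    using semigroup assms by (simp add: semigroup_of_def)
  from tendsto_power[OF this, of 2] show ?thesis unfolding l2norm_square by simp
qed

lemma T_derivative: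
  assumes f: "f \<in> L2 M" and t: "t > 0"
  obtains w where "gen (T t f) w" "L2_derivative M (\<lambda>s. T s f) (\<lambda>x. - w x) t"
proof -
  have "\<exists>w. gen (T t f) w \<and>
      ((\<lambda>h. l2norm M (\<lambda>x. (T (t + h) f x - T t f x) / h + w x)) \<longlongrightarrow> 0) (at 0)"
    using semigroup f t by (simp add: semigroup_of_def)
  then obtain w where w: "gen (T t f) w"
    and lim: "((\<lambda>h. l2norm M (\<lambda>x. (T (t + h) f x - T t f x) / h + w x)) \<longlongrightarrow> 0) (at 0)"
    by blast
  have "((\<lambda>h. t + h) \<longlongrightarrow> t + 0) (at (0::real))" by (intro tendsto_intros)
  from order_tendstoD(1)[OF this, of 0] have "\<forall>\<^sub>F h in at 0. T (t + h) f \<in> L2 M"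
    using t by (auto elim!: eventually_mono intro: T_L2[OF f])
  moreover have "((\<lambda>h. quad (ip M) (\<lambda>x. (T (t + h) f x - T t f x) / h - (- w x))) \<longlongrightarrow> 0) (at 0)"
    using tendsto_power[OF lim, of 2] unfolding l2norm_square by simp
  moreover have "(\<lambda>x. - w x) \<in> L2 M"
    using L2.scale_mem[OF gen_rel_L2[OF w], of "- 1"] by simp
  ultimately have "L2_derivative M (\<lambda>s. T s f) (\<lambda>x. - w x) t"
    unfolding L2_derivative_def using T_L2[OF f] t by auto
  with w show ?thesis by (rule that)
qed

lemma T_pairing_continuous:
  assumes f: "f \<in> L2 M" and g: "g \<in> L2 M"
  shows "continuous_on {0..} (\<lambda>s. \<langle>T s f, g\<rangle>)"
  unfolding continuous_on_def
proof
  fix t :: real assume "t \<in> {0..}"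
  then show "((\<lambda>s. \<langle>T s f, g\<rangle>) \<longlongrightarrow> \<langle>T t f, g\<rangle>) (at t within {0..})"
    using T_L2[OF f] by (intro L2.tendsto_left[OF _ _ g T_continuous[OF f]])
      (auto simp: eventually_at_filter)
qed

text \<open>The derivative of \<open>\<integral> \<theta> (T\<^sub>t f)\<close> is \<open>- Q (T\<^sub>t f) (\<theta>' (T\<^sub>t f)) \<le> 0\<close>.\<close>

lemma integral_primitive_T_le:
  assumes \<theta>: "quadratic_primitive \<theta> C" and mono: "mono C" and f: "f \<in> L2 M" and "t \<ge> 0"
  shows "(\<integral>x. \<theta> (T t f x) \<partial>M) \<le> (\<integral>x. \<theta> (f x) \<partial>M)"
proof -
  define \<Phi> where "\<Phi> s = (\<integral>x. \<theta> (T s f x) \<partial>M)" for s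
  have C: "normal_contraction C" and [measurable]: "\<theta> \<in> borel_measurable borel"
    using \<theta> by (auto simp: quadratic_primitive_def)
  have deriv: "\<exists>y. (\<Phi> has_real_derivative y) (at s) \<and> y \<le> 0" if s: "s > 0" for s
  proof -
    obtain w where w: "gen (T s f) w" and deriv: "L2_derivative M (\<lambda>s. T s f) (\<lambda>x. - w x) s"
      by (rule T_derivative[OF f s])
    note TD = gen_rel_mem[OF w]
    have "\<langle>\<lambda>x. - w x, \<lambda>x. C (T s f x)\<rangle> = - Q (T s f) (\<lambda>x. C (T s f x))"
      using gen_rel_form[OF w D_contraction[OF C TD]] ip_scale_left[of M "- 1" w] by simp
    also have "\<dots> \<le> 0" using Q_monotone_contraction_nonneg[OF C mono TD] by simp
    finally show ?thesis
      using L2_derivative_integral_primitive[OF \<theta> deriv] unfolding \<Phi>_def by blast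
  qed
  have cont: "continuous_on {0..t} \<Phi>"
    unfolding continuous_on_def \<Phi>_def
  proof
    fix s assume s: "s \<in> {0..t}"
    show "((\<lambda>r. \<integral>x. \<theta> (T r f x) \<partial>M) \<longlongrightarrow> (\<integral>x. \<theta> (T s f x) \<partial>M)) (at s within {0..t})"
    proof (rule integral_primitive_tendsto[OF \<theta>])
      show "\<forall>\<^sub>F r in at s within {0..t}. T r f \<in> L2 M"
        using T_L2[OF f] by (auto simp: eventually_at_filter)
      show "((\<lambda>r. quad (ip M) (\<lambda>x. T r f x - T s f x)) \<longlongrightarrow> 0) (at s within {0..t})"
        using s by (intro tendsto_within_subset[OF T_continuous[OF f]]) auto
    qed (use T_L2[OF f] s in simp)
  qed
  have "\<Phi> t \<le> \<Phi> 0"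
    by (rule DERIV_nonpos_imp_decreasing_open[OF \<open>t \<ge> 0\<close> _ cont]) (use deriv in auto)
  also have "\<Phi> 0 = (\<integral>x. \<theta> (f x) \<partial>M)"
    unfolding \<Phi>_def using T_0[OF f] L2_measurable[OF T_L2[OF f]] L2_measurable[OF f]
    by (intro integral_cong_AE) auto
  finally show ?thesis by (simp add: \<Phi>_def)
qed

lemma T_nonneg_L2:
  assumes f: "f \<in> L2 M" "AE x in M. 0 \<le> f x" and t: "t \<ge> 0"
  shows "AE x in M. 0 \<le> T t f x"
proof -
  let ?C = "\<lambda>s::real. min 0 s" and ?\<theta> = "\<lambda>s::real. (min 0 s)\<^sup>2 / 2"
  have \<theta>: "quadratic_primitive ?\<theta> ?C" by (rule quadratic_primitive_negative_part)
  have "(\<integral>x. ?\<theta> (f x) \<partial>M) = (\<integral>x. 0 \<partial>M)"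
    using f L2_measurable[OF f(1)] by (intro integral_cong_AE) (auto elim!: eventually_mono)
  with integral_primitive_T_le[OF \<theta> _ f(1) t] have "(\<integral>x. ?\<theta> (T t f x) \<partial>M) \<le> 0"
    by (simp add: monoI)
  then have "quad (ip M) (\<lambda>x. ?C (T t f x)) \<le> 0" unfolding quad_ip by simp
  moreover have "(\<lambda>x. ?C (T t f x)) \<in> L2 M"
    by (rule L2_normal_contraction[OF normal_contraction_min T_L2[OF f(1) t]]) simp
  ultimately have "AE x in M. ?C (T t f x) = 0" by (intro AE_eq_0_if_quad_ip_le_0)
  then show ?thesis by eventually_elim (simp add: min_def split: if_splits)
qed

lemma T_zero:
  assumes "t \<ge> 0"
  shows "AE x in M. T t (\<lambda>x. 0) x = 0"
proof -
  have "quadratic_primitive (\<lambda>s. s\<^sup>2 / 2) (\<lambda>s. s)" by (rule quadratic_primitive_square)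
  from integral_primitive_T_le[OF this _ L2.zero_mem assms] have "quad (ip M) (T t (\<lambda>x. 0)) \<le> 0"
    unfolding quad_ip by (simp add: monoI)
  then show ?thesis by (intro AE_eq_0_if_quad_ip_le_0 T_L2 L2.zero_mem assms)
qed

lemma T_L1_norm_le:
  assumes f: "integrable M f" and t: "t \<ge> 0"
  shows "(\<integral>x. \<bar>T t f x\<bar> \<partial>M) \<le> (\<integral>x. \<bar>f x\<bar> \<partial>M)"
proof -
  note [measurable] = T_integrable[OF f t, THEN borel_measurable_integrable]
    T_integrable[OF integrable_zero t, THEN borel_measurable_integrable]
  have "(\<integral>x. \<bar>T t f x\<bar> \<partial>M) = (\<integral>x. \<bar>T t f x - T t (\<lambda>x. 0) x\<bar> \<partial>M)"
    using T_zero[OF t] by (intro integral_cong_AE) (auto elim!: AE_mp)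
  also have "\<dots> \<le> (\<integral>x. \<bar>f x\<bar> \<partial>M)" using T_L1_contraction[OF f integrable_zero t] by simp
  finally show ?thesis .
qed

lemma T_nonneg:
  assumes f: "integrable M f" "AE x in M. 0 \<le> f x" and t: "t \<ge> 0"
  shows "AE x in M. 0 \<le> T t f x"
proof -
  let ?f = "\<lambda>n x. clip (real n) (f x)" and ?neg = "\<lambda>x. min 0 (T t f x)"
  note Tf = T_integrable[OF f(1) t]
  have fn: "integrable M (?f n)" for n by (intro clip_integrable f(1)) simp
  have "(\<integral>x. \<bar>?neg x\<bar> \<partial>M) \<le> (\<integral>x. \<bar>f x - ?f n x\<bar> \<partial>M)" for n
  proof -
    have "?f n \<in> L2 M" using f(1) by (intro L2_if_integrable_Linf[OF fn] clip_Linf) auto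
    moreover have "AE x in M. 0 \<le> ?f n x" using f(2) by eventually_elim (simp add: clip_nonneg)
    ultimately have "AE x in M. 0 \<le> T t (?f n) x" by (rule T_nonneg_L2[OF _ _ t])
    then have "AE x in M. \<bar>?neg x\<bar> \<le> \<bar>T t f x - T t (?f n) x\<bar>" by eventually_elim auto
    then have "(\<integral>x. \<bar>?neg x\<bar> \<partial>M) \<le> (\<integral>x. \<bar>T t f x - T t (?f n) x\<bar> \<partial>M)"
      using Tf T_integrable[OF fn t] by (intro integral_mono_AE) auto
    also have "\<dots> \<le> (\<integral>x. \<bar>f x - ?f n x\<bar> \<partial>M)" by (rule T_L1_contraction[OF f(1) fn t])
    finally show ?thesis .
  qed
  then have "(\<integral>x. \<bar>?neg x\<bar> \<partial>M) \<le> 0" by (intro LIMSEQ_le_const[OF clip_L1_tendsto[OF f(1)]]) auto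
  moreover have "0 \<le> (\<integral>x. \<bar>?neg x\<bar> \<partial>M)" by (rule integral_nonneg_AE) simp
  ultimately have "(\<integral>x. \<bar>?neg x\<bar> \<partial>M) = 0" by (rule antisym)
  then have "AE x in M. \<bar>?neg x\<bar> = 0"
    using Tf by (subst (asm) integral_nonneg_eq_0_iff_AE) auto
  then show ?thesis by eventually_elim (simp add: min_def split: if_splits)
qed

lemma abs_T_pairing_le:
  assumes f: "integrable M f" and t: "t \<ge> 0" and g: "g \<in> borel_measurable M"
    and bound: "0 \<le> B" "\<And>x. x \<in> space M \<Longrightarrow> \<bar>g x\<bar> \<le> B"
  shows "\<bar>\<langle>T t f, g\<rangle>\<bar> \<le> B * (\<integral>x. \<bar>f x\<bar> \<partial>M)"
proof -
  have "\<bar>\<langle>T t f, g\<rangle>\<bar> \<le> B * (\<integral>x. \<bar>T t f x\<bar> \<partial>M)"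
    using bound(2) by (intro abs_ip_le T_integrable f t g) auto
  also have "\<dots> \<le> B * (\<integral>x. \<bar>f x\<bar> \<partial>M)" by (intro mult_left_mono T_L1_norm_le f t bound(1))
  finally show ?thesis .
qed

lemma T_pairing_nonneg:
  assumes f: "integrable M f" "AE x in M. 0 \<le> f x" and "t \<ge> 0" and g: "\<And>x. x \<in> space M \<Longrightarrow> 0 \<le> g x"
  shows "0 \<le> \<langle>T t f, g\<rangle>"
proof (rule ip_nonneg)
  show "AE x in M. 0 \<le> T t f x * g x"
    using T_nonneg[OF f \<open>t \<ge> 0\<close>] AE_space by eventually_elim (simp add: g)
qed

lemma T_clip_pairing_tendsto:
  assumes f: "integrable M f" and g: "g \<in> Linf M" and t: "t \<ge> 0"
  shows "(\<lambda>n. \<langle>T t (\<lambda>x. clip (real n) (f x)), g\<rangle>) \<longlonglongrightarrow> \<langle>T t f, g\<rangle>"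
proof -
  let ?f = "\<lambda>n x. clip (real n) (f x)"
  obtain B where B: "0 \<le> B" "\<And>x. x \<in> space M \<Longrightarrow> \<bar>g x\<bar> \<le> B" by (rule LinfE[OF g]) blast
  have "norm (\<langle>T t (?f n), g\<rangle> - \<langle>T t f, g\<rangle>) \<le> B * (\<integral>x. \<bar>f x - ?f n x\<bar> \<partial>M)" for n
  proof -
    have fn: "integrable M (?f n)" by (intro clip_integrable f) simp
    note Tf = T_integrable[OF f t] and Tfn = T_integrable[OF fn t]
    have "\<bar>\<langle>T t (?f n), g\<rangle> - \<langle>T t f, g\<rangle>\<bar> = \<bar>\<langle>\<lambda>x. T t (?f n) x - T t f x, g\<rangle>\<bar>"
      by (simp add: ip_diff_left_L1 Tf Tfn g)
    also have "\<dots> \<le> B * (\<integral>x. \<bar>T t (?f n) x - T t f x\<bar> \<partial>M)"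
      using Tf Tfn g B(2) by (intro abs_ip_le) auto
    also have "\<dots> \<le> B * (\<integral>x. \<bar>?f n x - f x\<bar> \<partial>M)"
      by (intro mult_left_mono T_L1_contraction f fn t B(1))
    finally show ?thesis by (simp add: abs_minus_commute)
  qed
  then have "(\<lambda>n. \<langle>T t (?f n), g\<rangle> - \<langle>T t f, g\<rangle>) \<longlonglongrightarrow> 0"
    by (intro Lim_null_comparison[OF always_eventually
          tendsto_mult_right_zero[OF clip_L1_tendsto[OF f]]] allI)
  then show ?thesis by (rule LIM_zero_cancel)
qed

section \<open>Occupation integrals\<close>

definition occupation :: "('a \<Rightarrow> real) \<Rightarrow> real \<Rightarrow> ('a \<Rightarrow> real) \<Rightarrow> real" where
  "occupation f r g = (LBINT s:{0..r}. \<langle>T s f, g\<rangle>)"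

lemma T_pairing_measurable_L2:
  assumes f: "integrable M f" and g: "g \<in> L2 M" "g \<in> Linf M"
  shows "(\<lambda>s. indicator {0..r} s *\<^sub>R \<langle>T s f, g\<rangle>) \<in> borel_measurable lborel"
proof (rule borel_measurable_LIMSEQ_real)
  let ?f = "\<lambda>n x. clip (real n) (f x)"
  show "(\<lambda>s. indicator {0..r} s *\<^sub>R \<langle>T s (?f n), g\<rangle>) \<in> borel_measurable lborel" for n
  proof -
    have "?f n \<in> L2 M" using f by (intro L2_if_integrable_Linf clip_integrable clip_Linf) auto
    then have "continuous_on {0..r} (\<lambda>s. \<langle>T s (?f n), g\<rangle>)"
      by (intro continuous_on_subset[OF T_pairing_continuous[OF _ g(1)]]) auto
    from borel_measurable_continuous_on_indicator[OF _ this] show ?thesis by simp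
  qed
  show "(\<lambda>n. indicator {0..r} s *\<^sub>R \<langle>T s (?f n), g\<rangle>) \<longlonglongrightarrow> indicator {0..r} s *\<^sub>R \<langle>T s f, g\<rangle>" for s
    using T_clip_pairing_tendsto[OF f g(2), of s] by (cases "s \<in> {0..r}") auto
qed

lemma T_pairing_measurable:
  assumes f: "integrable M f" and g: "g \<in> Linf M"
  shows "(\<lambda>s. indicator {0..r} s *\<^sub>R \<langle>T s f, g\<rangle>) \<in> borel_measurable lborel"
proof -
  obtain A where A: "\<And>i. A i \<in> sets M" "\<And>i. emeasure M (A i) < \<infinity>" "incseq A" "(\<Union>i. A i) = space M"
    by (rule finite_exhaustion) blast
  obtain B where B: "0 \<le> B" "\<And>x. x \<in> space M \<Longrightarrow> \<bar>g x\<bar> \<le> B" by (rule LinfE[OF g]) blast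
  let ?g = "\<lambda>i x. g x * indicator (A i) x"
  have gi: "?g i \<in> L2 M" "?g i \<in> Linf M" for i
    using A(1,2)[of i] g by (simp_all add: L2_Linf_mult[OF L2_if_integrable_Linf])
  show ?thesis
  proof (rule borel_measurable_LIMSEQ_real[OF _ T_pairing_measurable_L2[OF f gi]])
    fix s
    show "(\<lambda>i. indicator {0..r} s *\<^sub>R \<langle>T s f, ?g i\<rangle>) \<longlonglongrightarrow> indicator {0..r} s *\<^sub>R \<langle>T s f, g\<rangle>"
    proof (cases "s \<in> {0..r}")
      case True
      have "(\<lambda>i. \<langle>T s f, ?g i\<rangle>) \<longlonglongrightarrow> \<langle>T s f, g\<rangle>"
      proof (rule ip_tendsto_if_bounded)
        show "integrable M (T s f)" using True by (intro T_integrable f) simp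
        show "\<bar>?g i x\<bar> \<le> B" if "x \<in> space M" for i x
          using B(1) B(2)[OF that] by (simp add: indicator_def)
        show "AE x in M. (\<lambda>i. ?g i x) \<longlonglongrightarrow> g x"
        proof (rule AE_I2)
          fix x assume "x \<in> space M"
          then have "(\<lambda>i. g x * indicator (A i) x) \<longlonglongrightarrow> g x * indicator (\<Union>i. A i) x"
            by (intro tendsto_mult_left LIMSEQ_indicator_incseq A(3))
          with \<open>x \<in> space M\<close> show "(\<lambda>i. ?g i x) \<longlonglongrightarrow> g x" by (simp add: A(4))
        qed
      qed (use gi(2) g Linf_measurable in blast)+
      then show ?thesis by (intro tendsto_scaleR tendsto_const)
    qed simp
  qed
qed

lemma T_pairing_set_integrable:
  assumes f: "integrable M f" and g: "g \<in> Linf M"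
  shows "set_integrable lborel {0..r} (\<lambda>s. \<langle>T s f, g\<rangle>)"
proof -
  obtain B where B: "0 \<le> B" "\<And>x. x \<in> space M \<Longrightarrow> \<bar>g x\<bar> \<le> B" by (rule LinfE[OF g]) blast
  have "integrable lborel (\<lambda>s. indicator {0..r} s *\<^sub>R (B * (\<integral>x. \<bar>f x\<bar> \<partial>M)))"
    by (intro integrable_real_indicator integrable_scaleR_left) (auto simp: emeasure_lborel_Icc_eq)
  moreover have "AE s in lborel. norm (indicator {0..r} s *\<^sub>R \<langle>T s f, g\<rangle>) \<le>
      norm (indicator {0..r} s *\<^sub>R (B * (\<integral>x. \<bar>f x\<bar> \<partial>M)))"
    using abs_T_pairing_le[OF f _ Linf_measurable[OF g] B]
    by (auto simp: indicator_def intro!: AE_I2 order_trans[OF _ abs_ge_self])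
  ultimately show ?thesis
    unfolding set_integrable_def
    by (intro Bochner_Integration.integrable_bound[OF _ T_pairing_measurable[OF f g]])
qed

lemma occupation_diff:
  assumes f: "integrable M f" and g: "g \<in> Linf M" "h \<in> Linf M"
  shows "occupation f r (\<lambda>x. g x - h x) = occupation f r g - occupation f r h"
proof -
  have "(LBINT s:{0..r}. \<langle>T s f, \<lambda>x. g x - h x\<rangle>) = (LBINT s:{0..r}. \<langle>T s f, g\<rangle> - \<langle>T s f, h\<rangle>)"
    using f g by (intro set_lebesgue_integral_cong) (auto simp: ip_diff_right_Linf T_integrable)
  then show ?thesis
    unfolding occupation_def by (simp add: set_integral_diff(2) T_pairing_set_integrable f g)
qed

lemma occupation_scale: "occupation f r (\<lambda>x. c * g x) = c * occupation f r g"
  unfolding occupation_def ip_scale_right by simp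

lemma occupation_mono:
  assumes f: "integrable M f" "AE x in M. 0 \<le> f x" and g: "g \<in> Linf M" "h \<in> Linf M"
    and le: "\<And>x. x \<in> space M \<Longrightarrow> g x \<le> h x"
  shows "occupation f r g \<le> occupation f r h"
  unfolding occupation_def
  by (intro set_integral_mono T_pairing_set_integrable f g ip_mono_right T_integrable T_nonneg le) auto

lemma occupation_nonneg:
  assumes f: "integrable M f" "AE x in M. 0 \<le> f x" and g: "g \<in> Linf M" "\<And>x. x \<in> space M \<Longrightarrow> 0 \<le> g x"
  shows "0 \<le> occupation f r g"
  using occupation_mono[OF f Linf_const[of 0] g(1), of r] g(2) by (simp add: occupation_def ip_def)

lemma occupation_mono_time:
  assumes f: "integrable M f" "AE x in M. 0 \<le> f x" and g: "g \<in> Linf M" "\<And>x. x \<in> space M \<Longrightarrow> 0 \<le> g x"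
    and "r \<le> r'"
  shows "occupation f r g \<le> occupation f r' g"
  unfolding occupation_def set_lebesgue_integral_def
proof (rule integral_mono)
  show "indicator {0..r} s *\<^sub>R \<langle>T s f, g\<rangle> \<le> indicator {0..r'} s *\<^sub>R \<langle>T s f, g\<rangle>" for s
    using T_pairing_nonneg[OF f _ g(2)] \<open>r \<le> r'\<close> by (auto simp: indicator_def)
qed (use T_pairing_set_integrable[OF f(1) g(1)] in \<open>simp_all add: set_integrable_def\<close>)

lemma occupation_tendsto:
  assumes f: "integrable M f" and g: "g \<in> Linf M"
  shows "(\<lambda>n. occupation (\<lambda>x. clip (real n) (f x)) r g) \<longlonglongrightarrow> occupation f r g"
proof -
  let ?f = "\<lambda>n x. clip (real n) (f x)"
  obtain B where B: "0 \<le> B" "\<And>x. x \<in> space M \<Longrightarrow> \<bar>g x\<bar> \<le> B" by (rule LinfE[OF g]) blast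
  have fn: "integrable M (?f n)" for n by (intro clip_integrable f) simp
  have bound: "\<bar>\<langle>T s (?f n), g\<rangle>\<bar> \<le> B * (\<integral>x. \<bar>f x\<bar> \<partial>M)" if "s \<ge> 0" for n s
  proof -
    have "(\<integral>x. \<bar>?f n x\<bar> \<partial>M) \<le> (\<integral>x. \<bar>f x\<bar> \<partial>M)"
      using f fn[of n] normal_contraction_abs_le[OF normal_contraction_clip[of "real n"]]
      by (intro integral_mono) auto
    from mult_left_mono[OF this B(1)] show ?thesis
      using abs_T_pairing_le[OF fn that Linf_measurable[OF g] B, of n] by linarith
  qed
  show ?thesis
    unfolding occupation_def set_lebesgue_integral_def
  proof (rule integral_dominated_convergence)
    show "(\<lambda>s. indicator {0..r} s *\<^sub>R \<langle>T s f, g\<rangle>) \<in> borel_measurable lborel"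
      "(\<lambda>s. indicator {0..r} s *\<^sub>R \<langle>T s (?f n), g\<rangle>) \<in> borel_measurable lborel" for n
      by (intro T_pairing_measurable f fn g)+
    show "integrable lborel (\<lambda>s. indicator {0..r} s *\<^sub>R (B * (\<integral>x. \<bar>f x\<bar> \<partial>M)))"
      by (intro integrable_real_indicator integrable_scaleR_left)
        (auto simp: emeasure_lborel_Icc_eq)
    show "AE s in lborel. norm (indicator {0..r} s *\<^sub>R \<langle>T s (?f n), g\<rangle>) \<le>
        indicator {0..r} s *\<^sub>R (B * (\<integral>x. \<bar>f x\<bar> \<partial>M))" for n
      using bound by (auto simp: indicator_def)
    show "AE s in lborel. (\<lambda>n. indicator {0..r} s *\<^sub>R \<langle>T s (?f n), g\<rangle>) \<longlonglongrightarrow>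
        indicator {0..r} s *\<^sub>R \<langle>T s f, g\<rangle>"
      using T_clip_pairing_tendsto[OF f g] by (auto simp: indicator_def intro!: AE_I2)
  qed
qed

lemma occupation_generator_L2:
  assumes f: "f \<in> L2 M" and u: "gen u w" and "r \<ge> 0"
  shows "occupation f r w = \<langle>f, u\<rangle> - \<langle>T r f, u\<rangle>"
proof -
  note uD = gen_rel_mem[OF u] and wL = gen_rel_L2[OF u]
  let ?F = "\<lambda>s. - \<langle>T s f, u\<rangle>"
  have "((\<lambda>s. \<langle>T s f, w\<rangle>) has_integral (?F r - ?F 0)) {0..r}"
  proof (rule fundamental_theorem_of_calculus_interior[OF \<open>r \<ge> 0\<close>])
    show "continuous_on {0..r} ?F"
      by (intro continuous_on_minus
          continuous_on_subset[OF T_pairing_continuous[OF f D_L2[OF uD]]]) auto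
    fix t assume "t \<in> {0<..<r}"
    then have "t > 0" by simp
    then obtain v where v: "gen (T t f) v" and deriv: "L2_derivative M (\<lambda>s. T s f) (\<lambda>x. - v x) t"
      using T_derivative[OF f] by blast
    have "- \<langle>\<lambda>x. - v x, u\<rangle> = \<langle>T t f, w\<rangle>"
      using Q.gen_rel_swap[OF v u] ip_commute[of M w "T t f"] ip_scale_left[of M "- 1" v u] by simp
    then show "(?F has_vector_derivative \<langle>T t f, w\<rangle>) (at t)"
      using DERIV_minus[OF L2_derivative_ip[OF deriv D_L2[OF uD]]]
      by (simp add: has_real_derivative_iff_has_vector_derivative)
  qed
  then have "integral {0..r} (\<lambda>s. \<langle>T s f, w\<rangle>) = ?F r - ?F 0" by (rule integral_unique)
  moreover have "set_integrable lborel {0..r} (\<lambda>s. \<langle>T s f, w\<rangle>)"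
    by (intro borel_integrable_atLeastAtMost'
        continuous_on_subset[OF T_pairing_continuous[OF f wL]]) auto
  moreover have "\<langle>T 0 f, u\<rangle> = \<langle>f, u\<rangle>"
    using T_0[OF f] L2_measurable[OF T_L2[OF f]] L2_measurable[OF f] D_measurable[OF uD]
    by (intro ip_cong_AE) auto
  ultimately show ?thesis by (simp add: occupation_def set_borel_integral_eq_integral)
qed

lemma occupation_generator:
  assumes f: "integrable M f" and u: "gen u w" and bounded: "u \<in> Linf M" "w \<in> Linf M" and "r \<ge> 0"
  shows "occupation f r w = \<langle>f, u\<rangle> - \<langle>T r f, u\<rangle>"
proof (rule LIMSEQ_unique[OF occupation_tendsto[OF f bounded(2)]])
  let ?f = "\<lambda>n x. clip (real n) (f x)"
  have "?f n \<in> L2 M" for n using f by (intro L2_if_integrable_Linf clip_integrable clip_Linf) auto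
  then have "occupation (?f n) r w = \<langle>?f n, u\<rangle> - \<langle>T r (?f n), u\<rangle>" for n
    by (rule occupation_generator_L2[OF _ u \<open>r \<ge> 0\<close>])
  moreover have "(\<lambda>n. \<langle>?f n, u\<rangle>) \<longlonglongrightarrow> \<langle>f, u\<rangle>"
    unfolding ip_def
  proof (rule integral_dominated_convergence)
    note [measurable] = borel_measurable_integrable[OF f] Linf_measurable[OF bounded(1)]
    show "integrable M (\<lambda>x. \<bar>f x * u x\<bar>)" using integrable_mult_Linf[OF f bounded(1)] by simp
    show "AE x in M. norm (?f n x * u x) \<le> \<bar>f x * u x\<bar>" for n
      using normal_contraction_abs_le[OF normal_contraction_clip[of "real n"]]
      by (simp add: abs_mult mult_right_mono)
    show "AE x in M. (\<lambda>n. ?f n x * u x) \<longlonglongrightarrow> f x * u x"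
      by (intro AE_I2 tendsto_intros clip_tendsto filterlim_real_sequentially)
    show "(\<lambda>x. f x * u x) \<in> borel_measurable M" "(\<lambda>x. ?f n x * u x) \<in> borel_measurable M" for n
      by measurable
  qed
  ultimately show "(\<lambda>n. occupation (?f n) r w) \<longlonglongrightarrow> \<langle>f, u\<rangle> - \<langle>T r f, u\<rangle>"
    using T_clip_pairing_tendsto[OF f bounded(1) \<open>r \<ge> 0\<close>] by (simp add: tendsto_diff)
qed

end

section \<open>Finite-time potentials\<close>

lemma nn_integral_mult_eq_ip:
  assumes f: "integrable M f" "AE x in M. 0 \<le> f x" and g: "g \<in> Linf M" "\<And>x. x \<in> space M \<Longrightarrow> 0 \<le> g x"
  shows "(\<integral>\<^sup>+x. ennreal (f x) * ennreal (g x) \<partial>M) = ennreal (ip M f g)"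
proof -
  have nonneg: "AE x in M. 0 \<le> f x * g x" using f(2) AE_space by eventually_elim (simp add: g(2))
  have "(\<integral>\<^sup>+x. ennreal (f x) * ennreal (g x) \<partial>M) = (\<integral>\<^sup>+x. ennreal (f x * g x) \<partial>M)"
    using AE_space by (intro nn_integral_cong_AE, eventually_elim) (simp add: ennreal_mult'' g(2))
  also have "\<dots> = ennreal (ip M f g)"
    unfolding ip_def by (rule nn_integral_eq_integral[OF integrable_mult_Linf[OF f(1) g(1)] nonneg])
  finally show ?thesis .
qed

context dirichlet_semigroup
begin

lemma int_semigroup_iff:
  "is_int_semigroup M T f r F \<longleftrightarrow> integrable M F \<and> (\<forall>g\<in>Linf M. \<langle>F, g\<rangle> = occupation f r g)"
  by (auto simp: is_int_semigroup_def L1_def Linf_def occupation_def ip_def)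

lemma int_semigroup_integrable: "is_int_semigroup M T f r F \<Longrightarrow> integrable M F"
  and int_semigroup_ip: "is_int_semigroup M T f r F \<Longrightarrow> g \<in> Linf M \<Longrightarrow> \<langle>F, g\<rangle> = occupation f r g"
  by (simp_all add: int_semigroup_iff)

lemma nn_integral_occupation:
  assumes f: "integrable M f" "AE x in M. 0 \<le> f x" and g: "g \<in> Linf M" "\<And>x. x \<in> space M \<Longrightarrow> 0 \<le> g x"
  shows "(\<integral>\<^sup>+s. ennreal \<langle>T s f, g\<rangle> \<partial>restrict_space lborel {0..r}) = ennreal (occupation f r g)"
proof -
  have "(\<integral>\<^sup>+s. ennreal \<langle>T s f, g\<rangle> \<partial>restrict_space lborel {0..r}) =
      (\<integral>\<^sup>+s. ennreal (indicator {0..r} s *\<^sub>R \<langle>T s f, g\<rangle>) \<partial>lborel)"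
    by (subst nn_integral_restrict_space) (auto intro!: nn_integral_cong simp: indicator_def)
  also have "\<dots> = ennreal (occupation f r g)"
    unfolding occupation_def set_lebesgue_integral_def
  proof (rule nn_integral_eq_integral)
    show "integrable lborel (\<lambda>s. indicator {0..r} s *\<^sub>R \<langle>T s f, g\<rangle>)"
      using T_pairing_set_integrable[OF f(1) g(1)] by (simp add: set_integrable_def)
    show "AE s in lborel. 0 \<le> indicator {0..r} s *\<^sub>R \<langle>T s f, g\<rangle>"
      using T_pairing_nonneg[OF f _ g(2)] by (auto simp: indicator_def)
  qed
  finally show ?thesis .
qed

lemma ex_potential_density:
  assumes f: "integrable M f" "AE x in M. 0 \<le> f x"
  obtains H where "H \<in> borel_measurable M"
    "\<And>g. g \<in> Linf M \<Longrightarrow> (\<And>x. x \<in> space M \<Longrightarrow> 0 \<le> g x) \<Longrightarrow>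
      (\<integral>\<^sup>+x. H x * ennreal (g x) \<partial>M) = ennreal (occupation f r g)"
proof -
  define L where "L = restrict_space lborel {0..r}"
  define h where "h s x = ennreal (T s f x)" for s x
  have s: "0 \<le> s" if "s \<in> space L" for s using that by (simp add: L_def space_restrict_space)
  have h: "h s \<in> borel_measurable M" if "s \<in> space L" for s
    using borel_measurable_integrable[OF T_integrable[OF f(1) s[OF that]]]
    unfolding h_def by measurable
  have h_ip: "(\<integral>\<^sup>+x. h s x * ennreal (g x) \<partial>M) = ennreal \<langle>T s f, g\<rangle>"
    if "s \<in> space L" "g \<in> Linf M" "\<And>x. x \<in> space M \<Longrightarrow> 0 \<le> g x" for s g
    unfolding h_def using that
    by (intro nn_integral_mult_eq_ip T_integrable[OF f(1) s] T_nonneg[OF f s])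
  have meas: "(\<lambda>s. \<integral>\<^sup>+x\<in>A. h s x \<partial>M) \<in> borel_measurable L" if A: "A \<in> sets M" for A
  proof -
    have "(\<lambda>s. \<langle>T s f, indicat_real A\<rangle>) \<in> borel_measurable L"
      unfolding L_def using T_pairing_measurable[OF f(1) Linf_indicator[OF A], of r]
      by (subst borel_measurable_restrict_space_iff) auto
    then have "(\<lambda>s. ennreal \<langle>T s f, indicat_real A\<rangle>) \<in> borel_measurable L" by measurable
    then show ?thesis
      by (rule measurable_cong[THEN iffD1, rotated])
        (use A in \<open>simp add: h_ip[symmetric] ennreal_indicator\<close>)
  qed
  obtain H where H: "H \<in> borel_measurable M"
    "\<And>A. A \<in> sets M \<Longrightarrow> (\<integral>\<^sup>+x\<in>A. H x \<partial>M) = (\<integral>\<^sup>+s. (\<integral>\<^sup>+x\<in>A. h s x \<partial>M) \<partial>L)"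
    using ex_mixture_density[OF h meas] by blast
  have "(\<integral>\<^sup>+x. H x * ennreal (g x) \<partial>M) = ennreal (occupation f r g)"
    if g: "g \<in> Linf M" "\<And>x. x \<in> space M \<Longrightarrow> 0 \<le> g x" for g
  proof -
    have g_meas: "(\<lambda>x. ennreal (g x)) \<in> borel_measurable M"
      using Linf_measurable[OF g(1)] by measurable
    have "(\<integral>\<^sup>+x. H x * ennreal (g x) \<partial>M) = (\<integral>\<^sup>+s. (\<integral>\<^sup>+x. h s x * ennreal (g x) \<partial>M) \<partial>L)"
      by (rule nn_integral_mixture_density[OF h meas H g_meas, THEN conjunct2])
    also have "\<dots> = (\<integral>\<^sup>+s. ennreal \<langle>T s f, g\<rangle> \<partial>L)" by (intro nn_integral_cong h_ip g)
    also have "\<dots> = ennreal (occupation f r g)"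
      unfolding L_def by (rule nn_integral_occupation[OF f g])
    finally show ?thesis .
  qed
  with H(1) show ?thesis by (rule that)
qed

lemma int_semigroupI_nonneg:
  assumes f: "integrable M f" and F: "integrable M F"
    and eq: "\<And>g. g \<in> Linf M \<Longrightarrow> (\<And>x. x \<in> space M \<Longrightarrow> 0 \<le> g x) \<Longrightarrow> \<langle>F, g\<rangle> = occupation f r g"
  shows "is_int_semigroup M T f r F"
proof -
  have "\<langle>F, g\<rangle> = occupation f r g" if g: "g \<in> Linf M" for g
  proof -
    let ?p = "\<lambda>x. max 0 (g x)" and ?n = "\<lambda>x. max 0 (- g x)"
    have pn: "?p \<in> Linf M" "?n \<in> Linf M"
      using g Linf_max_0[OF Linf_diff[OF Linf_const[of 0] g]] by simp_all
    have g_eq: "g = (\<lambda>x. ?p x - ?n x)" by auto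
    have "\<langle>F, \<lambda>x. ?p x - ?n x\<rangle> = occupation f r (\<lambda>x. ?p x - ?n x)"
      using pn eq[of ?p] eq[of ?n] by (simp add: ip_diff_right_Linf occupation_diff F f)
    then show ?thesis by (simp flip: g_eq)
  qed
  with F show ?thesis by (simp add: int_semigroup_iff)
qed

lemma ex_int_semigroup:
  assumes f: "integrable M f" "AE x in M. 0 \<le> f x"
  obtains F where "is_int_semigroup M T f r F"
proof -
  obtain H where [measurable]: "H \<in> borel_measurable M" and
    H: "\<And>g. g \<in> Linf M \<Longrightarrow> (\<And>x. x \<in> space M \<Longrightarrow> 0 \<le> g x) \<Longrightarrow>
      (\<integral>\<^sup>+x. H x * ennreal (g x) \<partial>M) = ennreal (occupation f r g)"
    by (rule ex_potential_density[OF f]) blast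
  define F where "F x = enn2real (H x)" for x
  have [measurable]: "F \<in> borel_measurable M" unfolding F_def by measurable
  have F_nonneg: "0 \<le> F x" for x by (simp add: F_def)
  have total: "(\<integral>\<^sup>+x. H x \<partial>M) < \<infinity>" using H[of "\<lambda>x. 1"] by simp
  then have "AE x in M. H x \<noteq> \<infinity>" by (intro nn_integral_noteq_infinite) auto
  then have F_eq: "AE x in M. ennreal (F x) = H x"
    by eventually_elim (simp add: F_def less_top)
  then have "(\<integral>\<^sup>+x. ennreal (norm (F x)) \<partial>M) = (\<integral>\<^sup>+x. H x \<partial>M)"
    using F_nonneg by (intro nn_integral_cong_AE) simp
  with total have F: "integrable M F" by (intro integrableI_bounded) simp_all
  have F_ip: "\<langle>F, g\<rangle> = occupation f r g" if g: "g \<in> Linf M" "\<And>x. x \<in> space M \<Longrightarrow> 0 \<le> g x" for g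
  proof -
    have "ennreal \<langle>F, g\<rangle> = (\<integral>\<^sup>+x. ennreal (F x) * ennreal (g x) \<partial>M)"
      using F_nonneg by (intro nn_integral_mult_eq_ip[symmetric] F g) auto
    also have "\<dots> = (\<integral>\<^sup>+x. H x * ennreal (g x) \<partial>M)"
      using F_eq by (intro nn_integral_cong_AE) auto
    also have "\<dots> = ennreal (occupation f r g)" by (rule H[OF g])
    finally show ?thesis
      using g F_nonneg by (subst (asm) ennreal_inj) (auto intro!: ip_nonneg occupation_nonneg f)
  qed
  have "is_int_semigroup M T f r F" by (rule int_semigroupI_nonneg[OF f(1) F F_ip])
  then show ?thesis by (rule that)
qed

definition potential_sequence :: "('a \<Rightarrow> real) \<Rightarrow> (nat \<Rightarrow> 'a \<Rightarrow> real) \<Rightarrow> bool" where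
  "potential_sequence f F \<longleftrightarrow> (\<forall>n. is_int_semigroup M T f (real n) (F n))"

lemma ex_potential_sequence:
  assumes f: "integrable M f" "AE x in M. 0 \<le> f x"
  obtains F where "potential_sequence f F"
proof -
  have "\<exists>F. is_int_semigroup M T f (real n) F" for n using ex_int_semigroup[OF f] by blast
  then show ?thesis using that unfolding potential_sequence_def by metis
qed

context
  fixes f :: "'a \<Rightarrow> real" and F :: "nat \<Rightarrow> 'a \<Rightarrow> real"
  assumes f: "integrable M f" "AE x in M. 0 \<le> f x" and F: "potential_sequence f F"
begin

lemma potential_integrable: "integrable M (F n)"
  using F int_semigroup_integrable by (auto simp: potential_sequence_def)

lemma potential_ip: "g \<in> Linf M \<Longrightarrow> \<langle>F n, g\<rangle> = occupation f (real n) g"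
  using F int_semigroup_ip by (auto simp: potential_sequence_def)

lemma potential_sequence_mono: "AE x in M. \<forall>n. 0 \<le> F n x \<and> F n x \<le> F (Suc n) x"
  unfolding AE_all_countable
proof
  fix n
  have "AE x in M. 0 \<le> F n x"
  proof (rule AE_le_if_ip_indicator_le)
    show "\<langle>\<lambda>x. 0, indicator A\<rangle> \<le> \<langle>F n, indicator A\<rangle>" if "A \<in> sets M" for A
      using occupation_nonneg[OF f Linf_indicator[OF that], of "real n"]
      by (simp add: potential_ip that ip_def[of M "\<lambda>x. 0"])
  qed (simp_all add: potential_integrable)
  moreover have "AE x in M. F n x \<le> F (Suc n) x"
  proof (rule AE_le_if_ip_indicator_le)
    show "\<langle>F n, indicator A\<rangle> \<le> \<langle>F (Suc n), indicator A\<rangle>" if "A \<in> sets M" for A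
      using that by (simp only: potential_ip Linf_indicator) (intro occupation_mono_time f; simp)
  qed (simp_all add: potential_integrable)
  ultimately show "AE x in M. 0 \<le> F n x \<and> F n x \<le> F (Suc n) x" by eventually_elim simp
qed

lemma potential_eq_0_if_AE_eq_0:
  assumes "AE x in M. f x = 0"
  shows "AE x in M. F n x = 0"
proof -
  have "(\<integral>x. \<bar>f x\<bar> \<partial>M) = (\<integral>x. 0 \<partial>M)"
    using assms f(1) by (intro integral_cong_AE) auto
  then have "\<langle>T s f, \<lambda>x. 1\<rangle> = 0" if "s \<ge> 0" for s
    using abs_T_pairing_le[OF f(1) that, of "\<lambda>x. 1" 1] by simp
  then have "occupation f (real n) (\<lambda>x. 1) = (LBINT s:{0..real n}. 0)"
    unfolding occupation_def by (intro set_lebesgue_integral_cong) auto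
  then have zero: "(\<integral>x. F n x \<partial>M) = 0"
    using potential_ip[of "\<lambda>x. 1" n] by (simp add: ip_def)
  have nonneg: "AE x in M. 0 \<le> F n x" using potential_sequence_mono by eventually_elim simp
  show ?thesis using integral_nonneg_eq_0_iff_AE[OF potential_integrable nonneg] zero by simp
qed

end

text \<open>With \<open>u = (L + \<rho>)\<^sup>-\<^sup>1 p\<close> the generator identity reads
  \<open>\<integral>\<^sub>0\<^sup>r \<langle>T\<^sub>s f, p - \<rho> u\<rangle> ds = \<langle>f, u\<rangle> - \<langle>T\<^sub>r f, u\<rangle>\<close>.\<close>

context
  fixes f \<rho> p u :: "'a \<Rightarrow> real" and B :: real
  assumes f: "integrable M f" "AE x in M. 0 \<le> f x"
    and \<rho>: "weight \<rho>" and p: "p \<in> Linf M"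
    and u: "resolvent \<rho> p u" "\<And>x. 0 \<le> u x \<and> u x \<le> B"
begin

lemma resolvent_Linf: "u \<in> Linf M"
  using u(2) by (intro LinfI[of _ _ B] D_measurable gen_rel_mem[OF u(1)]) auto

lemma occupation_resolvent:
  assumes "r \<ge> 0"
  shows "occupation f r (\<lambda>x. \<rho> x * u x) = occupation f r p - \<langle>f, u\<rangle> + \<langle>T r f, u\<rangle>"
  using occupation_generator[OF f(1) resolvent_gen[OF \<rho> u(1)] resolvent_Linf _ assms]
    occupation_diff[OF f(1) p Linf_mult[OF weight_Linf[OF \<rho>] resolvent_Linf], of r]
    p weight_Linf[OF \<rho>] resolvent_Linf by simp

lemma occupation_resolvent_nonneg: "0 \<le> occupation f r (\<lambda>x. \<rho> x * u x)"
  using u(2) weight_pos[OF \<rho>]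
  by (intro occupation_nonneg f Linf_mult weight_Linf \<rho> resolvent_Linf) (simp add: less_imp_le)

lemma T_pairing_resolvent_le:
  assumes "r \<ge> 0"
  shows "\<langle>T r f, u\<rangle> \<le> B * (\<integral>x. f x \<partial>M)"
proof -
  have "(\<integral>x. \<bar>f x\<bar> \<partial>M) = (\<integral>x. f x \<partial>M)" using f by (intro integral_cong_AE) auto
  moreover have "0 \<le> B" using u(2)[of undefined] by linarith
  then have "\<bar>\<langle>T r f, u\<rangle>\<bar> \<le> B * (\<integral>x. \<bar>f x\<bar> \<partial>M)"
    using u(2) by (intro abs_T_pairing_le f assms) (auto intro: D_measurable gen_rel_mem[OF u(1)])
  ultimately show ?thesis by simp
qed

lemma occupation_resolvent_le:
  assumes "r \<ge> 0"
  shows "occupation f r (\<lambda>x. \<rho> x * u x) \<le> occupation f r p + B * (\<integral>x. f x \<partial>M)"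
proof -
  have "0 \<le> \<langle>f, u\<rangle>" using f(2) u(2) by (intro ip_nonneg) auto
  then show ?thesis
    using occupation_resolvent[OF assms] T_pairing_resolvent_le[OF assms] by linarith
qed

text \<open>Otherwise \<open>\<langle>T\<^sub>r f, u\<rangle>\<close> would stay above a positive constant, with infinite time integral.\<close>

lemma ip_resolvent_le_if_occupation_le:
  assumes bound: "\<And>r. r \<ge> 0 \<Longrightarrow> occupation f r p \<le> K"
  shows "\<langle>f, u\<rangle> \<le> K"
proof (rule ccontr)
  assume "\<not> \<langle>f, u\<rangle> \<le> K"
  define e where "e = \<langle>f, u\<rangle> - K"
  have e: "0 < e" using \<open>\<not> \<langle>f, u\<rangle> \<le> K\<close> by (simp add: e_def)
  obtain \<alpha> where \<alpha>: "0 < \<alpha>" "\<And>x. x \<in> space M \<Longrightarrow> \<alpha> \<le> \<rho> x" using \<rho> by (auto simp: weight_def)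
  have lower: "e \<le> \<langle>T s f, u\<rangle>" if "s \<ge> 0" for s
    using occupation_resolvent[OF that] occupation_resolvent_nonneg[of s] bound[OF that]
    unfolding e_def by linarith
  have "\<alpha> * (real n * e) \<le> K + B * (\<integral>x. f x \<partial>M)" for n
  proof -
    have "real n * e = (LBINT s:{0..real n}. e)" by (simp add: set_lebesgue_integral_def)
    also have "\<dots> \<le> occupation f (real n) u"
      unfolding occupation_def
    proof (rule set_integral_mono)
      show "set_integrable lborel {0..real n} (\<lambda>s. e)"
        by (intro borel_integrable_atLeastAtMost' continuous_on_const)
    qed (use lower T_pairing_set_integrable[OF f(1) resolvent_Linf] in auto)
    finally have "\<alpha> * (real n * e) \<le> occupation f (real n) (\<lambda>x. \<alpha> * u x)"
      using \<alpha>(1) by (simp add: occupation_scale)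
    also have "\<dots> \<le> occupation f (real n) (\<lambda>x. \<rho> x * u x)"
      using \<alpha>(2) u(2) Linf_mult[OF Linf_const resolvent_Linf]
        Linf_mult[OF weight_Linf[OF \<rho>] resolvent_Linf]
      by (intro occupation_mono f) (auto intro: mult_right_mono)
    also have "\<dots> \<le> K + B * (\<integral>x. f x \<partial>M)"
      using occupation_resolvent_le[of "real n"] bound[of "real n"] by simp
    finally show ?thesis .
  qed
  moreover obtain n :: nat where "(K + B * (\<integral>x. f x \<partial>M)) / (\<alpha> * e) < real n"
    using reals_Archimedean2 by blast
  then have "K + B * (\<integral>x. f x \<partial>M) < \<alpha> * (real n * e)"
    using \<alpha>(1) e by (simp add: pos_divide_less_eq mult_ac)
  ultimately show False by (simp add: not_less[symmetric])
qed

end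

end

section \<open>Invariant sets\<close>

context dirichlet_space
begin

definition resolvent_invariant :: "'a set \<Rightarrow> bool" where
  "resolvent_invariant A \<longleftrightarrow> (\<forall>\<beta>>0. \<forall>p\<in>L2 M. \<forall>v. resolvent (\<lambda>x. \<beta>) (\<lambda>x. indicator A x * p x) v \<longrightarrow>
     (AE x in M. x \<notin> A \<longrightarrow> v x = 0))"

lemma resolvent_invariantD:
  "resolvent_invariant A \<Longrightarrow> 0 < \<beta> \<Longrightarrow> p \<in> L2 M \<Longrightarrow> resolvent (\<lambda>x. \<beta>) (\<lambda>x. indicator A x * p x) v \<Longrightarrow>
    AE x in M. x \<notin> A \<longrightarrow> v x = 0"
  unfolding resolvent_invariant_def by blast

lemma resolvent_invariant_Compl:
  assumes A: "indicat_real A \<in> Linf M" "resolvent_invariant A"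
  shows "resolvent_invariant (- A)"
  unfolding resolvent_invariant_def
proof (intro allI impI ballI)
  fix \<beta> :: real and p v
  assume \<beta>: "0 < \<beta>" and p: "p \<in> L2 M" and v: "resolvent (\<lambda>x. \<beta>) (\<lambda>x. indicator (- A) x * p x) v"
  note vL = D_L2[OF gen_rel_mem[OF v]]
  let ?Av = "\<lambda>x. indicator A x * v x"
  have Av: "?Av \<in> L2 M" by (rule L2_Linf_mult[OF vL A(1)])
  obtain y where y: "resolvent (\<lambda>x. \<beta>) ?Av y" using ex_resolvent[OF weight_const[OF \<beta>] Av] .
  have "quad (ip M) ?Av = \<langle>?Av, v\<rangle>"
    unfolding ip_def by (intro Bochner_Integration.integral_cong) (auto simp: indicator_def)
  also have "\<dots> = \<langle>\<lambda>x. indicator (- A) x * p x, y\<rangle>"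
    by (rule resolvent_swap[OF weight_const[OF \<beta>] y v])
  also have "\<dots> = 0"
  proof (rule ip_eq_0_if_AE_mult_eq_0)
    show "AE x in M. indicator (- A) x * p x * y x = 0"
      using resolvent_invariantD[OF A(2) \<beta> vL y] by eventually_elim (auto simp: indicator_def)
  qed (auto intro: L2_measurable gen_rel_L2[OF v] D_measurable gen_rel_mem[OF y])
  finally have "AE x in M. ?Av x = 0" by (intro AE_eq_0_if_quad_ip_le_0 Av) simp
  then show "AE x in M. x \<notin> - A \<longrightarrow> v x = 0" by eventually_elim (auto simp: indicator_def)
qed

lemma resolvent_sequence_diff:
  assumes "resolvent_sequence f v" "resolvent_sequence f' v'"
  shows "resolvent_sequence (\<lambda>x. f x - f' x) (\<lambda>n x. v n x - v' n x)"
  unfolding resolvent_sequence_def right_diff_distrib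
  using assms by (auto simp: resolvent_sequence_def intro!: resolvent_diff weight_const)

lemma restriction_mem_if_orthogonal_splitting:
  assumes A: "indicat_real A \<in> Linf M" and a: "\<And>n. a n \<in> D" "\<And>n. AE x in M. x \<notin> A \<longrightarrow> a n x = 0"
    and b: "\<And>n. b n \<in> D" "\<And>n. AE x in M. x \<in> A \<longrightarrow> b n x = 0" and orth: "\<And>n m. Q (a n) (b m) = 0"
    and v: "\<And>n x. v n x = a n x + b n x" and p: "p \<in> L2 M" and "form_Cauchy Q v"
    and lim: "(\<lambda>n. quad (ip M) (\<lambda>x. v n x - p x)) \<longlonglongrightarrow> 0"
  shows "(\<lambda>x. indicator A x * p x) \<in> D"
    and "(\<lambda>n. quad Q (\<lambda>x. a n x - indicator A x * p x)) \<longlonglongrightarrow> 0"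
proof -
  have "quad Q (\<lambda>x. a n x - a m x) \<le> 1 * quad Q (\<lambda>x. v n x - v m x)" for n m
  proof -
    have "(\<lambda>x. v n x - v m x) = (\<lambda>x. (a n x - a m x) + (b n x - b m x))" by (auto simp: v)
    then have "quad Q (\<lambda>x. v n x - v m x) = quad Q (\<lambda>x. a n x - a m x) + quad Q (\<lambda>x. b n x - b m x)"
      by (simp add: Q.quad_add Q.diff_left Q.diff_right a(1) b(1) orth)
    then show ?thesis using Q.quad_nonneg[OF Q.diff_mem[OF b(1) b(1)], of n m] by simp
  qed
  then have Cauchy: "form_Cauchy Q a"
    by (rule form_Cauchy_if_quad_le[OF \<open>form_Cauchy Q v\<close> zero_less_one])
  have Ap: "(\<lambda>x. indicator A x * p x) \<in> L2 M" by (rule L2_Linf_mult[OF p A])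
  have "quad (ip M) (\<lambda>x. a n x - indicator A x * p x) \<le> quad (ip M) (\<lambda>x. v n x - p x)" for n
    unfolding quad_ip
  proof (rule integral_mono_AE)
    show "AE x in M. (a n x - indicator A x * p x)\<^sup>2 \<le> (v n x - p x)\<^sup>2"
      using a(2)[of n] b(2)[of n] by eventually_elim (auto simp: v indicator_def)
    have "v n \<in> L2 M" using a(1) b(1) by (simp add: v[abs_def] D_L2)
    then show "integrable M (\<lambda>x. (v n x - p x)\<^sup>2)" by (intro L2_integrable_square L2.diff_mem p)
  qed (intro L2_integrable_square L2.diff_mem Ap D_L2 a(1))
  then have "(\<lambda>n. quad (ip M) (\<lambda>x. a n x - indicator A x * p x)) \<longlonglongrightarrow> 0"
    by (intro Lim_null_comparison[OF always_eventually lim] allI) simp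
  note D_closed[OF a(1) Cauchy Ap this]
  then show "(\<lambda>x. indicator A x * p x) \<in> D"
    "(\<lambda>n. quad Q (\<lambda>x. a n x - indicator A x * p x)) \<longlonglongrightarrow> 0" by -
qed

lemma AE_resolvent_sequence_eq_0:
  assumes "resolvent_invariant A" and f: "f \<in> L2 M"
    and v: "resolvent_sequence (\<lambda>x. indicator A x * f x) v"
  shows "AE x in M. x \<notin> A \<longrightarrow> v n x = 0"
  using v by (intro resolvent_invariantD[OF assms(1) _ L2.scale_mem[OF f, of "real n + 1"]])
    (auto simp: resolvent_sequence_def mult.left_commute add_nonneg_pos)

text \<open>If the resolvents preserve functions supported in \<open>A\<close>, then by symmetry they also preserve
  functions supported off \<open>A\<close>, so they commute with multiplication by the indicator of \<open>A\<close>.\<close>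

lemma ex_orthogonal_resolvent_splitting:
  assumes A: "indicat_real A \<in> Linf M" "resolvent_invariant A" and f: "f \<in> L2 M"
  obtains a b where "resolvent_sequence f (\<lambda>n x. a n x + b n x)" "\<And>n. a n \<in> D" "\<And>n. b n \<in> D"
    "\<And>n. AE x in M. x \<notin> A \<longrightarrow> a n x = 0" "\<And>n. AE x in M. x \<in> A \<longrightarrow> b n x = 0" "\<And>n m. Q (a n) (b m) = 0"
proof -
  let ?fA = "\<lambda>x. indicator A x * f x" and ?fB = "\<lambda>x. indicator (- A) x * f x"
  obtain v where v: "resolvent_sequence f v" using ex_resolvent_sequence[OF f] .
  obtain a where a: "resolvent_sequence ?fA a"
    using ex_resolvent_sequence[OF L2_Linf_mult[OF f A(1)]] .
  define b where "b n x = v n x - a n x" for n x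
  have "(\<lambda>x. f x - ?fA x) = ?fB" by (auto simp: indicator_def)
  then have b: "resolvent_sequence ?fB b"
    using resolvent_sequence_diff[OF v a] by (simp add: b_def[abs_def])
  note aD = resolvent_sequence_mem[OF a] and bD = resolvent_sequence_mem[OF b]
  have a0: "AE x in M. x \<notin> A \<longrightarrow> a n x = 0" for n by (rule AE_resolvent_sequence_eq_0[OF A(2) f a])
  have b0: "AE x in M. x \<in> A \<longrightarrow> b n x = 0" for n
    using AE_resolvent_sequence_eq_0[OF resolvent_invariant_Compl[OF A] f b] by simp
  have orth: "Q (a n) (b m) = 0" for n m
    unfolding gen_rel_form[OF resolvent_sequence_gen[OF a] bD]
  proof (rule ip_eq_0_if_AE_mult_eq_0)
    show "AE x in M. (real n + 1) * (?fA x - a n x) * b m x = 0"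
      using a0[of n] b0[of m] by eventually_elim (auto simp: indicator_def)
  qed (auto intro: L2_measurable gen_rel_L2[OF resolvent_sequence_gen[OF a]] D_measurable bD)
  from v have "resolvent_sequence f (\<lambda>n x. a n x + b n x)" by (simp add: b_def)
  then show ?thesis by (rule that[OF _ aD bD a0 b0 orth])
qed

lemma quad_restriction_splitting:
  assumes A: "indicat_real A \<in> Linf M" "resolvent_invariant A" and f: "f \<in> D"
  shows "(\<lambda>x. indicator A x * f x) \<in> D" "(\<lambda>x. indicator (- A) x * f x) \<in> D"
    and "quad Q f = quad Q (\<lambda>x. indicator A x * f x) + quad Q (\<lambda>x. indicator (- A) x * f x)"
proof -
  let ?fA = "\<lambda>x. indicator A x * f x" and ?fB = "\<lambda>x. indicator (- A) x * f x"
  have B: "indicat_real (- A) \<in> Linf M"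
  proof -
    have "indicat_real (- A) = (\<lambda>x. 1 - indicator A x)" by (auto simp: indicator_def)
    then show ?thesis using Linf_diff[OF Linf_const[of 1] A(1)] by simp
  qed
  note fL = D_L2[OF f]
  obtain a b where v: "resolvent_sequence f (\<lambda>n x. a n x + b n x)" and aD: "\<And>n. a n \<in> D"
    and bD: "\<And>n. b n \<in> D" and a0: "\<And>n. AE x in M. x \<notin> A \<longrightarrow> a n x = 0"
    and b0: "\<And>n. AE x in M. x \<in> A \<longrightarrow> b n x = 0" and orth: "\<And>n m. Q (a n) (b m) = 0"
    by (rule ex_orthogonal_resolvent_splitting[OF A fL]) blast
  note v_lim = resolvent_sequence_Cauchy[OF f v] resolvent_sequence_L2_tendsto[OF f v]
  note fA = restriction_mem_if_orthogonal_splitting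
    [where a = a and b = b, OF A(1) aD a0 bD b0 orth refl fL v_lim]
  have a0': "AE x in M. x \<in> - A \<longrightarrow> a n x = 0" and b0': "AE x in M. x \<notin> - A \<longrightarrow> b n x = 0" for n
    using a0[of n] b0[of n] by simp_all
  have orth': "Q (b n) (a m) = 0" for n m using orth Q.sym[OF aD bD] by simp
  note fB = restriction_mem_if_orthogonal_splitting
    [where a = b and b = a, OF B bD b0' aD a0' orth' add.commute fL v_lim]
  show mem: "?fA \<in> D" "?fB \<in> D" by (fact fA(1), fact fB(1))
  have "Q ?fA (b m) = 0" for m
    using Q.tendsto_left[OF _ mem(1) bD fA(2), of m] aD by (simp add: orth LIMSEQ_const_iff)
  then have "Q ?fA ?fB = 0"
    using Q.tendsto_left[OF _ mem(2,1) fB(2)] bD mem by (simp add: Q.sym[of _ ?fA] LIMSEQ_const_iff)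
  then have "quad Q (\<lambda>x. ?fA x + ?fB x) = quad Q ?fA + quad Q ?fB" using Q.quad_add[OF mem] by simp
  moreover have "(\<lambda>x. ?fA x + ?fB x) = f" by (auto simp: indicator_def)
  ultimately show "quad Q f = quad Q ?fA + quad Q ?fB" by simp
qed

lemma invariant_set_if_resolvent_invariant:
  assumes A: "A \<in> sets M" and inv: "resolvent_invariant A"
  shows "invariant_set M D Q A"
  unfolding invariant_set_def
proof (intro conjI ballI A)
  fix f assume f: "f \<in> D"
  note split = quad_restriction_splitting[OF Linf_indicator[OF A] inv f]
  show "(\<lambda>x. indicator A x * f x) \<in> D" by (fact split(1))
  have "quad Q (\<lambda>x. indicator (space M - A) x * f x) = quad Q (\<lambda>x. indicator (- A) x * f x)"
    using A f D_measurable[OF f]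
    by (intro quad_cong[OF split(2)]) (auto intro!: AE_I2 simp: indicator_def)
  with split(3) show "quad Q f = quad Q (\<lambda>x. indicator A x * f x)
      + quad Q (\<lambda>x. indicator (space M - A) x * f x)" by simp
qed

end

context dirichlet_semigroup
begin

context
  fixes f :: "'a \<Rightarrow> real" and F :: "nat \<Rightarrow> 'a \<Rightarrow> real"
  assumes f: "integrable M f" "AE x in M. 0 \<le> f x" and F: "potential_sequence f F"
begin

lemma resolvent_eq_0_on_unbounded_set:
  assumes h: "integrable M h" "\<And>x. 0 \<le> h x \<and> h x \<le> 1" "\<And>n. \<langle>F n, h\<rangle> \<le> K" and "0 < \<beta>"
    and s: "\<And>x. \<bar>s x\<bar> \<le> h x" "resolvent (\<lambda>x. \<beta>) s u"
  shows "AE x in M. x \<in> unbounded_set M F \<longrightarrow> u x = 0"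
proof -
  note \<beta> = weight_const[OF \<open>0 < \<beta>\<close>]
  have hI: "h \<in> Linf M" using h by (intro LinfI[of _ _ 1]) auto
  obtain y where y: "resolvent (\<lambda>x. \<beta>) h y" "\<And>x. 0 \<le> y x \<and> y x \<le> 1 / \<beta>"
  proof (rule ex_resolvent_between[OF \<beta> L2_if_integrable_Linf[OF h(1) hI], of "1 / \<beta>"])
    show "AE x in M. 0 \<le> h x \<and> h x \<le> 1 / \<beta> * \<beta>" using h(2) \<open>0 < \<beta>\<close> by simp
  qed (use \<open>0 < \<beta>\<close> in auto)
  note yI = resolvent_Linf[OF f \<beta> hI y]
  have "AE x in M. x \<in> unbounded_set M F \<longrightarrow> y x = 0"
  proof (rule AE_eq_0_on_unbounded_set[OF potential_integrable[OF f F]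
        potential_sequence_mono[OF f F] yI])
    show "0 \<le> y x" for x using y(2) by simp
    show "\<langle>F n, y\<rangle> \<le> (K + 1 / \<beta> * (\<integral>x. f x \<partial>M)) / \<beta>" for n
    proof -
      have "\<beta> * occupation f (real n) y \<le> K + 1 / \<beta> * (\<integral>x. f x \<partial>M)"
        using occupation_resolvent_le[OF f \<beta> hI y, of "real n"] h(3)[of n]
        by (simp add: potential_ip[OF f F] hI occupation_scale)
      then show ?thesis
        using \<open>0 < \<beta>\<close> by (simp add: potential_ip[OF f F] yI pos_le_divide_eq mult.commute)
    qed
  qed
  moreover have "AE x in M. \<bar>u x\<bar> \<le> y x" using s(1) by (intro resolvent_abs_le[OF \<beta> s(2) y(1)]) simp
  ultimately show ?thesis by eventually_elim auto
qed

lemma invariant_unbounded_set: "invariant_set M D Q (unbounded_set M F)"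
proof (rule invariant_set_if_resolvent_invariant)
  let ?U = "unbounded_set M F"
  note Fi = potential_integrable[OF f F]
  show "?U \<in> sets M" using Fi by (intro unbounded_set_measurable) simp
  obtain h K where h: "integrable M h" "\<And>x. 0 \<le> h x \<and> h x \<le> 1"
    and h_zero: "\<And>x. x \<in> space M \<Longrightarrow> h x = 0 \<longleftrightarrow> x \<in> ?U" and hK: "\<And>n. \<langle>F n, h\<rangle> \<le> K"
    by (rule ex_weight_bounding_sequence[of F, OF Fi]) blast
  have hL: "h \<in> L2 M" using h by (intro L2_if_integrable_Linf LinfI[of _ _ 1]) auto
  show "resolvent_invariant ?U"
    unfolding resolvent_invariant_def
  proof (intro allI impI ballI)
    fix \<beta> :: real and p v
    assume \<beta>: "0 < \<beta>" and v: "resolvent (\<lambda>x. \<beta>) (\<lambda>x. indicator ?U x * p x) v"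
    have vL: "v \<in> L2 M" by (rule D_L2[OF gen_rel_mem[OF v]])
    define s where "s x = sgn (v x) * h x" for x
    have s_le: "\<bar>s x\<bar> \<le> h x" for x using h(2)[of x] by (simp add: s_def abs_mult sgn_if)
    have s: "s \<in> L2 M"
      using vL hL s_le h(2) by (intro L2_dominated[OF hL])
        (auto simp: s_def[abs_def] intro: order_trans)
    have sv: "s x * v x = \<bar>v x\<bar> * h x" for x by (simp add: s_def abs_sgn mult_ac)
    obtain u where u: "resolvent (\<lambda>x. \<beta>) s u" using ex_resolvent[OF weight_const[OF \<beta>] s] .
    have "\<langle>s, v\<rangle> = \<langle>\<lambda>x. indicator ?U x * p x, u\<rangle>"
      by (rule resolvent_swap[OF weight_const[OF \<beta>] u v])
    also have "\<dots> = 0"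
    proof (rule ip_eq_0_if_AE_mult_eq_0)
      show "AE x in M. indicator ?U x * p x * u x = 0"
        using resolvent_eq_0_on_unbounded_set[OF h hK \<beta> s_le u]
        by eventually_elim (auto simp: indicator_def)
    qed (auto intro: L2_measurable gen_rel_L2[OF v] D_measurable gen_rel_mem[OF u])
    finally have "(\<integral>x. \<bar>v x\<bar> * h x \<partial>M) = 0" by (simp add: ip_def sv)
    then have "AE x in M. \<bar>v x\<bar> * h x = 0"
      using L2_mult_integrable[OF s vL] h(2)
      by (subst (asm) integral_nonneg_eq_0_iff_AE) (auto simp: sv)
    then show "AE x in M. x \<notin> ?U \<longrightarrow> v x = 0"
      using AE_space by eventually_elim (auto simp: h_zero)
  qed
qed

end

end

section \<open>Characterisations of recurrence\<close>

context dirichlet_semigroup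
begin

lemma AE_eq_0_if_int_semigroup_eq_0:
  assumes g: "integrable M g" "\<And>x. 0 \<le> g x" "g \<in> Linf M"
    and F: "is_int_semigroup M T g r F" "AE x in M. F x = 0" and "0 < r"
  shows "AE x in M. g x = 0"
proof -
  have gL: "g \<in> L2 M" by (rule L2_if_integrable_Linf[OF g(1,3)])
  have cont: "continuous_on {0..r} (\<lambda>s. \<langle>T s g, g\<rangle>)"
    by (rule continuous_on_subset[OF T_pairing_continuous[OF gL gL]]) auto
  have "\<langle>F, g\<rangle> = 0"
    using F g int_semigroup_integrable[OF F(1)] by (intro ip_eq_0_if_AE_mult_eq_0) auto
  then have "occupation g r g = 0" by (simp add: int_semigroup_ip[OF F(1) g(3)])
  then have "((\<lambda>s. \<langle>T s g, g\<rangle>) has_integral 0) (cbox 0 r)"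
    using set_borel_integral_eq_integral[OF T_pairing_set_integrable[OF g(1,3)], of r]
    by (simp add: occupation_def has_integral_integrable_integral)
  then have "\<langle>T 0 g, g\<rangle> = 0"
    using cont T_pairing_nonneg[OF g(1) AE_I2 _ g(2)] g(2) \<open>0 < r\<close>
    by (intro has_integral_0_cbox_imp_0[of 0 r "\<lambda>s. \<langle>T s g, g\<rangle>"]) auto
  moreover have "\<langle>T 0 g, g\<rangle> = \<langle>g, g\<rangle>"
    using T_0[OF gL] L2_measurable[OF T_L2[OF gL]] L2_measurable[OF gL]
    by (intro ip_cong_AE) auto
  ultimately show ?thesis by (intro AE_eq_0_if_quad_ip_le_0 gL) simp
qed

lemma AE_unbounded_potential_if_recurrent:
  assumes rec: "recurrent M T" and g: "integrable M g" "\<And>x. 0 < g x" "g \<in> Linf M"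
    and F: "potential_sequence g F"
  shows "AE x in M. x \<in> unbounded_set M F"
proof -
  have g_nonneg: "\<And>x. 0 \<le> g x" "AE x in M. 0 \<le> g x" using g(2) by (auto intro: less_imp_le)
  note mono = potential_sequence_mono[OF g(1) g_nonneg(2) F]
  define G where "G x = (SUP n. ereal (F n x))" for x
  have "AE x in M. (\<lambda>n. ereal (F n x)) \<longlonglongrightarrow> G x"
    using mono
  proof eventually_elim
    case (elim x)
    then have "incseq (\<lambda>n. ereal (F n x))" by (intro incseq_SucI) simp
    then show ?case unfolding G_def by (rule LIMSEQ_SUP)
  qed
  then have "is_Green M T g G" using F unfolding is_Green_def potential_sequence_def by blast
  with rec g(1) g_nonneg(2) have "(AE x in M. G x = 0) \<or> (AE x in M. G x = \<infinity>)"
    unfolding recurrent_def L1_def by blast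
  then show ?thesis
  proof
    assume "AE x in M. G x = 0"
    then have "AE x in M. F 1 x = 0"
      using mono
    proof eventually_elim
      case (elim x)
      have "ereal (F 1 x) \<le> G x" unfolding G_def by (rule SUP_upper) simp
      then show ?case using elim by (simp add: zero_ereal_def antisym)
    qed
    moreover have "is_int_semigroup M T g 1 (F 1)"
      using F unfolding potential_sequence_def by (metis of_nat_1)
    ultimately have "AE x in M. g x = 0"
      using AE_eq_0_if_int_semigroup_eq_0[OF g(1) g_nonneg(1) g(3)] by simp
    then show ?thesis by eventually_elim (metis g(2) less_irrefl)
  next
    assume "AE x in M. G x = \<infinity>"
    then show ?thesis
      using AE_space
    proof eventually_elim
      case (elim x)
      have "ereal (real k) < (SUP n. ereal (F n x))" for k :: nat using elim(1) by (simp add: G_def)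
      then show ?case using elim(2) by (simp add: unbounded_set_def less_SUP_iff)
    qed
  qed
qed

lemma potential_equilibrium_le:
  assumes g: "integrable M g" "\<And>x. 0 \<le> g x \<and> g x \<le> 1" and F: "potential_sequence g F"
    and u: "equilibrium g a u" "0 < a"
  shows "\<langle>F n, \<lambda>x. g x * (1 - u x)\<rangle> \<le> (\<integral>x. g x \<partial>M) + a * (\<integral>x. F n x \<partial>M)"
proof -
  let ?w = "\<lambda>x. g x * (1 - u x)" and ?r = "real n"
  have g_nonneg: "AE x in M. 0 \<le> g x" using g(2) by simp
  note uI = equilibrium_Linf[OF u(1)] and u01 = equilibrium_unit[OF u(1)]
  have w: "?w \<in> Linf M" by (intro Linf_mult Linf_diff Linf_const unit_density_Linf[OF g] uI)
  have au: "(\<lambda>x. a * u x) \<in> Linf M" by (intro Linf_mult Linf_const uI)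
  have "occupation g ?r ?w - a * occupation g ?r u = \<langle>g, u\<rangle> - \<langle>T ?r g, u\<rangle>"
    using occupation_generator[OF g(1) equilibrium_gen[OF g u] uI Linf_diff[OF w au], of ?r]
    by (simp add: occupation_diff[OF g(1) w au] occupation_scale)
  moreover have "0 \<le> \<langle>T ?r g, u\<rangle>" using u01 by (intro T_pairing_nonneg g g_nonneg) auto
  moreover have "\<langle>g, u\<rangle> \<le> (\<integral>x. g x \<partial>M)" using u01 by (intro ip_unit_density_le[OF g] uI) auto
  moreover have "occupation g ?r u \<le> occupation g ?r (\<lambda>x. 1)"
    using u01 by (intro occupation_mono g g_nonneg uI Linf_const) auto
  then have "a * occupation g ?r u \<le> a * (\<integral>x. F n x \<partial>M)"
    using u(2) potential_ip[OF g(1) g_nonneg F, of "\<lambda>x. 1" n] by (simp add: ip_def)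
  ultimately show ?thesis by (simp add: potential_ip[OF g(1) g_nonneg F w])
qed

lemma potential_equilibrium_limit_le:
  assumes g: "integrable M g" "\<And>x. 0 \<le> g x \<and> g x \<le> 1" and F: "potential_sequence g F"
    and u: "equilibrium_sequence g u" and e: "e \<in> Linf M" "AE x in M. (\<lambda>k. u k x) \<longlonglongrightarrow> e x"
  shows "\<langle>F n, \<lambda>x. g x * (1 - e x)\<rangle> \<le> (\<integral>x. g x \<partial>M)"
proof (rule LIMSEQ_le)
  note un = equilibrium_sequence_nth[OF g u] and gI = unit_density_Linf[OF g]
  have g_nonneg: "AE x in M. 0 \<le> g x" using g(2) by simp
  show "(\<lambda>k. \<langle>F n, \<lambda>x. g x * (1 - u k x)\<rangle>) \<longlonglongrightarrow> \<langle>F n, \<lambda>x. g x * (1 - e x)\<rangle>"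
  proof (rule ip_tendsto_if_bounded[OF potential_integrable[OF g(1) g_nonneg F]])
    show "\<bar>g x * (1 - u k x)\<bar> \<le> 1" for k x
      using g(2)[of x] equilibrium_unit[OF un, of k x] by (simp add: abs_mult mult_le_one)
    show "AE x in M. (\<lambda>k. g x * (1 - u k x)) \<longlonglongrightarrow> g x * (1 - e x)"
      using e(2) by eventually_elim (intro tendsto_intros)
    show "(\<lambda>x. g x * (1 - u k x)) \<in> borel_measurable M"
      "(\<lambda>x. g x * (1 - e x)) \<in> borel_measurable M" for k
      by (intro Linf_measurable Linf_mult Linf_diff Linf_const gI e(1) equilibrium_Linf[OF un])+
  qed
  show "(\<lambda>k. (\<integral>x. g x \<partial>M) + inverse (real k + 1) * (\<integral>x. F n x \<partial>M)) \<longlonglongrightarrow> (\<integral>x. g x \<partial>M)"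
    using tendsto_add[OF tendsto_const tendsto_mult_left_zero[OF inverse_nat_add_1_tendsto_0]]
    by simp
  show "\<exists>N. \<forall>k\<ge>N. \<langle>F n, \<lambda>x. g x * (1 - u k x)\<rangle>
      \<le> (\<integral>x. g x \<partial>M) + inverse (real k + 1) * (\<integral>x. F n x \<partial>M)"
    using potential_equilibrium_le[OF g F un] by simp
qed

lemma ext_gen_rel_one_if_recurrent:
  assumes rec: "recurrent M T"
  shows "ext_gen_rel M D Q (\<lambda>x. 1) (\<lambda>x. 0)"
proof -
  obtain g :: "'a \<Rightarrow> real" where g: "integrable M g" "\<And>x. 0 < g x" "\<And>x. g x \<le> 1"
    using obtain_positive_integrable_function by metis
  have g01: "\<And>x. 0 \<le> g x \<and> g x \<le> 1" and g_nonneg: "AE x in M. 0 \<le> g x"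
    using g(2,3) by (auto intro: less_imp_le)
  note gI = unit_density_Linf[OF g(1) g01]
  obtain F where F: "potential_sequence g F" using ex_potential_sequence[OF g(1) g_nonneg] .
  note Fi = potential_integrable[OF g(1) g_nonneg F]
  obtain u where u: "equilibrium_sequence g u" using ex_equilibrium_sequence[OF g(1) g01] .
  note un = equilibrium_sequence_nth[OF g(1) g01 u]
  obtain e where e: "e \<in> Linf M" "\<And>x. 0 \<le> e x \<and> e x \<le> 1" "AE x in M. (\<lambda>k. u k x) \<longlonglongrightarrow> e x"
    by (rule equilibrium_sequence_limit[OF g(1) g01 u]) blast
  let ?w = "\<lambda>x. g x * (1 - e x)"
  have w: "?w \<in> Linf M" by (intro Linf_mult Linf_diff Linf_const gI e(1))
  have "\<langle>F n, ?w\<rangle> \<le> (\<integral>x. g x \<partial>M)" for n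
    by (rule potential_equilibrium_limit_le[OF g(1) g01 F u e(1,3)])
  then have "AE x in M. x \<in> unbounded_set M F \<longrightarrow> ?w x = 0"
    using e(2) g01
    by (intro AE_eq_0_on_unbounded_set[OF Fi potential_sequence_mono[OF g(1) g_nonneg F] w]) auto
  with AE_unbounded_potential_if_recurrent[OF rec g(1,2) gI F] e(3)
  have "AE x in M. (\<lambda>k. u k x) \<longlonglongrightarrow> 1"
  proof eventually_elim
    case (elim x)
    then have "e x = 1" using g(2)[of x] by simp
    with elim show ?case by simp
  qed
  from ext_gen_rel_equilibrium_limit[OF g(1) g01 u Linf_const this] show ?thesis by simp
qed

lemma integral_le_if_occupation_le:
  assumes zero: "\<forall>v w. ext_gen_rel M D Q v w \<and> integrable M w \<longrightarrow> (\<integral>x. w x \<partial>M) = 0"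
    and f: "integrable M f" "AE x in M. 0 \<le> f x"
    and g: "integrable M g" "\<And>x. 0 \<le> g x \<and> g x \<le> 1" "AE x in M. 0 < g x"
    and bound: "\<And>r. r \<ge> 0 \<Longrightarrow> occupation f r g \<le> K"
  shows "(\<integral>x. f x \<partial>M) \<le> K"
proof -
  obtain u where u: "equilibrium_sequence g u" using ex_equilibrium_sequence[OF g(1,2)] .
  note un = equilibrium_sequence_nth[OF g(1,2) u]
  have one: "AE x in M. (\<lambda>n. u n x) \<longlonglongrightarrow> 1"
    using equilibrium_sequence_tendsto_1_if_integral_generator_eq_0[OF g(1,2) u zero] g(3)
    by eventually_elim simp
  have "\<langle>f, u n\<rangle> \<le> K" for n
  proof (rule ip_resolvent_le_if_occupation_le[OF f])
    show "weight (\<lambda>x. g x + inverse (real n + 1))" by (rule weight_equilibrium[OF g(1,2)]) simp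
    show "resolvent (\<lambda>x. g x + inverse (real n + 1)) g (u n)" by (rule equilibrium_resolvent[OF un])
    show "0 \<le> u n x \<and> u n x \<le> 1" for x by (rule equilibrium_unit[OF un])
  qed (fact unit_density_Linf[OF g(1,2)] bound)+
  moreover have "(\<lambda>n. \<langle>f, u n\<rangle>) \<longlonglongrightarrow> \<langle>f, \<lambda>x. 1\<rangle>"
    using equilibrium_unit[OF un] Linf_measurable[OF equilibrium_Linf[OF un]] one
    by (intro ip_tendsto_if_bounded[OF f(1), where B = 1]) auto
  ultimately have "\<langle>f, \<lambda>x. 1\<rangle> \<le> K" by (intro LIMSEQ_le_const2) auto
  then show ?thesis by (simp add: ip_def)
qed

lemma AE_eq_0_if_bounded_potential:
  assumes zero: "\<forall>v w. ext_gen_rel M D Q v w \<and> integrable M w \<longrightarrow> (\<integral>x. w x \<partial>M) = 0"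
    and f: "integrable M f" "AE x in M. 0 \<le> f x" and F: "potential_sequence f F"
    and bounded: "AE x in M. x \<notin> unbounded_set M F"
  shows "AE x in M. f x = 0"
proof -
  obtain h K where h: "integrable M h" "\<And>x. 0 \<le> h x \<and> h x \<le> 1"
    and h_zero: "\<And>x. x \<in> space M \<Longrightarrow> h x = 0 \<longleftrightarrow> x \<in> unbounded_set M F"
    and hK: "\<And>n. \<langle>F n, h\<rangle> \<le> K"
    by (rule ex_weight_bounding_sequence[of F, OF potential_integrable[OF f F]]) blast
  have hI: "h \<in> Linf M" by (rule unit_density_Linf[OF h])
  have pos: "AE x in M. 0 < h x"
    using bounded AE_space
  proof eventually_elim
    case (elim x)
    then show ?case using h(2)[of x] h_zero[of x] by (simp add: order_less_le)
  qed
  have occ: "occupation f r h \<le> K" if "r \<ge> 0" for r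
  proof -
    obtain n :: nat where "r \<le> real n" using real_arch_simple by blast
    then have "occupation f r h \<le> occupation f (real n) h"
      using h(2) by (intro occupation_mono_time f hI) auto
    also have "\<dots> \<le> K" using hK[of n] by (simp add: potential_ip[OF f F hI])
    finally show ?thesis .
  qed
  have "(\<integral>x. f x \<partial>M) \<le> inverse (real n + 1) * K" for n
  proof (rule integral_le_if_occupation_le[OF zero f])
    let ?\<kappa> = "inverse (real n + 1)"
    have "?\<kappa> \<le> 1" using le_imp_inverse_le[of 1 "real n + 1"] by simp
    then show "0 \<le> ?\<kappa> * h x \<and> ?\<kappa> * h x \<le> 1" for x using h(2)[of x] by (auto intro: mult_le_one)
    show "integrable M (\<lambda>x. ?\<kappa> * h x)" using h(1) by simp
    show "AE x in M. 0 < ?\<kappa> * h x" using pos by eventually_elim (simp add: add_nonneg_pos)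
    show "occupation f r (\<lambda>x. ?\<kappa> * h x) \<le> ?\<kappa> * K" if "r \<ge> 0" for r
      using occ[OF that] by (simp add: occupation_scale mult_left_mono)
  qed
  then have "(\<integral>x. f x \<partial>M) \<le> 0"
    by (intro LIMSEQ_le_const[OF tendsto_mult_left_zero[OF inverse_nat_add_1_tendsto_0]]) auto
  then have "(\<integral>x. f x \<partial>M) = 0" using integral_nonneg_AE[OF f(2)] by simp
  then show ?thesis using integral_nonneg_eq_0_iff_AE[OF f] by simp
qed

lemma recurrent_if_integral_generator_eq_0:
  assumes irr: "irreducible_form M D Q"
    and zero: "\<forall>v w. ext_gen_rel M D Q v w \<and> integrable M w \<longrightarrow> (\<integral>x. w x \<partial>M) = 0"
  shows "recurrent M T"
  unfolding recurrent_def
proof (intro ballI impI allI)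
  fix f G assume "f \<in> L1 M" and f_nonneg: "AE x in M. 0 \<le> f x" and "is_Green M T f G"
  then have f: "integrable M f" by (simp add: L1_def)
  obtain F where F: "potential_sequence f F" and lim: "AE x in M. (\<lambda>n. ereal (F n x)) \<longlonglongrightarrow> G x"
    using \<open>is_Green M T f G\<close> unfolding is_Green_def potential_sequence_def by blast
  let ?U = "unbounded_set M F"
  have "?U \<in> sets M"
    using potential_integrable[OF f f_nonneg F] by (intro unbounded_set_measurable) simp
  have "emeasure M ?U = 0 \<or> emeasure M (space M - ?U) = 0"
    using irr invariant_unbounded_set[OF f f_nonneg F] by (simp add: irreducible_form_def)
  then show "(AE x in M. G x = 0) \<or> (AE x in M. G x = \<infinity>)"
  proof
    assume "emeasure M (space M - ?U) = 0"
    then have "AE x in M. x \<in> ?U"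
      using \<open>?U \<in> sets M\<close> by (intro AE_I[of _ _ "space M - ?U"]) auto
    then have "AE x in M. G x = \<infinity>"
      using lim potential_sequence_mono[OF f f_nonneg F]
      by eventually_elim (rule limit_eq_infinity_on_unbounded_set, auto)
    then show ?thesis ..
  next
    assume "emeasure M ?U = 0"
    then have "AE x in M. x \<notin> ?U" using \<open>?U \<in> sets M\<close> by (intro AE_I[of _ _ ?U]) auto
    then have "AE x in M. f x = 0"
      by (rule AE_eq_0_if_bounded_potential[OF zero f f_nonneg F])
    then have "AE x in M. \<forall>n. F n x = 0"
      unfolding AE_all_countable using potential_eq_0_if_AE_eq_0[OF f f_nonneg F] by blast
    with lim have "AE x in M. G x = 0"
    proof eventually_elim
      case (elim x)
      then show ?case by (simp add: LIMSEQ_const_iff flip: zero_ereal_def)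
    qed
    then show ?thesis ..
  qed
qed

end

theorem mainTheorem6:
  fixes M :: "'a measure" and D :: "('a \<Rightarrow> real) set"
    and Q :: "('a \<Rightarrow> real) \<Rightarrow> ('a \<Rightarrow> real) \<Rightarrow> real"
    and T :: "real \<Rightarrow> ('a \<Rightarrow> real) \<Rightarrow> ('a \<Rightarrow> real)"
  assumes "sigma_finite_measure M"
    and "dirichlet_form M D Q"
    and "irreducible_form M D Q"
    and "semigroup_of M D Q T"
  shows "(recurrent M T \<longleftrightarrow>
           (\<forall>u w. ext_gen_rel M D Q u w \<and> integrable M w \<longrightarrow> (\<integral>x. w x \<partial>M) = 0))
       \<and> (recurrent M T \<longleftrightarrow> ext_gen_rel M D Q (\<lambda>x. 1) (\<lambda>x. 0))"
proof -
  interpret sigma_finite_measure M by (rule assms(1))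
  interpret dirichlet_semigroup M D Q T
    by unfold_locales (rule assms(2), rule assms(4))
  have "recurrent M T \<Longrightarrow> ext_gen_rel M D Q (\<lambda>x. 1) (\<lambda>x. 0)"
    by (rule ext_gen_rel_one_if_recurrent)
  moreover have "(\<integral>x. w x \<partial>M) = 0"
    if "ext_gen_rel M D Q (\<lambda>x. 1) (\<lambda>x. 0)" "ext_gen_rel M D Q u w" "integrable M w" for u w
    using that by (rule integral_generator_eq_0)
  moreover have "recurrent M T"
    if "\<forall>u w. ext_gen_rel M D Q u w \<and> integrable M w \<longrightarrow> (\<integral>x. w x \<partial>M) = 0"
    by (rule recurrent_if_integral_generator_eq_0[OF assms(3) that])
  ultimately show ?thesis by blast
qed

end
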